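(* Let $(A,A^* )$ be a Lie bialgebroid over a smooth manifold $M$ and let $E=A\oplus A^*$ be the Courant algebroid that is its double. Then the modular class of $E$ vanishes, i.e. $[\theta_{\wedge^{\mathrm{top}}E}]=0$ in $H^1_{\mathrm{naive}}(E)$.
   Context: Courant algebroid: a smooth real vector bundle $E\to M$ with a pseudo-metric $\langle\cdot,\cdot\rangle$ (smooth non-degenerate symmetric bilinear form on fibers), a bundle map $\rho:E\to TM$ and an $\mathbb{R}$-bilinear (Dorfman) operation $\circ$ on $\Gamma(E)$ satisfying, for all $e,e_1,e_2,e_3\in\Gamma(E)$, $f\in C^\infty(M)$: $e_1\circ(e_2\circ e_3)=(e_1\circ e_2)\circ e_3+e_2\circ(e_1\circ e_3)$; $\rho(e_1\circ e_2)=[\rho(e_1),\rho(e_2)]$; $e_1\circ(fe_2)=(\rho(e_1)f)e_2+f(e_1\circ e_2)$; $e_1\circ e_2+e_2\circ e_1=2\mathcal{D}\langle e_1,e_2\rangle$; $\mathcal{D}f\circ e=0$; $\rho(e)\langle e_1,e_2\rangle=\langle e\circ e_1,e_2\rangle+\langle e_1,e\circ e_2\rangle$; where $\mathcal{D}:C^\infty(M)\to\Gamma(E)$ is defined by $\langle\mathcal{D}f,e\rangle=\tfrac12\rho(e)f$. (Dropping the last axiom gives the notion of Loday algebroid; the definitions below make sense for Loday algebroids.) The Courant bracket is $\llbracket a,b\rrbracket=\tfrac12(a\circ b-b\circ a)$, so $a\circ b=\llbracket a,b\rrbracket+\mathcal{D}\langle a,b\rangle$. Double of a Lie bialgebroid: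 a Lie bialgebroid $(A,A^* )$ is a pair of Lie algebroid structures on a vector bundle $A\to M$ and its dual $A^*$ such that $d_*[X,Y]=[d_*X,Y]+[X,d_*Y]$ for all $X,Y\in\Gamma(A)$, where $d$ on $\Gamma(\wedge^\bullet A^* )$ and $d_*$ on $\Gamma(\wedge^\bullet A)$ are the Lie algebroid differentials of $A$ and $A^*$ respectively, and the brackets are Schouten brackets. Its double is $E=A\oplus A^*$ with $\rho$ the sum of the anchors of $A$ and $A^*$, pseudo-metric $\langle X+\xi,Y+\eta\rangle=(\xi,Y)+(\eta,X)$ (where $(\cdot,\cdot)$ is the duality pairing), so that $\mathcal{D}=\tfrac12(d+d_* )$, and skew-symmetric Courant bracket given for $X,Y\in\Gamma(A)$, $\xi,\eta\in\Gamma(A^* )$ by $$\llbracket X,\xi\rrbracket=\big(-L_\xi X+\tfrac12d_*(\xi,X)\big)+\big(L_X\xi-\tfrac12d(\xi,X)\big),\quad \llbracket X,Y\rrbracket=[X,Y],\quad \llbracket\xi,\eta\rrbracket=[\xi,\eta],$$ with $L_X$, $L_\xi$ the Lie algebroid Lie derivatives. It is a theorem of Liu, Weinstein and Xu that this is a Courant algebroid. Naive cohomology: $\Gamma(\wedge^k\ker\rho)$ is the space of smooth sections $\alpha$ of $\wedge^kE$ with $\alpha|_m\in\wedge^k\ker(\rho|_m)$ for all $m\in M$. Identifying $\wedge^kE$ with $\wedge^kE^*$ by the pseudo-metric, define $\breve d:\Gamma(\wedge^k\ker\rho)\to\Gamma(\wedge^{k+1}\ker\rho)$ by $$(\breve d\alpha)(e_0,\dots,e_k)=\sum_{i}(-1)^i\rho(e_i)\alpha(e_0,\dots,\widehat{e_i},\dots,e_k)+\sum_{i<j}(-1)^{i+j}\alpha(\llbracket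 e_i,e_j\rrbracket,e_0,\dots,\widehat{e_i},\dots,\widehat{e_j},\dots,e_k).$$ Then $\breve d^2=0$, and $H^\bullet_{\mathrm{naive}}(E)$ is the cohomology of $(\Gamma(\wedge^\bullet\ker\rho),\breve d)$. In degree $1$, $\theta\in\Gamma(\ker\rho)$ is a coboundary if and only if $\theta=\mathcal{D}f$ for some $f\in C^\infty(M)$. Modular class: for $z\in\Gamma(E)$ set $\mathcal{L}_zf=\rho(z)f$ on functions, $\mathcal{L}_zx=z\circ x$ on $\Gamma(E)$, and extend to $\Gamma(\wedge^kE)$ by the Leibniz rule for the wedge product. On $S=\wedge^{\mathrm{top}}E$ the operation $e\otimes s\mapsto\mathcal{L}_es$ is $C^\infty(M)$-linear in $e$ and makes $S$ a module of $E$. If $S$ has a nowhere vanishing section $s$, define $\theta_s\in\Gamma(E)$ by $\mathcal{L}_es=\langle\theta_s,e\rangle s$ for all $e\in\Gamma(E)$; it is a naive $1$-cocycle whose class in $H^1_{\mathrm{naive}}(E)$ is independent of $s$ and is denoted $[\theta_{\wedge^{\mathrm{top}}E}]$. If $S$ is not trivial, one takes half of the class obtained in the same way from the trivial line bundle $S\otimes S$ (with the induced module structure). This class is the modular class of $E$. For $E=A\oplus A^*$, $\wedge^{\mathrm{top}}E\cong(\wedge^{\mathrm{top}}A)\otimes(\wedge^{\mathrm{top}}A^* )$ is a trivial line bundle. *)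

theory Defs
  imports
    "HOL-Analysis.Analysis"
    "HOL-Library.Function_Algebras"
    "HOL-Library.FuncSet"
    "HOL-Combinatorics.Permutations"
begin

text \<open>
  Functions into a real vector space form a real vector space, so that spaces of covectors,
  multivectors and derivations can serve as fibres.
\<close>

instantiation "fun" :: (type, real_vector) real_vector
begin

definition scaleR_fun :: "real \<Rightarrow> ('a \<Rightarrow> 'b) \<Rightarrow> 'a \<Rightarrow> 'b"
  where "scaleR_fun c f = (\<lambda>x. c *\<^sub>R f x)"

instance
  by standard (simp_all add: scaleR_fun_def fun_eq_iff algebra_simps)

end

lemma scaleR_fun_apply [simp]: "(c *\<^sub>R f) x = c *\<^sub>R f x"
  by (simp add: scaleR_fun_def)


section \<open>Smooth manifolds\<close>

primrec Ck_on :: "nat \<Rightarrow> 'a::real_normed_vector set \<Rightarrow> ('a \<Rightarrow> 'b::real_normed_vector) \<Rightarrow> bool" where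
  "Ck_on 0 S f \<longleftrightarrow> continuous_on S f"
| "Ck_on (Suc k) S f \<longleftrightarrow> (\<forall>x\<in>S. f differentiable (at x)) \<and>
     (\<forall>v. Ck_on k S (\<lambda>x. frechet_derivative f (at x) v))"

text \<open>
  Smoothness on an arbitrary set is local extendability to a smooth map on an open set. It is only
  used on relatively open subsets of a linear subspace, where it is ordinary smoothness.
\<close>

definition smooth_on :: "'a::real_normed_vector set \<Rightarrow> ('a \<Rightarrow> 'b::real_normed_vector) \<Rightarrow> bool" where
  "smooth_on S f \<longleftrightarrow> (\<forall>x\<in>S. \<exists>U g. open U \<and> x \<in> U \<and> (\<forall>k. Ck_on k U g) \<and> (\<forall>y\<in>S \<inter> U. g y = f y))"

text \<open>
  The charts take values in a linear subspace \<open>model\<close> of a Euclidean space rather than in the whole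
  space: the types of class \<open>euclidean_space\<close> have positive dimension, and manifolds of dimension
  \<open>0\<close> (for instance a point, over which a Lie bialgebroid is a Lie bialgebra) must be included.
\<close>

record ('m, 'a) manifold =
  model :: "'a set"
  charts :: "('m set \<times> ('m \<Rightarrow> 'a)) set"

definition smooth_manifold ::
    "('m::{t2_space, second_countable_topology}, 'a::euclidean_space) manifold \<Rightarrow> bool" where
  "smooth_manifold M \<longleftrightarrow>
     subspace (model M) \<and>
     (\<Union>(U, \<phi>)\<in>charts M. U) = UNIV \<and>
     (\<forall>(U, \<phi>)\<in>charts M. open U \<and> openin (top_of_set (model M)) (\<phi> ` U) \<and>
        (\<exists>\<psi>. homeomorphism U (\<phi> ` U) \<phi> \<psi>)) \<and>
     (\<forall>(U, \<phi>)\<in>charts M. \<forall>(V, \<psi>)\<in>charts M. smooth_on (\<phi> ` (U \<inter> V)) (\<psi> \<circ> inv_into U \<phi>))"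

definition smooth_fun_on :: "('m, 'a::euclidean_space) manifold \<Rightarrow> 'm set \<Rightarrow> ('m \<Rightarrow> real) \<Rightarrow> bool" where
  "smooth_fun_on M W f \<longleftrightarrow> (\<forall>(U, \<phi>)\<in>charts M. smooth_on (\<phi> ` (U \<inter> W)) (f \<circ> inv_into U \<phi>))"

definition Cinf :: "('m, 'a::euclidean_space) manifold \<Rightarrow> ('m \<Rightarrow> real) set" where
  "Cinf M = {f. smooth_fun_on M UNIV f}"

text \<open>Tangent vectors are derivations of \<open>Cinf M\<close> at a point, extended by \<open>0\<close> to all functions.\<close>

definition tangent_space :: "('m, 'a::euclidean_space) manifold \<Rightarrow> 'm \<Rightarrow> (('m \<Rightarrow> real) \<Rightarrow> real) set" where
  "tangent_space M m = {D.
     (\<forall>f\<in>Cinf M. \<forall>g\<in>Cinf M. D (f + g) = D f + D g) \<and>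
     (\<forall>c. \<forall>f\<in>Cinf M. D (c *\<^sub>R f) = c * D f) \<and>
     (\<forall>f\<in>Cinf M. \<forall>g\<in>Cinf M. D (f * g) = f m * D g + g m * D f) \<and>
     (\<forall>f. f \<notin> Cinf M \<longrightarrow> D f = 0)}"


section \<open>Smooth vector bundles\<close>

text \<open>
  A vector bundle is a family of subspaces \<open>fiber B m\<close> of a real vector space (not assumed finite
  dimensional) together with a trivialising family of local frames. A frame is an open set with a
  list of local sections; the values of these outside the open set are irrelevant.
\<close>

record ('m, 'v) vbundle =
  fiber :: "'m \<Rightarrow> 'v set"
  rank :: nat
  frames :: "('m set \<times> ('m \<Rightarrow> 'v) list) set"

definition smooth_section_on ::
    "('m, 'a::euclidean_space) manifold \<Rightarrow> ('m, 'v::real_vector) vbundle \<Rightarrow> 'm set \<Rightarrow> ('m \<Rightarrow> 'v) \<Rightarrow> bool" where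
  "smooth_section_on M B W s \<longleftrightarrow>
     (\<forall>m\<in>W. s m \<in> fiber B m) \<and>
     (\<forall>(U, es)\<in>frames B. \<exists>c. (\<forall>i<length es. smooth_fun_on M (U \<inter> W) (c i)) \<and>
        (\<forall>m\<in>U \<inter> W. s m = (\<Sum>i<length es. c i m *\<^sub>R (es ! i) m)))"

definition vector_bundle ::
    "('m::topological_space, 'a::euclidean_space) manifold \<Rightarrow> ('m, 'v::real_vector) vbundle \<Rightarrow> bool" where
  "vector_bundle M B \<longleftrightarrow>
     (\<forall>m. subspace (fiber B m)) \<and>
     (\<Union>(U, es)\<in>frames B. U) = UNIV \<and>
     (\<forall>(U, es)\<in>frames B. open U \<and> length es = rank B \<and>
        (\<forall>m\<in>U. distinct (map (\<lambda>e. e m) es) \<and> independent (set (map (\<lambda>e. e m) es)) \<and>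
           span (set (map (\<lambda>e. e m) es)) = fiber B m) \<and>
        (\<forall>e\<in>set es. smooth_section_on M B U e))"

definition Sec :: "('m, 'a::euclidean_space) manifold \<Rightarrow> ('m, 'v::real_vector) vbundle \<Rightarrow> ('m \<Rightarrow> 'v) set" where
  "Sec M B = {s. smooth_section_on M B UNIV s}"

definition smult :: "('m \<Rightarrow> real) \<Rightarrow> ('m \<Rightarrow> 'v::real_vector) \<Rightarrow> 'm \<Rightarrow> 'v" where
  "smult f s = (\<lambda>m. f m *\<^sub>R s m)"

definition nowhere_vanishing ::
    "('m, 'a::euclidean_space) manifold \<Rightarrow> ('m, 'v::real_vector) vbundle \<Rightarrow> ('m \<Rightarrow> 'v) \<Rightarrow> bool" where
  "nowhere_vanishing M B s \<longleftrightarrow> s \<in> Sec M B \<and> (\<forall>m. s m \<noteq> 0)"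

definition direct_sum :: "('m, 'v::real_vector) vbundle \<Rightarrow> ('m, 'w::real_vector) vbundle \<Rightarrow> ('m, 'v \<times> 'w) vbundle" where
  "direct_sum A B = \<lparr>
     fiber = (\<lambda>m. fiber A m \<times> fiber B m),
     rank = rank A + rank B,
     frames = {(U \<inter> V, map (\<lambda>e m. (e m, 0)) es @ map (\<lambda>e m. (0, e m)) fs) | U es V fs.
       (U, es) \<in> frames A \<and> (V, fs) \<in> frames B}\<rparr>"

text \<open>Covectors on a subspace \<open>V\<close> are extended by \<open>0\<close> outside \<open>V\<close>, to have a canonical representative.\<close>

definition dual_space :: "'v::real_vector set \<Rightarrow> ('v \<Rightarrow> real) set" where
  "dual_space V = {\<phi>. (\<forall>x\<in>V. \<forall>y\<in>V. \<phi> (x + y) = \<phi> x + \<phi> y) \<and>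
     (\<forall>c. \<forall>x\<in>V. \<phi> (c *\<^sub>R x) = c * \<phi> x) \<and> (\<forall>x. x \<notin> V \<longrightarrow> \<phi> x = 0)}"

definition dual_frame :: "('m, 'v::real_vector) vbundle \<Rightarrow> ('m \<Rightarrow> 'v) list \<Rightarrow> ('m \<Rightarrow> 'v \<Rightarrow> real) list" where
  "dual_frame B es = map (\<lambda>i m. THE \<phi>. \<phi> \<in> dual_space (fiber B m) \<and>
     (\<forall>j<length es. \<phi> ((es ! j) m) = (if i = j then 1 else 0))) [0..<length es]"

definition dual_bundle :: "('m, 'v::real_vector) vbundle \<Rightarrow> ('m, 'v \<Rightarrow> real) vbundle" where
  "dual_bundle B = \<lparr>
     fiber = (\<lambda>m. dual_space (fiber B m)),
     rank = rank B,
     frames = (\<lambda>(U, es). (U, dual_frame B es)) ` frames B\<rparr>"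

definition pairing :: "('m \<Rightarrow> 'v \<Rightarrow> real) \<Rightarrow> ('m \<Rightarrow> 'v) \<Rightarrow> 'm \<Rightarrow> real" where
  "pairing \<xi> X = (\<lambda>m. \<xi> m (X m))"


section \<open>Exterior powers and tensor squares\<close>

text \<open>
  The exterior power \<open>\<Lambda>\<^sup>k V\<close> is realised inside the \<open>k\<close>-forms on the dual of \<open>V\<close>, with
  \<open>x\<^sub>1 \<and> \<dots> \<and> x\<^sub>k\<close> acting as \<open>(\<phi>\<^sub>1, \<dots>, \<phi>\<^sub>k) \<mapsto> det (\<phi>\<^sub>i(x\<^sub>j))\<close>. Lists of the wrong length, or with entries
  that are not covectors on \<open>V\<close>, are sent to \<open>0\<close>.
\<close>

definition wedge :: "'v::real_vector set \<Rightarrow> 'v list \<Rightarrow> ('v \<Rightarrow> real) list \<Rightarrow> real" where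
  "wedge V xs = (\<lambda>\<phi>s. if length \<phi>s = length xs \<and> set \<phi>s \<subseteq> dual_space V
     then \<Sum>p | p permutes {..<length xs}. of_int (sign p) * (\<Prod>i<length xs. (\<phi>s ! i) (xs ! p i))
     else 0)"

text \<open>\<open>ext_power V U k\<close> is \<open>\<Lambda>\<^sup>k U\<close>, for a subspace \<open>U\<close> of \<open>V\<close>, as a subspace of \<open>\<Lambda>\<^sup>k V\<close>.\<close>

definition ext_power :: "'v::real_vector set \<Rightarrow> 'v set \<Rightarrow> nat \<Rightarrow> (('v \<Rightarrow> real) list \<Rightarrow> real) set" where
  "ext_power V U k = span {wedge V xs | xs. set xs \<subseteq> U \<and> length xs = k}"

definition wedge_sec :: "('m, 'v::real_vector) vbundle \<Rightarrow> ('m \<Rightarrow> 'v) list \<Rightarrow> 'm \<Rightarrow> ('v \<Rightarrow> real) list \<Rightarrow> real" where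
  "wedge_sec B xs = (\<lambda>m. wedge (fiber B m) (map (\<lambda>x. x m) xs))"

definition ext_bundle :: "('m, 'v::real_vector) vbundle \<Rightarrow> nat \<Rightarrow> ('m, ('v \<Rightarrow> real) list \<Rightarrow> real) vbundle" where
  "ext_bundle B k = \<lparr>
     fiber = (\<lambda>m. ext_power (fiber B m) (fiber B m) k),
     rank = rank B choose k,
     frames = (\<lambda>(U, es). (U, map (wedge_sec B) (filter (\<lambda>xs. length xs = k) (subseqs es)))) ` frames B\<rparr>"

text \<open>Likewise \<open>V \<otimes> V\<close> is realised inside the bilinear forms on the dual of \<open>V\<close>.\<close>

definition tensor :: "'v::real_vector set \<Rightarrow> 'v \<Rightarrow> 'v \<Rightarrow> ('v \<Rightarrow> real) \<Rightarrow> ('v \<Rightarrow> real) \<Rightarrow> real" where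
  "tensor V x y = (\<lambda>\<phi> \<psi>. if \<phi> \<in> dual_space V \<and> \<psi> \<in> dual_space V then \<phi> x * \<psi> y else 0)"

definition tensor_sec ::
    "('m, 'v::real_vector) vbundle \<Rightarrow> ('m \<Rightarrow> 'v) \<Rightarrow> ('m \<Rightarrow> 'v) \<Rightarrow> 'm \<Rightarrow> ('v \<Rightarrow> real) \<Rightarrow> ('v \<Rightarrow> real) \<Rightarrow> real" where
  "tensor_sec B s t = (\<lambda>m. tensor (fiber B m) (s m) (t m))"

definition tensor_square ::
    "('m, 'v::real_vector) vbundle \<Rightarrow> ('m, ('v \<Rightarrow> real) \<Rightarrow> ('v \<Rightarrow> real) \<Rightarrow> real) vbundle" where
  "tensor_square B = \<lparr>
     fiber = (\<lambda>m. span {tensor (fiber B m) x y | x y. x \<in> fiber B m \<and> y \<in> fiber B m}),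
     rank = rank B * rank B,
     frames = (\<lambda>(U, es). (U, map (\<lambda>(s, t). tensor_sec B s t) (List.product es es))) ` frames B\<rparr>"


section \<open>Derivations of sections\<close>

text \<open>\<open>T\<close> is an operator on the sections of \<open>W\<close> that is a derivation over the operator \<open>X\<close> on functions.\<close>

definition derivation_over ::
    "('m, 'a::euclidean_space) manifold \<Rightarrow> ('m, 'w::real_vector) vbundle \<Rightarrow>
     (('m \<Rightarrow> real) \<Rightarrow> 'm \<Rightarrow> real) \<Rightarrow> (('m \<Rightarrow> 'w) \<Rightarrow> 'm \<Rightarrow> 'w) \<Rightarrow> bool" where
  "derivation_over M W X T \<longleftrightarrow>
     T \<in> Sec M W \<rightarrow> Sec M W \<and>
     (\<forall>s\<in>Sec M W. \<forall>t\<in>Sec M W. T (s + t) = T s + T t) \<and>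
     (\<forall>f\<in>Cinf M. \<forall>s\<in>Sec M W. T (smult f s) = smult (X f) s + smult f (T s))"

text \<open>
  The extension by the Leibniz rule to \<open>\<Lambda>\<^sup>k B\<close> of an operator \<open>\<delta>\<close> on the sections of \<open>B\<close> that is a
  derivation over \<open>X\<close>. Sections of \<open>\<Lambda>\<^sup>k B\<close> are locally sums of terms \<open>f x\<^sub>1 \<and> \<dots> \<and> x\<^sub>k\<close>, so the
  extension is unique on sections; \<open>extensional\<close> fixes its values elsewhere.
\<close>

definition leibniz_ext ::
    "('m, 'a::euclidean_space) manifold \<Rightarrow> ('m, 'v::real_vector) vbundle \<Rightarrow> nat \<Rightarrow>
     (('m \<Rightarrow> real) \<Rightarrow> 'm \<Rightarrow> real) \<Rightarrow> (('m \<Rightarrow> 'v) \<Rightarrow> 'm \<Rightarrow> 'v) \<Rightarrow>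
     ('m \<Rightarrow> ('v \<Rightarrow> real) list \<Rightarrow> real) \<Rightarrow> 'm \<Rightarrow> ('v \<Rightarrow> real) list \<Rightarrow> real" where
  "leibniz_ext M B k X \<delta> = (THE T.
     T \<in> extensional (Sec M (ext_bundle B k)) \<and>
     derivation_over M (ext_bundle B k) X T \<and>
     (\<forall>xs. length xs = k \<and> set xs \<subseteq> Sec M B \<longrightarrow>
        T (wedge_sec B xs) = (\<Sum>i<k. wedge_sec B (xs[i := \<delta> (xs ! i)]))))"

definition tensor_square_ext ::
    "('m, 'a::euclidean_space) manifold \<Rightarrow> ('m, 'v::real_vector) vbundle \<Rightarrow>
     (('m \<Rightarrow> real) \<Rightarrow> 'm \<Rightarrow> real) \<Rightarrow> (('m \<Rightarrow> 'v) \<Rightarrow> 'm \<Rightarrow> 'v) \<Rightarrow>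
     ('m \<Rightarrow> ('v \<Rightarrow> real) \<Rightarrow> ('v \<Rightarrow> real) \<Rightarrow> real) \<Rightarrow> 'm \<Rightarrow> ('v \<Rightarrow> real) \<Rightarrow> ('v \<Rightarrow> real) \<Rightarrow> real" where
  "tensor_square_ext M B X \<delta> = (THE T.
     T \<in> extensional (Sec M (tensor_square B)) \<and>
     derivation_over M (tensor_square B) X T \<and>
     (\<forall>s\<in>Sec M B. \<forall>t\<in>Sec M B. T (tensor_sec B s t) = tensor_sec B (\<delta> s) t + tensor_sec B s (\<delta> t)))"


section \<open>Lie algebroids and Lie bialgebroids\<close>

type_synonym ('m, 'v) bundle_anchor = "'m \<Rightarrow> 'v \<Rightarrow> ('m \<Rightarrow> real) \<Rightarrow> real"
type_synonym ('m, 'v) section_bracket = "('m \<Rightarrow> 'v) \<Rightarrow> ('m \<Rightarrow> 'v) \<Rightarrow> 'm \<Rightarrow> 'v"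

definition act :: "('m, 'v) bundle_anchor \<Rightarrow> ('m \<Rightarrow> 'v) \<Rightarrow> ('m \<Rightarrow> real) \<Rightarrow> 'm \<Rightarrow> real" where
  "act a e f = (\<lambda>m. a m (e m) f)"

text \<open>Smooth bundle maps from \<open>B\<close> to the tangent bundle over the identity.\<close>

definition anchor_map ::
    "('m, 'a::euclidean_space) manifold \<Rightarrow> ('m, 'v::real_vector) vbundle \<Rightarrow> ('m, 'v) bundle_anchor \<Rightarrow> bool" where
  "anchor_map M B a \<longleftrightarrow>
     (\<forall>m. \<forall>x\<in>fiber B m. a m x \<in> tangent_space M m) \<and>
     (\<forall>m. \<forall>x\<in>fiber B m. \<forall>y\<in>fiber B m. a m (x + y) = a m x + a m y) \<and>
     (\<forall>m c. \<forall>x\<in>fiber B m. a m (c *\<^sub>R x) = c *\<^sub>R a m x) \<and>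
     (\<forall>e\<in>Sec M B. \<forall>f\<in>Cinf M. act a e f \<in> Cinf M)"

record ('m, 'v) lie_structure =
  lanchor :: "('m, 'v) bundle_anchor"
  lbracket :: "('m, 'v) section_bracket"

definition lie_algebroid ::
    "('m::topological_space, 'a::euclidean_space) manifold \<Rightarrow> ('m, 'v::real_vector) vbundle \<Rightarrow>
     ('m, 'v) lie_structure \<Rightarrow> bool" where
  "lie_algebroid M A L \<longleftrightarrow>
     vector_bundle M A \<and> anchor_map M A (lanchor L) \<and>
     (\<forall>X\<in>Sec M A. \<forall>Y\<in>Sec M A. lbracket L X Y \<in> Sec M A) \<and>
     (\<forall>X\<in>Sec M A. \<forall>Y\<in>Sec M A. \<forall>Z\<in>Sec M A.
        lbracket L (X + Y) Z = lbracket L X Z + lbracket L Y Z \<and>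
        lbracket L Z (X + Y) = lbracket L Z X + lbracket L Z Y) \<and>
     (\<forall>c. \<forall>X\<in>Sec M A. \<forall>Y\<in>Sec M A.
        lbracket L (c *\<^sub>R X) Y = c *\<^sub>R lbracket L X Y \<and>
        lbracket L X (c *\<^sub>R Y) = c *\<^sub>R lbracket L X Y) \<and>
     (\<forall>X\<in>Sec M A. \<forall>Y\<in>Sec M A. lbracket L X Y = - lbracket L Y X) \<and>
     (\<forall>X\<in>Sec M A. \<forall>Y\<in>Sec M A. \<forall>Z\<in>Sec M A.
        lbracket L X (lbracket L Y Z) = lbracket L (lbracket L X Y) Z + lbracket L Y (lbracket L X Z)) \<and>
     (\<forall>X\<in>Sec M A. \<forall>Y\<in>Sec M A. \<forall>f\<in>Cinf M.
        lbracket L X (smult f Y) = smult (act (lanchor L) X f) Y + smult f (lbracket L X Y)) \<and>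
     (\<forall>X\<in>Sec M A. \<forall>Y\<in>Sec M A. \<forall>f\<in>Cinf M.
        act (lanchor L) (lbracket L X Y) f =
          act (lanchor L) X (act (lanchor L) Y f) - act (lanchor L) Y (act (lanchor L) X f))"

text \<open>
  The Cartan formula for the differential of a form \<open>\<alpha>\<close> with arguments \<open>e\<^sub>0, \<dots>, e\<^sub>k\<close>;
  \<open>nths es (- I)\<close> omits the arguments with index in \<open>I\<close>.
\<close>

definition cartan_formula ::
    "('m, 'v) bundle_anchor \<Rightarrow> ('m, 'v) section_bracket \<Rightarrow> (('m \<Rightarrow> 'v) list \<Rightarrow> 'm \<Rightarrow> real) \<Rightarrow>
     ('m \<Rightarrow> 'v) list \<Rightarrow> 'm \<Rightarrow> real" where
  "cartan_formula a br \<alpha> es = (\<lambda>m.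
     (\<Sum>i<length es. (-1) ^ i * act a (es ! i) (\<alpha> (nths es (- {i}))) m) +
     (\<Sum>j<length es. \<Sum>i<j. (-1) ^ (i + j) * \<alpha> (br (es ! i) (es ! j) # nths es (- {i, j})) m))"

definition multivector_eval ::
    "('m \<Rightarrow> ('v \<Rightarrow> real) list \<Rightarrow> real) \<Rightarrow> ('m \<Rightarrow> 'v \<Rightarrow> real) list \<Rightarrow> 'm \<Rightarrow> real" where
  "multivector_eval \<alpha> \<xi>s = (\<lambda>m. \<alpha> m (map (\<lambda>\<xi>. \<xi> m) \<xi>s))"

text \<open>
  The differential \<open>d\<^sub>*\<close> from sections of \<open>\<Lambda>\<^sup>k A\<close> to sections of \<open>\<Lambda>\<^sup>k\<^sup>+\<^sup>1 A\<close> of a Lie algebroid structure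
  \<open>L'\<close> on the dual of \<open>A\<close>.
\<close>

definition d_star ::
    "('m, 'a::euclidean_space) manifold \<Rightarrow> ('m, 'v::real_vector) vbundle \<Rightarrow> ('m, 'v \<Rightarrow> real) lie_structure \<Rightarrow>
     nat \<Rightarrow> ('m \<Rightarrow> ('v \<Rightarrow> real) list \<Rightarrow> real) \<Rightarrow> 'm \<Rightarrow> ('v \<Rightarrow> real) list \<Rightarrow> real" where
  "d_star M A L' k \<alpha> = (THE \<beta>. \<beta> \<in> Sec M (ext_bundle A (Suc k)) \<and>
     (\<forall>\<xi>s. length \<xi>s = Suc k \<and> set \<xi>s \<subseteq> Sec M (dual_bundle A) \<longrightarrow>
        multivector_eval \<beta> \<xi>s = cartan_formula (lanchor L') (lbracket L') (multivector_eval \<alpha>) \<xi>s))"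

text \<open>The Schouten bracket \<open>[X, \<Lambda>]\<close> of a section \<open>X\<close> of \<open>A\<close> with a section \<open>\<Lambda>\<close> of \<open>\<Lambda>\<^sup>k A\<close>.\<close>

definition schouten ::
    "('m, 'a::euclidean_space) manifold \<Rightarrow> ('m, 'v::real_vector) vbundle \<Rightarrow> ('m, 'v) lie_structure \<Rightarrow> nat \<Rightarrow>
     ('m \<Rightarrow> 'v) \<Rightarrow> ('m \<Rightarrow> ('v \<Rightarrow> real) list \<Rightarrow> real) \<Rightarrow> 'm \<Rightarrow> ('v \<Rightarrow> real) list \<Rightarrow> real" where
  "schouten M A L k X = leibniz_ext M A k (act (lanchor L) X) (lbracket L X)"

text \<open>
  The compatibility condition is \<open>d\<^sub>*[X, Y] = [d\<^sub>*X, Y] + [X, d\<^sub>*Y]\<close>, where \<open>[\<Lambda>, Y] = - [Y, \<Lambda>]\<close> for the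
  Schouten bracket of a multivector with a section of \<open>A\<close>.
\<close>

definition lie_bialgebroid ::
    "('m::topological_space, 'a::euclidean_space) manifold \<Rightarrow> ('m, 'v::real_vector) vbundle \<Rightarrow>
     ('m, 'v) lie_structure \<Rightarrow> ('m, 'v \<Rightarrow> real) lie_structure \<Rightarrow> bool" where
  "lie_bialgebroid M A L L' \<longleftrightarrow>
     lie_algebroid M A L \<and> lie_algebroid M (dual_bundle A) L' \<and>
     (\<forall>X\<in>Sec M A. \<forall>Y\<in>Sec M A.
        d_star M A L' 1 (wedge_sec A [lbracket L X Y]) =
          - schouten M A L 2 Y (d_star M A L' 1 (wedge_sec A [X]))
          + schouten M A L 2 X (d_star M A L' 1 (wedge_sec A [Y])))"


section \<open>Courant algebroids, naive cohomology and the modular class\<close>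

text \<open>
  The data of a Courant (or Loday) algebroid. All notions below are determined by these data; the
  axioms are what makes them well defined.
\<close>

record ('m, 'e) courant_structure =
  cbundle :: "('m, 'e) vbundle"
  cmetric :: "'m \<Rightarrow> 'e \<Rightarrow> 'e \<Rightarrow> real"
  canchor :: "('m, 'e) bundle_anchor"
  dorfman :: "('m, 'e) section_bracket"

definition courant_bracket :: "('m, 'e::real_vector) courant_structure \<Rightarrow> ('m, 'e) section_bracket" where
  "courant_bracket E e1 e2 = (1/2) *\<^sub>R (dorfman E e1 e2 - dorfman E e2 e1)"

text \<open>The operator \<open>\<D>\<close> of a metric \<open>g\<close> and an anchor \<open>\<rho>\<close>: \<open>\<langle>\<D> f, e\<rangle> = 1/2 \<rho>(e) f\<close>.\<close>

definition courant_D ::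
    "('m, 'a::euclidean_space) manifold \<Rightarrow> ('m, 'e::real_vector) vbundle \<Rightarrow> ('m \<Rightarrow> 'e \<Rightarrow> 'e \<Rightarrow> real) \<Rightarrow>
     ('m, 'e) bundle_anchor \<Rightarrow> ('m \<Rightarrow> real) \<Rightarrow> 'm \<Rightarrow> 'e" where
  "courant_D M B g \<rho> f = (THE z. z \<in> Sec M B \<and>
     (\<forall>e\<in>Sec M B. (\<lambda>m. g m (z m) (e m)) = (1/2) *\<^sub>R act \<rho> e f))"

text \<open>The identification of the bundle with its dual by the metric.\<close>

definition flat :: "('m, 'e) courant_structure \<Rightarrow> ('m \<Rightarrow> 'e) \<Rightarrow> 'm \<Rightarrow> 'e \<Rightarrow> real" where
  "flat E e = (\<lambda>m w. if w \<in> fiber (cbundle E) m then cmetric E m (e m) w else 0)"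

definition form_eval ::
    "('m, 'e) courant_structure \<Rightarrow> ('m \<Rightarrow> ('e \<Rightarrow> real) list \<Rightarrow> real) \<Rightarrow> ('m \<Rightarrow> 'e) list \<Rightarrow> 'm \<Rightarrow> real" where
  "form_eval E \<alpha> es = multivector_eval \<alpha> (map (flat E) es)"

definition ker_anchor :: "('m, 'e) courant_structure \<Rightarrow> 'm \<Rightarrow> 'e set" where
  "ker_anchor E m = {x \<in> fiber (cbundle E) m. canchor E m x = 0}"

definition naive_cochains ::
    "('m, 'a::euclidean_space) manifold \<Rightarrow> ('m, 'e::real_vector) courant_structure \<Rightarrow> nat \<Rightarrow>
     ('m \<Rightarrow> ('e \<Rightarrow> real) list \<Rightarrow> real) set" where
  "naive_cochains M E k = {\<alpha> \<in> Sec M (ext_bundle (cbundle E) k).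
     \<forall>m. \<alpha> m \<in> ext_power (fiber (cbundle E) m) (ker_anchor E m) k}"

definition naive_d ::
    "('m, 'a::euclidean_space) manifold \<Rightarrow> ('m, 'e::real_vector) courant_structure \<Rightarrow> nat \<Rightarrow>
     ('m \<Rightarrow> ('e \<Rightarrow> real) list \<Rightarrow> real) \<Rightarrow> 'm \<Rightarrow> ('e \<Rightarrow> real) list \<Rightarrow> real" where
  "naive_d M E k \<alpha> = (THE \<beta>. \<beta> \<in> Sec M (ext_bundle (cbundle E) (Suc k)) \<and>
     (\<forall>es. length es = Suc k \<and> set es \<subseteq> Sec M (cbundle E) \<longrightarrow>
        form_eval E \<beta> es = cartan_formula (canchor E) (courant_bracket E) (form_eval E \<alpha>) es))"

definition naive_cocycles ::
    "('m, 'a::euclidean_space) manifold \<Rightarrow> ('m, 'e::real_vector) courant_structure \<Rightarrow> nat \<Rightarrow>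
     ('m \<Rightarrow> ('e \<Rightarrow> real) list \<Rightarrow> real) set" where
  "naive_cocycles M E k = {\<alpha> \<in> naive_cochains M E k. naive_d M E k \<alpha> = 0}"

fun naive_coboundaries ::
    "('m, 'a::euclidean_space) manifold \<Rightarrow> ('m, 'e::real_vector) courant_structure \<Rightarrow> nat \<Rightarrow>
     ('m \<Rightarrow> ('e \<Rightarrow> real) list \<Rightarrow> real) set" where
  "naive_coboundaries M E 0 = {0}"
| "naive_coboundaries M E (Suc k) = naive_d M E k ` naive_cochains M E k"

text \<open>Cohomology classes are cosets of the space of coboundaries.\<close>

definition naive_class ::
    "('m, 'a::euclidean_space) manifold \<Rightarrow> ('m, 'e::real_vector) courant_structure \<Rightarrow> nat \<Rightarrow>
     ('m \<Rightarrow> ('e \<Rightarrow> real) list \<Rightarrow> real) \<Rightarrow> ('m \<Rightarrow> ('e \<Rightarrow> real) list \<Rightarrow> real) set" where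
  "naive_class M E k \<alpha> = {\<alpha> + \<beta> | \<beta>. \<beta> \<in> naive_coboundaries M E k}"

definition naive_cohomology ::
    "('m, 'a::euclidean_space) manifold \<Rightarrow> ('m, 'e::real_vector) courant_structure \<Rightarrow> nat \<Rightarrow>
     ('m \<Rightarrow> ('e \<Rightarrow> real) list \<Rightarrow> real) set set" where
  "naive_cohomology M E k = naive_class M E k ` naive_cocycles M E k"

definition lie_derivative ::
    "('m, 'a::euclidean_space) manifold \<Rightarrow> ('m, 'e::real_vector) courant_structure \<Rightarrow> nat \<Rightarrow> ('m \<Rightarrow> 'e) \<Rightarrow>
     ('m \<Rightarrow> ('e \<Rightarrow> real) list \<Rightarrow> real) \<Rightarrow> 'm \<Rightarrow> ('e \<Rightarrow> real) list \<Rightarrow> real" where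
  "lie_derivative M E k z = leibniz_ext M (cbundle E) k (act (canchor E) z) (dorfman E z)"

text \<open>
  \<open>\<theta>\<close> is the section \<open>\<theta>\<^sub>s\<close> of \<open>E\<close> with \<open>T\<^sub>e s = \<langle>\<theta>\<^sub>s, e\<rangle> s\<close>, for a module structure \<open>T\<close> of \<open>E\<close> on a line
  bundle with section \<open>s\<close>.
\<close>

definition characteristic_section ::
    "('m, 'a::euclidean_space) manifold \<Rightarrow> ('m, 'e::real_vector) courant_structure \<Rightarrow>
     (('m \<Rightarrow> 'e) \<Rightarrow> ('m \<Rightarrow> 'w::real_vector) \<Rightarrow> 'm \<Rightarrow> 'w) \<Rightarrow> ('m \<Rightarrow> 'w) \<Rightarrow> ('m \<Rightarrow> 'e) \<Rightarrow> bool" where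
  "characteristic_section M E T s \<theta> \<longleftrightarrow> \<theta> \<in> Sec M (cbundle E) \<and>
     (\<forall>e\<in>Sec M (cbundle E). T e s = smult (\<lambda>m. cmetric E m (\<theta> m) (e m)) s)"

text \<open>
  The second case, which concerns a top exterior power \<open>S\<close> that is not trivial, takes half of the
  class obtained from \<open>S \<otimes> S\<close>.
\<close>

definition modular_class ::
    "('m, 'a::euclidean_space) manifold \<Rightarrow> ('m, 'e::real_vector) courant_structure \<Rightarrow>
     ('m \<Rightarrow> ('e \<Rightarrow> real) list \<Rightarrow> real) set" where
  "modular_class M E =
     (let n = rank (cbundle E); S = ext_bundle (cbundle E) n in
      if \<exists>s. nowhere_vanishing M S s
      then THE c. c \<in> naive_cohomology M E 1 \<and>
        (\<exists>s \<theta>. nowhere_vanishing M S s \<and> characteristic_section M E (lie_derivative M E n) s \<theta> \<and>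
           c = naive_class M E 1 (wedge_sec (cbundle E) [\<theta>]))
      else THE c. c \<in> naive_cohomology M E 1 \<and>
        (\<exists>s \<theta>. nowhere_vanishing M (tensor_square S) s \<and>
           characteristic_section M E
             (\<lambda>e. tensor_square_ext M S (act (canchor E) e) (lie_derivative M E n e)) s \<theta> \<and>
           c = naive_class M E 1 (wedge_sec (cbundle E) [(1/2) *\<^sub>R \<theta>])))"


section \<open>The double of a Lie bialgebroid\<close>

text \<open>
  Differential of functions and Lie derivative of dual sections for a Lie algebroid structure on \<open>A\<close>,
  and the same operators for a Lie algebroid structure on the dual of \<open>A\<close>, whose dual is \<open>A\<close>.
\<close>

definition diff_fun ::
    "('m, 'a::euclidean_space) manifold \<Rightarrow> ('m, 'v::real_vector) vbundle \<Rightarrow> ('m, 'v) lie_structure \<Rightarrow>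
     ('m \<Rightarrow> real) \<Rightarrow> 'm \<Rightarrow> 'v \<Rightarrow> real" where
  "diff_fun M A L f = (THE \<eta>. \<eta> \<in> Sec M (dual_bundle A) \<and>
     (\<forall>Y\<in>Sec M A. pairing \<eta> Y = act (lanchor L) Y f))"

definition diff_fun_star ::
    "('m, 'a::euclidean_space) manifold \<Rightarrow> ('m, 'v::real_vector) vbundle \<Rightarrow> ('m, 'v \<Rightarrow> real) lie_structure \<Rightarrow>
     ('m \<Rightarrow> real) \<Rightarrow> 'm \<Rightarrow> 'v" where
  "diff_fun_star M A L' f = (THE Z. Z \<in> Sec M A \<and>
     (\<forall>\<eta>\<in>Sec M (dual_bundle A). pairing \<eta> Z = act (lanchor L') \<eta> f))"

definition lie_der ::
    "('m, 'a::euclidean_space) manifold \<Rightarrow> ('m, 'v::real_vector) vbundle \<Rightarrow> ('m, 'v) lie_structure \<Rightarrow>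
     ('m \<Rightarrow> 'v) \<Rightarrow> ('m \<Rightarrow> 'v \<Rightarrow> real) \<Rightarrow> 'm \<Rightarrow> 'v \<Rightarrow> real" where
  "lie_der M A L X \<xi> = (THE \<eta>. \<eta> \<in> Sec M (dual_bundle A) \<and>
     (\<forall>Y\<in>Sec M A. pairing \<eta> Y = act (lanchor L) X (pairing \<xi> Y) - pairing \<xi> (lbracket L X Y)))"

definition lie_der_star ::
    "('m, 'a::euclidean_space) manifold \<Rightarrow> ('m, 'v::real_vector) vbundle \<Rightarrow> ('m, 'v \<Rightarrow> real) lie_structure \<Rightarrow>
     ('m \<Rightarrow> 'v \<Rightarrow> real) \<Rightarrow> ('m \<Rightarrow> 'v) \<Rightarrow> 'm \<Rightarrow> 'v" where
  "lie_der_star M A L' \<xi> X = (THE Z. Z \<in> Sec M A \<and>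
     (\<forall>\<eta>\<in>Sec M (dual_bundle A).
        pairing \<eta> Z = act (lanchor L') \<xi> (pairing \<eta> X) - pairing (lbracket L' \<xi> \<eta>) X))"

definition mixed_bracket ::
    "('m, 'a::euclidean_space) manifold \<Rightarrow> ('m, 'v::real_vector) vbundle \<Rightarrow>
     ('m, 'v) lie_structure \<Rightarrow> ('m, 'v \<Rightarrow> real) lie_structure \<Rightarrow>
     ('m \<Rightarrow> 'v) \<Rightarrow> ('m \<Rightarrow> 'v \<Rightarrow> real) \<Rightarrow> 'm \<Rightarrow> 'v \<times> ('v \<Rightarrow> real)" where
  "mixed_bracket M A L L' X \<xi> = (\<lambda>m.
     ((- lie_der_star M A L' \<xi> X + (1/2) *\<^sub>R diff_fun_star M A L' (pairing \<xi> X)) m,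
      (lie_der M A L X \<xi> - (1/2) *\<^sub>R diff_fun M A L (pairing \<xi> X)) m))"

text \<open>The skew-symmetric bilinear extension \<open>[X, Y] + [\<xi>, \<eta>] + [X, \<eta>] - [Y, \<xi>]\<close>.\<close>

definition double_bracket ::
    "('m, 'a::euclidean_space) manifold \<Rightarrow> ('m, 'v::real_vector) vbundle \<Rightarrow>
     ('m, 'v) lie_structure \<Rightarrow> ('m, 'v \<Rightarrow> real) lie_structure \<Rightarrow>
     ('m, 'v \<times> ('v \<Rightarrow> real)) section_bracket" where
  "double_bracket M A L L' e1 e2 =
     (let X = fst \<circ> e1; \<xi> = snd \<circ> e1; Y = fst \<circ> e2; \<eta> = snd \<circ> e2 in
      (\<lambda>m. (lbracket L X Y m, lbracket L' \<xi> \<eta> m))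
      + mixed_bracket M A L L' X \<eta> - mixed_bracket M A L L' Y \<xi>)"

definition double_metric :: "'m \<Rightarrow> 'v \<times> ('v \<Rightarrow> real) \<Rightarrow> 'v \<times> ('v \<Rightarrow> real) \<Rightarrow> real" where
  "double_metric m = (\<lambda>(x, \<xi>) (y, \<eta>). \<xi> y + \<eta> x)"

definition double_anchor ::
    "('m, 'v) lie_structure \<Rightarrow> ('m, 'v \<Rightarrow> real) lie_structure \<Rightarrow> ('m, 'v \<times> ('v \<Rightarrow> real)) bundle_anchor" where
  "double_anchor L L' m = (\<lambda>(x, \<xi>). lanchor L m x + lanchor L' m \<xi>)"

definition double ::
    "('m, 'a::euclidean_space) manifold \<Rightarrow> ('m, 'v::real_vector) vbundle \<Rightarrow>
     ('m, 'v) lie_structure \<Rightarrow> ('m, 'v \<Rightarrow> real) lie_structure \<Rightarrow>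
     ('m, 'v \<times> ('v \<Rightarrow> real)) courant_structure" where
  "double M A L L' = (let B = direct_sum A (dual_bundle A) in \<lparr>
     cbundle = B,
     cmetric = double_metric,
     canchor = double_anchor L L',
     dorfman = (\<lambda>e1 e2. double_bracket M A L L' e1 e2 +
       courant_D M B double_metric (double_anchor L L') (\<lambda>m. double_metric m (e1 m) (e2 m)))\<rparr>)"

end

theory Submission
  imports "Jordan_Normal_Form.Determinant" Defs
begin

text \<open>
  The reason for the theorem is a canonical volume. If \<open>e\<^sub>1, \<dots>, e\<^sub>r\<close> is a local frame of \<open>A\<close> with dual
  frame \<open>\<epsilon>\<^sub>1, \<dots>, \<epsilon>\<^sub>r\<close>, then \<open>e\<^sub>1 \<and> \<dots> \<and> e\<^sub>r \<and> \<epsilon>\<^sub>1 \<and> \<dots> \<and> \<epsilon>\<^sub>r\<close> does not depend on the frame, because a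
  change of frame by a matrix \<open>P\<close> multiplies it by \<open>det P * det P\<^sup>-\<^sup>T = 1\<close> (\<open>wedge_hyperbolic_indep\<close>).
  These local expressions glue to a nowhere vanishing section \<open>vol\<close> of the top exterior power of the
  double. It is determined up to sign by the pseudo-metric: if \<open>D x\<close> is the coefficient of
  \<open>x\<^sub>1 \<and> \<dots> \<and> x\<^sub>n\<close> with respect to \<open>vol\<close>, then \<open>det \<langle>y\<^sub>i, x\<^sub>j\<rangle> = \<kappa> (D x) (D y)\<close> with a constant \<open>\<kappa> \<noteq> 0\<close>
  (\<open>gram_coef\<close>). The Dorfman operation by a section is a derivation of the metric
  (\<open>dorfman_isometry\<close>), and differentiating the Gram determinant shows that it annihilates \<open>vol\<close>
  (\<open>derivation_coef\<close>, \<open>leibniz_ext_top\<close>). So the characteristic section of \<open>vol\<close> is \<open>0\<close>.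

  Every other nowhere vanishing section is \<open>f vol\<close> with a smooth \<open>f\<close> without zeros, and its
  characteristic section is \<open>2 \<D> (ln \<bar>f\<bar>)\<close>, a coboundary (\<open>characteristic_section_grad\<close>). Hence the
  class in the definition of the modular class exists, is unique, and is the class of \<open>0\<close>.

  The operators involved (differentials, Lie derivatives, \<open>\<D>\<close>, the extension by the Leibniz rule, the
  naive differential) are defined by descriptions that quantify over global sections. That they
  describe something rests on two facts. Bump functions provide enough global sections
  (\<open>bump\<close>, \<open>Sec_through\<close>), and a functional on sections that is linear over the smooth functions is
  the pairing with a unique section of the dual bundle (\<open>functional_section\<close>). Tangent vectors are
  abstract derivations of the algebra of smooth functions, so the chain rule for the logarithm also
  needs an argument: it comes from a factorisation \<open>exp t = 1 + t k(t)\<close> with \<open>k\<close> entire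
  (\<open>fun_derivation_exp\<close>, \<open>fun_derivation_ln\<close>).
\<close>

section \<open>Functions of class \<open>C\<^sup>k\<close>\<close>

lemma Ck_on_transfer:
  assumes "open S" "\<And>x. x \<in> S \<Longrightarrow> f x = g x" "Ck_on k S f"
  shows "Ck_on k S g"
  using assms(2,3)
proof (induction k arbitrary: f g)
  case 0
  then show ?case using continuous_on_cong[of S S f g] by simp
next
  case (Suc k)
  from Suc.prems(2) have C: "\<forall>x\<in>S. f differentiable (at x)"
    "\<And>v. Ck_on k S (\<lambda>x. frechet_derivative f (at x) v)"
    unfolding Ck_on.simps by blast+
  have D: "(f has_derivative frechet_derivative f (at x)) (at x)" if "x \<in> S" for x
    using C(1) that by (intro frechet_derivative_works[THEN iffD1]) blast
  have G: "(g has_derivative frechet_derivative f (at x)) (at x)" if "x \<in> S" for x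
    by (rule has_derivative_transform_within_open[OF D[OF that] assms(1) that Suc.prems(1)])
  have "frechet_derivative f (at x) v = frechet_derivative g (at x) v" if "x \<in> S" for x v
    by (simp add: frechet_derivative_at[OF G[OF that], symmetric])
  from Suc.IH[OF this C(2)] have "\<forall>v. Ck_on k S (\<lambda>x. frechet_derivative g (at x) v)"
    by blast
  moreover have "\<forall>x\<in>S. g differentiable (at x)"
    using G unfolding differentiable_def by blast
  ultimately show ?case unfolding Ck_on.simps by blast
qed

lemma Ck_on_subset: "Ck_on k S f \<Longrightarrow> T \<subseteq> S \<Longrightarrow> Ck_on k T f"
  by (induction k arbitrary: f) (auto intro: continuous_on_subset)

lemma Ck_on_SucD: "Ck_on (Suc k) S f \<Longrightarrow> Ck_on k S f"
proof (induction k arbitrary: f)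
  case 0
  then show ?case
    by (auto intro!: continuous_at_imp_continuous_on differentiable_imp_continuous_within)
next
  case (Suc k)
  have *: "\<forall>x\<in>S. f differentiable (at x)"
    "Ck_on (Suc k) S (\<lambda>x. frechet_derivative f (at x) v)" for v
    using Suc.prems Ck_on.simps(2)[of "Suc k" S f] by blast+
  show ?case
    unfolding Ck_on.simps(2)[of k] using *(1) Suc.IH[OF *(2)] by blast
qed

lemma Ck_on_SucI:
  assumes "open S" "\<And>x. x \<in> S \<Longrightarrow> (f has_derivative f' x) (at x)" "\<And>v. Ck_on k S (\<lambda>x. f' x v)"
  shows "Ck_on (Suc k) S f"
proof -
  have "frechet_derivative f (at x) v = f' x v" if "x \<in> S" for x v
    by (simp add: frechet_derivative_at[OF assms(2)[OF that], symmetric])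
  then have "f' x v = frechet_derivative f (at x) v" if "x \<in> S" for x v
    using that by simp
  from Ck_on_transfer[OF assms(1) this assms(3)]
  have "\<forall>v. Ck_on k S (\<lambda>x. frechet_derivative f (at x) v)" by blast
  moreover have "f differentiable (at x)" if "x \<in> S" for x
    using assms(2)[OF that] unfolding differentiable_def by blast
  ultimately show ?thesis unfolding Ck_on.simps(2) by blast
qed

lemma Ck_on_SucE:
  assumes "Ck_on (Suc k) S f"
  obtains f' where "\<And>x. x \<in> S \<Longrightarrow> (f has_derivative f' x) (at x)" "\<And>v. Ck_on k S (\<lambda>x. f' x v)"
proof (rule that[of "\<lambda>x. frechet_derivative f (at x)"])
  show "(f has_derivative frechet_derivative f (at x)) (at x)" if "x \<in> S" for x
    using assms that by (intro frechet_derivative_works[THEN iffD1]) simp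
  show "Ck_on k S (\<lambda>x. frechet_derivative f (at x) v)" for v
    using assms by simp
qed

lemma Ck_on_const: "open S \<Longrightarrow> Ck_on k S (\<lambda>_. c)"
proof (induction k arbitrary: c)
  case (Suc k)
  then show ?case by (intro Ck_on_SucI[where f' = "\<lambda>_ _. 0"]) auto
qed auto

lemma Ck_on_add:
  assumes "open S" "Ck_on k S f" "Ck_on k S g"
  shows "Ck_on k S (\<lambda>x. f x + g x)"
  using assms(2,3)
proof (induction k arbitrary: f g)
  case 0
  then show ?case by (auto intro: continuous_intros)
next
  case (Suc k)
  from Suc.prems obtain f' g' where
    "\<And>x. x \<in> S \<Longrightarrow> (f has_derivative f' x) (at x)" "\<And>v. Ck_on k S (\<lambda>x. f' x v)"
    "\<And>x. x \<in> S \<Longrightarrow> (g has_derivative g' x) (at x)" "\<And>v. Ck_on k S (\<lambda>x. g' x v)"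
    by (metis Ck_on_SucE)
  then show ?case
    by (intro Ck_on_SucI[where f' = "\<lambda>x v. f' x v + g' x v"])
       (auto intro!: derivative_intros Suc.IH assms(1))
qed

lemma Ck_on_bilinear:
  assumes "bounded_bilinear bop" "open S" "Ck_on k S f" "Ck_on k S g"
  shows "Ck_on k S (\<lambda>x. bop (f x) (g x))"
  using assms(3,4)
proof (induction k arbitrary: f g)
  case 0
  then show ?case using bounded_bilinear.continuous_on[OF assms(1)] by auto
next
  case (Suc k)
  from Suc.prems obtain f' g' where *:
    "\<And>x. x \<in> S \<Longrightarrow> (f has_derivative f' x) (at x)" "\<And>v. Ck_on k S (\<lambda>x. f' x v)"
    "\<And>x. x \<in> S \<Longrightarrow> (g has_derivative g' x) (at x)" "\<And>v. Ck_on k S (\<lambda>x. g' x v)"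
    by (metis Ck_on_SucE)
  show ?case
  proof (rule Ck_on_SucI[where f' = "\<lambda>x v. bop (f x) (g' x v) + bop (f' x v) (g x)"])
    show "((\<lambda>x. bop (f x) (g x)) has_derivative (\<lambda>v. bop (f x) (g' x v) + bop (f' x v) (g x))) (at x)"
      if "x \<in> S" for x
      by (rule bounded_bilinear.FDERIV[OF assms(1) *(1,3)[OF that]])
    show "Ck_on k S (\<lambda>x. bop (f x) (g' x v) + bop (f' x v) (g x))" for v
      by (intro Ck_on_add Suc.IH * assms(2) Suc.prems[THEN Ck_on_SucD])
  qed (rule assms)
qed

lemmas Ck_on_mult = Ck_on_bilinear[OF bounded_bilinear_mult]

text \<open>
  The derivative of \<open>h n \<circ> u\<close> is \<open>h (Suc n) \<circ> u\<close> times a derivative of \<open>u\<close>. Carrying the whole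
  sequence \<open>h\<close> of derivatives makes the induction on \<open>k\<close> close up.
\<close>

lemma Ck_on_compose:
  fixes u :: "'a::real_normed_vector \<Rightarrow> real" and h :: "nat \<Rightarrow> real \<Rightarrow> real"
  assumes "open S" "\<And>n t. t \<in> I \<Longrightarrow> (h n has_real_derivative h (Suc n) t) (at t)"
    "u ` S \<subseteq> I" "Ck_on k S u"
  shows "Ck_on k S (\<lambda>x. h n (u x))"
  using assms(4)
proof (induction k arbitrary: n)
  case 0
  have "continuous_on I (h n)"
    using assms(2) by (meson DERIV_isCont continuous_at_imp_continuous_on)
  then show ?case
    using 0 assms(3) continuous_on_compose2 by fastforce
next
  case (Suc k)
  from Suc.prems obtain u' where *:
    "\<And>x. x \<in> S \<Longrightarrow> (u has_derivative u' x) (at x)" "\<And>v. Ck_on k S (\<lambda>x. u' x v)"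
    by (metis Ck_on_SucE)
  show ?case
  proof (rule Ck_on_SucI[where f' = "\<lambda>x v. h (Suc n) (u x) * u' x v"])
    fix x assume "x \<in> S"
    then have "(h n has_derivative (\<lambda>y. h (Suc n) (u x) * y)) (at (u x))"
      using assms(2,3) by (auto simp: has_field_derivative_def)
    from has_derivative_compose[OF *(1)[OF \<open>x \<in> S\<close>] this]
    show "((\<lambda>x. h n (u x)) has_derivative (\<lambda>v. h (Suc n) (u x) * u' x v)) (at x)" .
  next
    show "Ck_on k S (\<lambda>x. h (Suc n) (u x) * u' x v)" for v
      by (intro Ck_on_mult assms(1) Suc.IH *(2) Suc.prems[THEN Ck_on_SucD])
  qed (rule assms)
qed

section \<open>Smooth functions on arbitrary sets\<close>

lemma smooth_on_subset:
  assumes "smooth_on S f" "T \<subseteq> S"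
  shows "smooth_on T f"
  unfolding smooth_on_def
proof
  fix x assume "x \<in> T"
  then obtain U g where "open U" "x \<in> U" "\<forall>k. Ck_on k U g" "\<forall>y\<in>S \<inter> U. g y = f y"
    using assms unfolding smooth_on_def by (meson subsetD)
  then show "\<exists>U g. open U \<and> x \<in> U \<and> (\<forall>k. Ck_on k U g) \<and> (\<forall>y\<in>T \<inter> U. g y = f y)"
    using assms(2) by (intro exI[of _ U] exI[of _ g]) auto
qed

lemma smooth_on_cong:
  assumes "\<And>x. x \<in> S \<Longrightarrow> f x = g x"
  shows "smooth_on S f \<longleftrightarrow> smooth_on S g"
  unfolding smooth_on_def using assms by simp

lemma smooth_on_const: "smooth_on S (\<lambda>_. c)"
  unfolding smooth_on_def by (metis Ck_on_const UNIV_I open_UNIV)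

lemma smooth_on_imp_continuous_on:
  assumes "smooth_on S f" shows "continuous_on S f"
  unfolding continuous_on_eq_continuous_within
proof
  fix x assume "x \<in> S"
  then obtain U g where U: "open U" "x \<in> U" "Ck_on 0 U g" "\<And>y. y \<in> S \<inter> U \<Longrightarrow> g y = f y"
    using assms unfolding smooth_on_def by meson
  then have "continuous (at x within S) g"
    by (auto intro: continuous_at_imp_continuous_within simp: continuous_on_eq_continuous_at)
  moreover have "\<forall>\<^sub>F y in at x within S. g y = f y"
    unfolding eventually_at_topological using U by (intro exI[of _ U]) blast
  ultimately show "continuous (at x within S) f"
    using U(2) U(4)[of x] \<open>x \<in> S\<close> tendsto_cong[of g f "at x within S" "g x"]
    by (simp add: continuous_within)
qed

text \<open>
  Pointwise binary operations only need to be treated on open sets: local extensions of the two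
  functions are combined on the intersection of their domains.
\<close>

lemma smooth_on_combine:
  fixes S :: "'a::real_normed_vector set"
  assumes "smooth_on S f" "smooth_on S g"
    and C: "\<And>(U :: 'a set) f g. open U \<Longrightarrow> \<forall>k. Ck_on k U f \<Longrightarrow> \<forall>k. Ck_on k U g \<Longrightarrow> \<forall>k. Ck_on k U (\<lambda>x. op (f x) (g x))"
  shows "smooth_on S (\<lambda>x. op (f x) (g x))"
  unfolding smooth_on_def
proof
  fix x assume "x \<in> S"
  then obtain U g1 V g2 where *: "open U" "x \<in> U" "\<forall>k. Ck_on k U g1" "\<forall>y\<in>S \<inter> U. g1 y = f y"
    "open V" "x \<in> V" "\<forall>k. Ck_on k V g2" "\<forall>y\<in>S \<inter> V. g2 y = g y"
    using assms unfolding smooth_on_def by meson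
  have "\<forall>k. Ck_on k (U \<inter> V) (\<lambda>x. op (g1 x) (g2 x))"
    by (rule C) (use * in \<open>auto intro: Ck_on_subset\<close>)
  then show "\<exists>U h. open U \<and> x \<in> U \<and> (\<forall>k. Ck_on k U h) \<and> (\<forall>y\<in>S \<inter> U. h y = op (f y) (g y))"
    using * by (intro exI[of _ "U \<inter> V"] exI[of _ "\<lambda>x. op (g1 x) (g2 x)"]) auto
qed

lemma smooth_on_add: "smooth_on S f \<Longrightarrow> smooth_on S g \<Longrightarrow> smooth_on S (\<lambda>x. f x + g x)"
  by (rule smooth_on_combine) (auto intro: Ck_on_add)

lemma smooth_on_bilinear:
  "bounded_bilinear bop \<Longrightarrow> smooth_on S f \<Longrightarrow> smooth_on S g \<Longrightarrow> smooth_on S (\<lambda>x. bop (f x) (g x))"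
  by (rule smooth_on_combine) (auto intro: Ck_on_bilinear)

lemmas smooth_on_mult = smooth_on_bilinear[OF bounded_bilinear_mult]
lemmas smooth_on_inner = smooth_on_bilinear[OF bounded_bilinear_inner]

lemma smooth_on_compose:
  fixes u :: "'a::real_normed_vector \<Rightarrow> real" and h :: "nat \<Rightarrow> real \<Rightarrow> real"
  assumes "open I" "\<And>n t. t \<in> I \<Longrightarrow> (h n has_real_derivative h (Suc n) t) (at t)"
    "u ` S \<subseteq> I" "smooth_on S u"
  shows "smooth_on S (\<lambda>x. h 0 (u x))"
  unfolding smooth_on_def
proof
  fix x assume "x \<in> S"
  then obtain U g where U: "open U" "x \<in> U" "\<forall>k. Ck_on k U g" "\<forall>y\<in>S \<inter> U. g y = u y"
    using assms unfolding smooth_on_def by meson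
  let ?U = "U \<inter> g -` I"
  have "open ?U"
    using U(1) U(3)[rule_format, of 0] assms(1) by (simp add: continuous_open_preimage)
  moreover have "Ck_on k ?U (\<lambda>x. h 0 (g x))" for k
    using U by (intro Ck_on_compose[where h = h and n = 0 and u = g, OF \<open>open ?U\<close> assms(2)])
      (auto intro: Ck_on_subset)
  ultimately show "\<exists>U g. open U \<and> x \<in> U \<and> (\<forall>k. Ck_on k U g) \<and> (\<forall>y\<in>S \<inter> U. g y = h 0 (u y))"
    using U \<open>x \<in> S\<close> assms(3) by (intro exI[of _ ?U] exI[of _ "\<lambda>x. h 0 (g x)"]) auto
qed

section \<open>Some smooth functions of one real variable\<close>

definition inverse_derivs :: "nat \<Rightarrow> real \<Rightarrow> real" where
  "inverse_derivs n t = (-1) ^ n * fact n * inverse t ^ Suc n"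

lemma inverse_derivs:
  assumes "t \<noteq> 0"
  shows "(inverse_derivs n has_real_derivative inverse_derivs (Suc n) t) (at t)"
  unfolding inverse_derivs_def
  by (rule derivative_eq_intros refl assms)+ (simp add: assms algebra_simps power2_eq_square)

definition ln_derivs :: "nat \<Rightarrow> real \<Rightarrow> real" where
  "ln_derivs n = (case n of 0 \<Rightarrow> ln | Suc n \<Rightarrow> inverse_derivs n)"

lemma ln_derivs:
  assumes "t > 0"
  shows "(ln_derivs n has_real_derivative ln_derivs (Suc n) t) (at t)"
  using inverse_derivs[of t] assms DERIV_ln[of t]
  by (cases n) (auto simp: ln_derivs_def inverse_derivs_def)

text \<open>
  The derivatives of \<open>(exp t - 1) / t\<close>. The power series, with coefficients \<open>1 / (k + 1)!\<close>, takes
  care of the removable singularity.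
\<close>

definition exp_quotient_derivs :: "nat \<Rightarrow> real \<Rightarrow> real" where
  "exp_quotient_derivs n t = (\<Sum>k. (diffs ^^ n) (\<lambda>k. inverse (fact (Suc k))) k * t ^ k)"

lemma summable_exp_quotient_derivs:
  "summable (\<lambda>k. (diffs ^^ n) (\<lambda>k. inverse (fact (Suc k))) k * (t::real) ^ k)"
proof (induction n arbitrary: t)
  case 0
  have "summable (\<lambda>k. norm (inverse (fact k) * t ^ k))"
    using summable_norm_exp[of t] by (simp add: divide_inverse_commute)
  moreover have "norm (inverse (fact (Suc k)) * t ^ k) \<le> norm (inverse (fact k) * t ^ k)" for k
    unfolding norm_mult by (intro mult_right_mono) (auto intro!: le_imp_inverse_le fact_mono simp del: fact_Suc)
  ultimately show ?case
    unfolding funpow_0 by (rule summable_comparison_test')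
next
  case (Suc n)
  then show ?case
    unfolding funpow.simps o_def by (rule termdiff_converges_all)
qed

lemma exp_quotient_derivs:
  "(exp_quotient_derivs n has_real_derivative exp_quotient_derivs (Suc n) t) (at t)"
  unfolding exp_quotient_derivs_def funpow.simps o_def
  by (rule termdiffs_strong_converges_everywhere) (rule summable_exp_quotient_derivs)

lemma exp_eq_quotient: "exp t = 1 + t * exp_quotient_derivs 0 t"
proof -
  have "(\<lambda>k. inverse (fact k) * t ^ k) sums exp t"
    using exp_converges[of t] by (simp add: divide_inverse_commute)
  then have "(\<lambda>k. inverse (fact (Suc k)) * t ^ Suc k) sums (exp t - 1)"
    by (subst sums_Suc_iff) simp
  moreover have "(\<lambda>k. inverse (fact (Suc k)) * t ^ Suc k) sums (t * exp_quotient_derivs 0 t)"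
    using sums_mult[OF summable_sums[OF summable_exp_quotient_derivs[of 0 t]], of t]
    unfolding exp_quotient_derivs_def funpow_0 by (simp add: mult_ac)
  ultimately show ?thesis using sums_unique2 by fastforce
qed

lemma exp_quotient_derivs_0: "exp_quotient_derivs 0 0 = 1"
  unfolding exp_quotient_derivs_def funpow_0
  by (subst powser_zero) simp

text \<open>
  The derivatives of \<open>exp (- 1 / t)\<close>, extended by \<open>0\<close> to \<open>t \<le> 0\<close>. With \<open>s = 1 / t\<close>, the derivative of
  \<open>p(s) exp (- s)\<close> is \<open>s\<^sup>2 (p - p')(s) exp (- s)\<close>, which gives the recursion for the polynomial factor.
\<close>

definition flat_fun_derivs :: "nat \<Rightarrow> real \<Rightarrow> real" where
  "flat_fun_derivs n t = (if t \<le> 0 then 0 else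
     poly (((\<lambda>p. [:0, 0, 1:] * (p - pderiv p)) ^^ n) 1) (inverse t) * exp (- inverse t))"

lemma tendsto_poly_exp: "((\<lambda>s. poly p s * exp (- s)) \<longlongrightarrow> (0::real)) at_top"
proof -
  have "((\<lambda>s. \<Sum>i\<le>degree p. coeff p i * (s ^ i / exp s)) \<longlongrightarrow> (\<Sum>i\<le>degree p. coeff p i * 0)) at_top"
    by (intro tendsto_sum tendsto_mult tendsto_const tendsto_power_div_exp_0)
  then show ?thesis
    by (simp add: poly_altdef sum_distrib_right exp_minus divide_inverse mult.assoc)
qed

text \<open>
  At \<open>t = 0\<close> the difference quotient from the right is \<open>s p(s) exp (- s)\<close> with \<open>s = 1 / t\<close>, which tends
  to \<open>0\<close> as \<open>s\<close> tends to infinity.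
\<close>

lemma flat_fun_derivs:
  "(flat_fun_derivs n has_real_derivative flat_fun_derivs (Suc n) t) (at t)"
proof -
  define p where "p = ((\<lambda>p. [:0, 0, 1:] * (p - pderiv p)) ^^ n) (1 :: real poly)"
  define f where "f = (\<lambda>t::real. poly p (inverse t) * exp (- inverse t))"
  have f: "flat_fun_derivs n t = (if t \<le> 0 then 0 else f t)" for t
    by (simp add: flat_fun_derivs_def f_def p_def)
  have Suc: "flat_fun_derivs (Suc n) t =
      (if t \<le> 0 then 0 else (inverse t)^2 * (poly p (inverse t) - poly (pderiv p) (inverse t)) * exp (- inverse t))" for t
    by (simp add: flat_fun_derivs_def p_def power2_eq_square algebra_simps)
  consider "t < 0" | "t = 0" | "t > 0" by linarith
  then show ?thesis
  proof cases
    case 1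
    have "((\<lambda>_. 0) has_real_derivative 0) (at t)" by simp
    then have "(flat_fun_derivs n has_real_derivative 0) (at t)"
      by (rule has_field_derivative_transform_within_open[where S = "{..<0}"]) (use 1 in \<open>auto simp: f\<close>)
    then show ?thesis using 1 by (simp add: Suc)
  next
    case 3
    have "(f has_real_derivative (inverse t)^2 * (poly p (inverse t) - poly (pderiv p) (inverse t)) * exp (- inverse t)) (at t)"
      unfolding f_def
      by (rule derivative_eq_intros DERIV_chain'[OF _ poly_DERIV] refl | use 3 in simp; fail)+
         (simp add: algebra_simps power2_eq_square)
    then have "(flat_fun_derivs n has_real_derivative (inverse t)^2 * (poly p (inverse t) - poly (pderiv p) (inverse t)) * exp (- inverse t)) (at t)"
      by (rule has_field_derivative_transform_within_open[where S = "{0<..}"]) (use 3 in \<open>auto simp: f\<close>)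
    then show ?thesis using 3 by (simp add: Suc)
  next
    case 2
    have "((\<lambda>h. inverse h * f h) \<longlongrightarrow> 0) (at_right 0)"
    proof -
      have "((\<lambda>s. poly (pCons 0 p) s * exp (- s)) \<longlongrightarrow> (0::real)) at_top"
        by (rule tendsto_poly_exp)
      from filterlim_compose[OF this filterlim_inverse_at_top_right]
      show ?thesis by (simp add: f_def mult_ac)
    qed
    then have "((\<lambda>h. flat_fun_derivs n h / h) \<longlongrightarrow> 0) (at_right 0)"
      by (rule Lim_transform_eventually)
         (auto simp: eventually_at_right_less f divide_inverse mult_ac
            intro: eventually_mono[OF eventually_at_right_less[of 0]])
    moreover have "((\<lambda>h. flat_fun_derivs n h / h) \<longlongrightarrow> 0) (at_left 0)"
      by (rule Lim_transform_eventually[OF tendsto_const])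
         (auto simp: f eventually_at_left_field intro!: exI[of _ "-1"])
    ultimately have "((\<lambda>h. flat_fun_derivs n h / h) \<longlongrightarrow> 0) (at 0)"
      by (simp add: filterlim_split_at)
    then show ?thesis
      unfolding 2 by (simp add: Suc has_field_derivative_iff) (simp add: f)
  qed
qed

section \<open>Smooth functions on a manifold\<close>

locale smooth_mfd =
  fixes M :: "('m::{t2_space, second_countable_topology}, 'a::euclidean_space) manifold"
  assumes mfd: "smooth_manifold M"
begin

lemma chart_ex: obtains U \<phi> where "(U, \<phi>) \<in> charts M" "m \<in> U"
proof -
  have "m \<in> (\<Union>(U, \<phi>)\<in>charts M. U)" using mfd unfolding smooth_manifold_def by simp
  then show ?thesis using that by auto
qed

lemma chart_open: "(U, \<phi>) \<in> charts M \<Longrightarrow> open U"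
  using mfd unfolding smooth_manifold_def by blast

lemma chart_homeo:
  assumes "(U, \<phi>) \<in> charts M"
  obtains \<psi> where "homeomorphism U (\<phi> ` U) \<phi> \<psi>"
  using assms mfd unfolding smooth_manifold_def by blast

lemma chart_inj: "(U, \<phi>) \<in> charts M \<Longrightarrow> inj_on \<phi> U"
  by (meson chart_homeo homeomorphism_def inj_on_inverseI)

lemma chart_inv [simp]: "(U, \<phi>) \<in> charts M \<Longrightarrow> x \<in> U \<Longrightarrow> inv_into U \<phi> (\<phi> x) = x"
  by (simp add: chart_inj)

lemma chart_image:
  assumes "(U, \<phi>) \<in> charts M" "open W"
  obtains O' where "open O'" "\<phi> ` (U \<inter> W) = model M \<inter> O'"
proof -
  obtain \<psi> where h: "homeomorphism U (\<phi> ` U) \<phi> \<psi>" using chart_homeo[OF assms(1)] .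
  have "openin (top_of_set U) (U \<inter> W)" using assms(2) by (simp add: openin_open_Int)
  from homeomorphism_imp_open_map[OF h this]
  have "openin (top_of_set (\<phi> ` U)) (\<phi> ` (U \<inter> W))" .
  moreover have "openin (top_of_set (model M)) (\<phi> ` U)"
    using assms(1) mfd unfolding smooth_manifold_def by blast
  ultimately have "openin (top_of_set (model M)) (\<phi> ` (U \<inter> W))" by (rule openin_trans)
  then show ?thesis using that by (auto simp: openin_open)
qed

lemma chart_image_model: "(U, \<phi>) \<in> charts M \<Longrightarrow> x \<in> U \<Longrightarrow> \<phi> x \<in> model M"
  using chart_image[of U \<phi> UNIV] by (metis IntE Int_UNIV_right imageI open_UNIV)

lemma smooth_fun_onI:
  "(\<And>U \<phi>. (U, \<phi>) \<in> charts M \<Longrightarrow> smooth_on (\<phi> ` (U \<inter> W)) (\<lambda>x. f (inv_into U \<phi> x))) \<Longrightarrow> smooth_fun_on M W f"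
  unfolding smooth_fun_on_def by (auto simp: o_def)

lemma smooth_fun_onD:
  "smooth_fun_on M W f \<Longrightarrow> (U, \<phi>) \<in> charts M \<Longrightarrow> smooth_on (\<phi> ` (U \<inter> W)) (\<lambda>x. f (inv_into U \<phi> x))"
  unfolding smooth_fun_on_def by (auto simp: o_def)

lemma smooth_fun_on_subset:
  assumes "smooth_fun_on M W f" "W' \<subseteq> W" shows "smooth_fun_on M W' f"
proof (rule smooth_fun_onI)
  fix U \<phi> assume "(U, \<phi>) \<in> charts M"
  from smooth_fun_onD[OF assms(1) this]
  show "smooth_on (\<phi> ` (U \<inter> W')) (\<lambda>x. f (inv_into U \<phi> x))"
    by (rule smooth_on_subset) (use assms(2) in auto)
qed

lemma smooth_fun_on_cong:
  assumes "smooth_fun_on M W f" "\<And>x. x \<in> W \<Longrightarrow> f x = g x" shows "smooth_fun_on M W g"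
proof (rule smooth_fun_onI)
  fix U \<phi> assume c: "(U, \<phi>) \<in> charts M"
  have "f (inv_into U \<phi> x) = g (inv_into U \<phi> x)" if "x \<in> \<phi> ` (U \<inter> W)" for x
    using that c assms(2) by auto
  then show "smooth_on (\<phi> ` (U \<inter> W)) (\<lambda>x. g (inv_into U \<phi> x))"
    using smooth_on_cong[of "\<phi> ` (U \<inter> W)" "\<lambda>x. f (inv_into U \<phi> x)" "\<lambda>x. g (inv_into U \<phi> x)"]
      smooth_fun_onD[OF assms(1) c] by metis
qed

lemma smooth_fun_on_const: "smooth_fun_on M W (\<lambda>_. c)"
  by (rule smooth_fun_onI) (rule smooth_on_const)

lemma smooth_fun_on_add:
  "smooth_fun_on M W f \<Longrightarrow> smooth_fun_on M W g \<Longrightarrow> smooth_fun_on M W (\<lambda>x. f x + g x)"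
  by (rule smooth_fun_onI, rule smooth_on_add) (erule (1) smooth_fun_onD)+

lemma smooth_fun_on_mult:
  "smooth_fun_on M W f \<Longrightarrow> smooth_fun_on M W g \<Longrightarrow> smooth_fun_on M W (\<lambda>x. f x * g x)"
  by (rule smooth_fun_onI, rule smooth_on_mult) (erule (1) smooth_fun_onD)+

lemma smooth_fun_on_compose:
  assumes "open I" "\<And>n t. t \<in> I \<Longrightarrow> (h n has_real_derivative h (Suc n) t) (at t)"
    "u ` W \<subseteq> I" "smooth_fun_on M W u"
  shows "smooth_fun_on M W (\<lambda>x. h 0 (u x))"
proof (rule smooth_fun_onI)
  fix U \<phi> assume c: "(U, \<phi>) \<in> charts M"
  show "smooth_on (\<phi> ` (U \<inter> W)) (\<lambda>x. h 0 (u (inv_into U \<phi> x)))"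
    by (rule smooth_on_compose[where h = h and I = I, OF assms(1,2) _ smooth_fun_onD[OF assms(4) c]])
       (use c assms(3) in auto)
qed

lemma smooth_fun_on_inverse:
  assumes "smooth_fun_on M W f" "\<And>x. x \<in> W \<Longrightarrow> f x \<noteq> 0"
  shows "smooth_fun_on M W (\<lambda>x. inverse (f x))"
proof -
  have "f ` W \<subseteq> - {0}" using assms(2) by auto
  from smooth_fun_on_compose[where h = inverse_derivs, OF open_Compl[OF closed_singleton] inverse_derivs this assms(1)]
  show ?thesis by (simp add: inverse_derivs_def)
qed

lemma smooth_fun_on_ln:
  assumes "smooth_fun_on M W f" "\<And>x. x \<in> W \<Longrightarrow> f x > 0"
  shows "smooth_fun_on M W (\<lambda>x. ln (f x))"
  using smooth_fun_on_compose[where h = ln_derivs and I = "{0<..}", OF _ ln_derivs _ assms(1)] assms(2)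
  by (auto simp: ln_derivs_def)

lemma smooth_fun_on_sum:
  "(\<And>i. i \<in> I \<Longrightarrow> smooth_fun_on M W (f i)) \<Longrightarrow> smooth_fun_on M W (\<lambda>x. \<Sum>i\<in>I. f i x)"
  by (induction I rule: infinite_finite_induct) (auto intro!: smooth_fun_on_const smooth_fun_on_add)

lemma smooth_fun_on_prod:
  "(\<And>i. i \<in> I \<Longrightarrow> smooth_fun_on M W (f i)) \<Longrightarrow> smooth_fun_on M W (\<lambda>x. \<Prod>i\<in>I. f i x)"
  by (induction I rule: infinite_finite_induct) (auto intro!: smooth_fun_on_const smooth_fun_on_mult)

text \<open>
  Charts map open sets to relatively open subsets of the model space. A smooth extension that is
  right on the image of \<open>V\<close> is therefore, after shrinking, right on the image of the whole of \<open>W\<close>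
  near the point.
\<close>

lemma smooth_fun_on_glue:
  assumes "\<And>m. m \<in> W \<Longrightarrow> \<exists>V. open V \<and> m \<in> V \<and> smooth_fun_on M V f"
  shows "smooth_fun_on M W f"
proof (rule smooth_fun_onI)
  fix U \<phi> assume c: "(U, \<phi>) \<in> charts M"
  let ?f = "\<lambda>x. f (inv_into U \<phi> x)"
  show "smooth_on (\<phi> ` (U \<inter> W)) ?f"
    unfolding smooth_on_def
  proof
    fix x assume "x \<in> \<phi> ` (U \<inter> W)"
    then obtain m where m: "m \<in> U" "m \<in> W" "x = \<phi> m" by blast
    obtain V where V: "open V" "m \<in> V" "smooth_fun_on M V f" using assms m by blast
    obtain O' where O': "open O'" "\<phi> ` (U \<inter> V) = model M \<inter> O'" using chart_image[OF c V(1)] .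
    have "x \<in> \<phi> ` (U \<inter> V)" using m V by blast
    then obtain Q g where Q: "open Q" "x \<in> Q" "\<forall>k. Ck_on k Q g" "\<forall>y\<in>\<phi> ` (U \<inter> V) \<inter> Q. g y = ?f y"
      using smooth_fun_onD[OF V(3) c] unfolding smooth_on_def by meson
    have "g y = ?f y" if "y \<in> \<phi> ` (U \<inter> W) \<inter> (Q \<inter> O')" for y
    proof -
      have "y \<in> model M" using that chart_image_model[OF c] by auto
      then show ?thesis using that Q(4) O'(2) by blast
    qed
    then show "\<exists>Q g. open Q \<and> x \<in> Q \<and> (\<forall>k. Ck_on k Q g) \<and> (\<forall>y\<in>\<phi> ` (U \<inter> W) \<inter> Q. g y = ?f y)"
      using Q O' \<open>x \<in> \<phi> ` (U \<inter> V)\<close>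
      by (intro exI[of _ "Q \<inter> O'"] exI[of _ g]) (auto intro: Ck_on_subset)
  qed
qed

lemma smooth_fun_on_continuous:
  assumes "open W" "smooth_fun_on M W f"
  shows "continuous_on W f"
proof -
  have "isCont f m" if "m \<in> W" for m
  proof -
    obtain U \<phi> where c: "(U, \<phi>) \<in> charts M" "m \<in> U" using chart_ex .
    obtain \<psi> where h: "homeomorphism U (\<phi> ` U) \<phi> \<psi>" using chart_homeo[OF c(1)] .
    have "continuous_on (\<phi> ` (U \<inter> W)) (\<lambda>x. f (inv_into U \<phi> x))"
      by (intro smooth_on_imp_continuous_on smooth_fun_onD assms c)
    moreover have "continuous_on (U \<inter> W) \<phi>"
      using h by (auto simp: homeomorphism_def intro: continuous_on_subset)
    ultimately have "continuous_on (U \<inter> W) (\<lambda>x. f (inv_into U \<phi> (\<phi> x)))"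
      by (rule continuous_on_compose2) auto
    then have "continuous_on (U \<inter> W) f"
      by (rule continuous_on_eq) (use c in auto)
    then show ?thesis
      using continuous_on_interior[of "U \<inter> W" f m] that c chart_open assms(1)
      by (simp add: interior_open open_Int)
  qed
  then show ?thesis by (simp add: continuous_at_imp_continuous_on)
qed

lemma open_nonzero:
  assumes "open W" "smooth_fun_on M W f"
  shows "open {x \<in> W. f x \<noteq> 0}"
proof -
  have "{x \<in> W. f x \<noteq> 0} = W \<inter> f -` (- {0})" by auto
  then show ?thesis
    using continuous_open_preimage[OF smooth_fun_on_continuous[OF assms] assms(1), of "- {0}"] open_Compl[OF closed_singleton[of "0::real"]] by simp
qed

text \<open>
  In a chart \<open>\<phi>\<close> around \<open>m\<close> the function is \<open>flat_fun_derivs 0 (e\<^sup>2 - \<bar>\<phi> x - \<phi> m\<bar>\<^sup>2)\<close>, normalised at \<open>m\<close>. It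
  vanishes off the inverse image \<open>K\<close> of a closed ball of the model space, which is compact, hence
  closed in the Hausdorff space \<open>M\<close>. The complement of \<open>K\<close> is the open set \<open>V\<close>, which makes products
  with functions and sections defined only on \<open>U\<close> smooth everywhere.
\<close>

lemma bump:
  assumes "open U" "m \<in> U"
  obtains \<beta> V where "\<beta> \<in> Cinf M" "open V" "V \<union> U = UNIV" "\<And>x. x \<in> V \<Longrightarrow> \<beta> x = 0" "\<beta> m = 1"
proof -
  obtain U0 \<phi> where c: "(U0, \<phi>) \<in> charts M" "m \<in> U0" using chart_ex .
  obtain \<psi> where h: "homeomorphism U0 (\<phi> ` U0) \<phi> \<psi>" using chart_homeo[OF c(1)] .
  obtain O' where O': "open O'" "\<phi> ` (U0 \<inter> U) = model M \<inter> O'" using chart_image[OF c(1) assms(1)] .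
  define p where "p = \<phi> m"
  have "p \<in> O'" using O'(2) c(2) assms(2) p_def by blast
  then obtain e where e: "e > 0" "cball p e \<subseteq> O'" using O'(1) open_contains_cball by blast
  define K where "K = \<psi> ` (cball p e \<inter> model M)"
  have sub: "cball p e \<inter> model M \<subseteq> \<phi> ` (U0 \<inter> U)" using O'(2) e(2) by blast
  have "subspace (model M)" using mfd unfolding smooth_manifold_def by blast
  then have "compact (cball p e \<inter> model M)" by (simp add: closed_subspace compact_Int_closed)
  moreover have "continuous_on (cball p e \<inter> model M) \<psi>"
    using h sub by (auto simp: homeomorphism_def intro!: continuous_on_subset[of "\<phi> ` U0" \<psi>])
  ultimately have "closed K"
    unfolding K_def by (intro compact_imp_closed compact_continuous_image)
  have KU: "K \<subseteq> U0 \<inter> U"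
    using h sub unfolding K_def homeomorphism_def by fastforce
  define \<beta> where "\<beta> = (\<lambda>x. if x \<in> U0 then flat_fun_derivs 0 (e\<^sup>2 + - ((\<phi> x + - p) \<bullet> (\<phi> x + - p))) else 0)"
  have zero: "\<beta> x = 0" if "x \<in> - K" for x
  proof (cases "x \<in> U0")
    case True
    have "\<phi> x \<notin> cball p e"
    proof
      assume "\<phi> x \<in> cball p e"
      then have "\<psi> (\<phi> x) \<in> K" using chart_image_model[OF c(1) True] unfolding K_def by blast
      then show False using that h True by (simp add: homeomorphism_def)
    qed
    then have "e \<le> norm (\<phi> x + - p)" by (simp add: dist_norm norm_minus_commute)
    then have "e\<^sup>2 \<le> (\<phi> x + - p) \<bullet> (\<phi> x + - p)"
      using e(1) by (simp add: power_mono flip: power2_norm_eq_inner)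
    then show ?thesis by (simp add: \<beta>_def flat_fun_derivs_def)
  qed (simp add: \<beta>_def)
  have "smooth_fun_on M U0 \<beta>"
  proof (rule smooth_fun_onI)
    fix V \<eta> assume v: "(V, \<eta>) \<in> charts M"
    have "smooth_on (\<eta> ` (V \<inter> U0)) (\<lambda>x. \<phi> (inv_into V \<eta> x))"
      using v c mfd unfolding smooth_manifold_def by (fastforce simp: o_def)
    then have "smooth_on (\<eta> ` (V \<inter> U0)) (\<lambda>x. \<phi> (inv_into V \<eta> x) + - p)"
      by (intro smooth_on_add smooth_on_const)
    note smooth_on_inner[OF this this]
    then have "smooth_on (\<eta> ` (V \<inter> U0)) (\<lambda>x. e\<^sup>2 + (-1) * ((\<phi> (inv_into V \<eta> x) + - p) \<bullet> (\<phi> (inv_into V \<eta> x) + - p)))"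
      by (intro smooth_on_add[OF smooth_on_const] smooth_on_mult[OF smooth_on_const])
    then have "smooth_on (\<eta> ` (V \<inter> U0)) (\<lambda>x. flat_fun_derivs 0 (e\<^sup>2 + (-1) * ((\<phi> (inv_into V \<eta> x) + - p) \<bullet> (\<phi> (inv_into V \<eta> x) + - p))))"
      by (intro smooth_on_compose[where I = UNIV and h = flat_fun_derivs] flat_fun_derivs) auto
    then show "smooth_on (\<eta> ` (V \<inter> U0)) (\<lambda>x. \<beta> (inv_into V \<eta> x))"
      by (subst smooth_on_cong[where g = "\<lambda>x. flat_fun_derivs 0 (e\<^sup>2 + (-1) * ((\<phi> (inv_into V \<eta> x) + - p) \<bullet> (\<phi> (inv_into V \<eta> x) + - p)))"])
         (use v in \<open>auto simp: \<beta>_def\<close>)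
  qed
  moreover have "smooth_fun_on M (- K) \<beta>"
    by (rule smooth_fun_on_cong[OF smooth_fun_on_const[of _ 0]]) (simp add: zero)
  ultimately have "smooth_fun_on M UNIV \<beta>"
    using KU \<open>closed K\<close> chart_open[OF c(1)] by (intro smooth_fun_on_glue) blast
  then have "(\<lambda>x. inverse (\<beta> m) * \<beta> x) \<in> Cinf M"
    unfolding Cinf_def by (auto intro: smooth_fun_on_mult smooth_fun_on_const)
  moreover have "\<beta> m \<noteq> 0"
    using c(2) e(1) by (simp add: \<beta>_def p_def flat_fun_derivs_def)
  ultimately show ?thesis
    using that[of "\<lambda>x. inverse (\<beta> m) * \<beta> x" "- K"] \<open>closed K\<close> KU zero by auto
qed

end

section \<open>Smooth sections\<close>

lemma span_list:
  assumes "v \<in> span (set vs)"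
  obtains c where "v = (\<Sum>i<length vs. c i *\<^sub>R vs ! i)"
proof -
  have "\<exists>c. v = (\<Sum>i<length vs. c i *\<^sub>R vs ! i)"
    using assms
  proof (induction vs arbitrary: v)
    case (Cons w ws)
    then obtain k where "v - k *\<^sub>R w \<in> span (set ws)" by (auto simp: span_insert)
    then obtain c where "v - k *\<^sub>R w = (\<Sum>i<length ws. c i *\<^sub>R ws ! i)" using Cons.IH by blast
    then have "v = (\<Sum>i<length (w # ws). (case i of 0 \<Rightarrow> k | Suc j \<Rightarrow> c j) *\<^sub>R (w # ws) ! i)"
      by (simp add: sum.lessThan_Suc_shift algebra_simps del: sum.lessThan_Suc)
    then show ?case by (rule exI[of _ "\<lambda>i. case i of 0 \<Rightarrow> k | Suc j \<Rightarrow> c j"])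
  qed simp
  then show ?thesis using that by blast
qed

context smooth_mfd
begin

lemma CinfI: "smooth_fun_on M UNIV f \<Longrightarrow> f \<in> Cinf M"
  by (simp add: Cinf_def)

lemma CinfD: "f \<in> Cinf M \<Longrightarrow> smooth_fun_on M W f"
  unfolding Cinf_def by (auto intro: smooth_fun_on_subset)

lemma Cinf_const: "(\<lambda>_. c) \<in> Cinf M"
  by (rule CinfI) (rule smooth_fun_on_const)

lemma Cinf_add: "f \<in> Cinf M \<Longrightarrow> g \<in> Cinf M \<Longrightarrow> (\<lambda>x. f x + g x) \<in> Cinf M"
  by (rule CinfI, rule smooth_fun_on_add) (erule CinfD)+

lemma Cinf_mult: "f \<in> Cinf M \<Longrightarrow> g \<in> Cinf M \<Longrightarrow> (\<lambda>x. f x * g x) \<in> Cinf M"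
  by (rule CinfI, rule smooth_fun_on_mult) (erule CinfD)+

lemma Cinf_sum: "(\<And>i. i \<in> I \<Longrightarrow> f i \<in> Cinf M) \<Longrightarrow> (\<lambda>x. \<Sum>i\<in>I. f i x) \<in> Cinf M"
  by (rule CinfI, rule smooth_fun_on_sum) (blast intro: CinfD)

lemma Cinf_prod: "(\<And>i. i \<in> I \<Longrightarrow> f i \<in> Cinf M) \<Longrightarrow> (\<lambda>x. \<Prod>i\<in>I. f i x) \<in> Cinf M"
  by (rule CinfI, rule smooth_fun_on_prod) (blast intro: CinfD)

lemma smooth_section_on_subset:
  assumes "smooth_section_on M B W s" "W' \<subseteq> W"
  shows "smooth_section_on M B W' s"
  unfolding smooth_section_on_def
proof (intro conjI ballI, goal_cases)
  case (1 m)
  then show ?case using assms unfolding smooth_section_on_def by blast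
next
  case (2 fr)
  obtain U es where fr: "fr = (U, es)" by fastforce
  then obtain c where "\<forall>i<length es. smooth_fun_on M (U \<inter> W) (c i)"
    "\<forall>m\<in>U \<inter> W. s m = (\<Sum>i<length es. c i m *\<^sub>R (es ! i) m)"
    using assms(1) 2 unfolding smooth_section_on_def by blast
  then show ?case
    using assms(2) unfolding fr by (auto intro!: exI[of _ c] intro: smooth_fun_on_subset)
qed

abbreviation smooth_coords where
  "smooth_coords U W es s c \<equiv> (\<forall>i<length es. smooth_fun_on M (U \<inter> W) (c i)) \<and>
     (\<forall>m\<in>U \<inter> W. s m = (\<Sum>i<length es. c i m *\<^sub>R (es ! i) m))"

lemma smooth_section_onI:
  assumes "\<And>m. m \<in> W \<Longrightarrow> s m \<in> fiber B m"
    "\<And>U es. (U, es) \<in> frames B \<Longrightarrow> \<exists>c. smooth_coords U W es s c"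
  shows "smooth_section_on M B W s"
  using assms unfolding smooth_section_on_def by blast

lemma smooth_section_on_fiber: "smooth_section_on M B W s \<Longrightarrow> m \<in> W \<Longrightarrow> s m \<in> fiber B m"
  unfolding smooth_section_on_def by blast

lemma smooth_section_onE:
  assumes "smooth_section_on M B W s" "(U, es) \<in> frames B"
  obtains c where "\<And>i. i < length es \<Longrightarrow> smooth_fun_on M (U \<inter> W) (c i)"
    "\<And>m. m \<in> U \<Longrightarrow> m \<in> W \<Longrightarrow> s m = (\<Sum>i<length es. c i m *\<^sub>R (es ! i) m)"
  using assms unfolding smooth_section_on_def by blast

lemma smooth_section_on_add:
  assumes "\<And>m. subspace (fiber B m)" "smooth_section_on M B W s" "smooth_section_on M B W t"
  shows "smooth_section_on M B W (\<lambda>m. s m + t m)"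
proof (rule smooth_section_onI)
  show "s m + t m \<in> fiber B m" if "m \<in> W" for m
    using smooth_section_on_fiber[OF assms(2) that] smooth_section_on_fiber[OF assms(3) that]
    by (rule subspace_add[OF assms(1)])
  fix U es assume fr: "(U, es) \<in> frames B"
  obtain c where c: "\<And>i. i < length es \<Longrightarrow> smooth_fun_on M (U \<inter> W) (c i)"
    "\<And>m. m \<in> U \<Longrightarrow> m \<in> W \<Longrightarrow> s m = (\<Sum>i<length es. c i m *\<^sub>R (es ! i) m)"
    using smooth_section_onE[OF assms(2) fr] by metis
  obtain d where d: "\<And>i. i < length es \<Longrightarrow> smooth_fun_on M (U \<inter> W) (d i)"
    "\<And>m. m \<in> U \<Longrightarrow> m \<in> W \<Longrightarrow> t m = (\<Sum>i<length es. d i m *\<^sub>R (es ! i) m)"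
    using smooth_section_onE[OF assms(3) fr] by metis
  show "\<exists>c. smooth_coords U W es (\<lambda>m. s m + t m) c"
  proof (intro exI[of _ "\<lambda>i m. c i m + d i m"] conjI allI impI ballI)
    show "smooth_fun_on M (U \<inter> W) (\<lambda>m. c i m + d i m)" if "i < length es" for i
      by (rule smooth_fun_on_add[OF c(1)[OF that] d(1)[OF that]])
  qed (simp add: c(2) d(2) scaleR_left_distrib sum.distrib)
qed

lemma smooth_section_on_smult:
  assumes "\<And>m. subspace (fiber B m)" "smooth_section_on M B W s" "smooth_fun_on M W f"
  shows "smooth_section_on M B W (smult f s)"
proof (rule smooth_section_onI)
  show "smult f s m \<in> fiber B m" if "m \<in> W" for m
    using smooth_section_on_fiber[OF assms(2) that]
    by (simp add: smult_def subspace_scale[OF assms(1)])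
  fix U es assume fr: "(U, es) \<in> frames B"
  obtain c where c: "\<And>i. i < length es \<Longrightarrow> smooth_fun_on M (U \<inter> W) (c i)"
    "\<And>m. m \<in> U \<Longrightarrow> m \<in> W \<Longrightarrow> s m = (\<Sum>i<length es. c i m *\<^sub>R (es ! i) m)"
    using smooth_section_onE[OF assms(2) fr] by metis
  show "\<exists>c. smooth_coords U W es (smult f s) c"
  proof (intro exI[of _ "\<lambda>i m. f m * c i m"] conjI allI impI ballI)
    show "smooth_fun_on M (U \<inter> W) (\<lambda>m. f m * c i m)" if "i < length es" for i
      by (rule smooth_fun_on_mult[OF smooth_fun_on_subset[OF assms(3)] c(1)[OF that]]) simp
  qed (simp add: c(2) smult_def scaleR_sum_right)
qed

lemma smooth_section_on_zero:
  assumes "\<And>m. subspace (fiber B m)"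
  shows "smooth_section_on M B W (\<lambda>_. 0)"
  by (rule smooth_section_onI)
     (auto intro!: exI[of _ "\<lambda>_ _. 0"] smooth_fun_on_const subspace_0 assms)

lemma smooth_section_on_sum:
  assumes "\<And>m. subspace (fiber B m)" "\<And>i. i \<in> I \<Longrightarrow> smooth_section_on M B W (s i)"
  shows "smooth_section_on M B W (\<lambda>m. \<Sum>i\<in>I. s i m)"
  using assms(2)
  by (induction I rule: infinite_finite_induct)
     (auto intro!: smooth_section_on_zero smooth_section_on_add assms(1))

lemma smooth_section_on_scaleR:
  assumes "\<And>m. subspace (fiber B m)" "smooth_section_on M B W s"
  shows "smooth_section_on M B W (\<lambda>m. c *\<^sub>R s m)"
  using smooth_section_on_smult[OF assms smooth_fun_on_const[of _ c]] by (simp add: smult_def)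

lemma SecI: "smooth_section_on M B UNIV s \<Longrightarrow> s \<in> Sec M B"
  by (simp add: Sec_def)

lemma SecD: "s \<in> Sec M B \<Longrightarrow> smooth_section_on M B W s"
  unfolding Sec_def by (auto intro: smooth_section_on_subset)

lemma Sec_fiber: "s \<in> Sec M B \<Longrightarrow> s m \<in> fiber B m"
  unfolding Sec_def by (auto intro: smooth_section_on_fiber)

text \<open>
  As \<open>w\<close> has no zeros, the coefficient of \<open>s\<close> in any frame \<open>[t]\<close> that agrees with \<open>w\<close> is the same function.
\<close>

lemma line_section_coefficient:
  assumes s: "s \<in> Sec M B" and w: "\<And>m. w m \<noteq> 0"
    and fr: "\<And>m. \<exists>U t. (U, [t]) \<in> frames B \<and> open U \<and> m \<in> U \<and> (\<forall>x\<in>U. t x = w x)"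
  obtains f where "f \<in> Cinf M" "s = smult f w"
proof -
  have ex: "\<exists>U c. open U \<and> m \<in> U \<and> smooth_fun_on M U c \<and> (\<forall>x\<in>U. s x = c x *\<^sub>R w x)" for m
  proof -
    obtain U t where U: "(U, [t]) \<in> frames B" "open U" "m \<in> U" "\<forall>x\<in>U. t x = w x" using fr by blast
    from smooth_section_onE[OF SecD[OF s, of UNIV] U(1)] obtain c where
      "smooth_fun_on M U (c (0::nat))" "\<And>x. x \<in> U \<Longrightarrow> s x = c 0 x *\<^sub>R t x" by auto
    then show ?thesis using U by (intro exI[of _ U] exI[of _ "c 0"]) simp
  qed
  then have "\<exists>a. s m = a *\<^sub>R w m" for m by metis
  then obtain f where f: "\<And>m. s m = f m *\<^sub>R w m" by metis
  have "f \<in> Cinf M"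
  proof (rule CinfI, rule smooth_fun_on_glue)
    fix m
    obtain U c where c: "open U" "m \<in> U" "smooth_fun_on M U c" "\<forall>x\<in>U. s x = c x *\<^sub>R w x" using ex by blast
    have "smooth_fun_on M U f"
      by (rule smooth_fun_on_cong[OF c(3)]) (metis c(4) f scaleR_cancel_right w)
    then show "\<exists>V. open V \<and> m \<in> V \<and> smooth_fun_on M V f" using c by blast
  qed
  then show ?thesis by (rule that) (simp add: f smult_def fun_eq_iff)
qed

text \<open>
  Extension by \<open>0\<close>: the product is smooth on \<open>U\<close>, it is \<open>0\<close> on \<open>V\<close>, and these two open sets cover.
\<close>

lemma bump_smult_fun:
  assumes \<beta>: "\<beta> \<in> Cinf M" "open V" "V \<union> U = UNIV" "\<And>x. x \<in> V \<Longrightarrow> \<beta> x = 0"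
    and U: "open U" "open U'" and c: "smooth_fun_on M (U' \<inter> U) c"
  shows "smooth_fun_on M U' (\<lambda>m. if m \<in> U then \<beta> m * c m else 0)"
proof (rule smooth_fun_on_glue)
  fix m assume m: "m \<in> U'"
  show "\<exists>V. open V \<and> m \<in> V \<and> smooth_fun_on M V (\<lambda>m. if m \<in> U then \<beta> m * c m else 0)"
  proof (cases "m \<in> U")
    case True
    have "smooth_fun_on M (U' \<inter> U) (\<lambda>m. \<beta> m * c m)"
      by (rule smooth_fun_on_mult[OF CinfD[OF \<beta>(1)] c])
    then have "smooth_fun_on M (U' \<inter> U) (\<lambda>m. if m \<in> U then \<beta> m * c m else 0)"
      by (rule smooth_fun_on_cong) simp
    then show ?thesis using True m U by blast
  next
    case False
    then have "m \<in> V" using \<beta>(3) by blast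
    moreover have "smooth_fun_on M V (\<lambda>m. if m \<in> U then \<beta> m * c m else 0)"
      by (rule smooth_fun_on_cong[OF smooth_fun_on_const[of _ 0]]) (simp add: \<beta>(4))
    ultimately show ?thesis using \<beta>(2) by blast
  qed
qed

lemma vb_subspace: "vector_bundle M B \<Longrightarrow> subspace (fiber B m)"
  unfolding vector_bundle_def by blast

lemma vb_frame_ex:
  assumes "vector_bundle M B"
  obtains U es where "(U, es) \<in> frames B" "m \<in> U"
proof -
  have "m \<in> (\<Union>(U, es)\<in>frames B. U)" using assms unfolding vector_bundle_def by simp
  then show ?thesis using that by auto
qed

lemma vb_frame:
  assumes "vector_bundle M B" "(U, es) \<in> frames B"
  shows "open U" "length es = rank B" "e \<in> set es \<Longrightarrow> smooth_section_on M B U e"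
    "m \<in> U \<Longrightarrow> distinct (map (\<lambda>e. e m) es)" "m \<in> U \<Longrightarrow> independent (set (map (\<lambda>e. e m) es))"
    "m \<in> U \<Longrightarrow> span (set (map (\<lambda>e. e m) es)) = fiber B m"
  using assms unfolding vector_bundle_def by blast+

lemma bump_smult_Sec:
  assumes "vector_bundle M B" and s: "smooth_section_on M B U s" and "open U"
    and \<beta>: "\<beta> \<in> Cinf M" "open V" "V \<union> U = UNIV" "\<And>x. x \<in> V \<Longrightarrow> \<beta> x = 0"
  shows "smult \<beta> s \<in> Sec M B"
proof (rule SecI, rule smooth_section_onI)
  fix m
  show "smult \<beta> s m \<in> fiber B m"
  proof (cases "m \<in> U")
    case True
    show ?thesis
      unfolding smult_def
      by (rule subspace_scale[OF vb_subspace[OF assms(1)] smooth_section_on_fiber[OF s True]])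
  next
    case False
    then have "\<beta> m = 0" using \<beta> by blast
    then show ?thesis by (simp add: smult_def subspace_0[OF vb_subspace[OF assms(1)]])
  qed
next
  fix U' es assume fr: "(U', es) \<in> frames B"
  obtain c where c: "\<And>i. i < length es \<Longrightarrow> smooth_fun_on M (U' \<inter> U) (c i)"
    "\<And>m. m \<in> U' \<Longrightarrow> m \<in> U \<Longrightarrow> s m = (\<Sum>i<length es. c i m *\<^sub>R (es ! i) m)"
    using smooth_section_onE[OF s fr] by metis
  show "\<exists>c. smooth_coords U' UNIV es (smult \<beta> s) c"
  proof (intro exI[of _ "\<lambda>i m. if m \<in> U then \<beta> m * c i m else 0"] conjI allI impI ballI)
    show "smooth_fun_on M (U' \<inter> UNIV) (\<lambda>m. if m \<in> U then \<beta> m * c i m else 0)" if "i < length es" for i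
      using bump_smult_fun[OF \<beta> assms(3) vb_frame(1)[OF assms(1) fr] c(1)[OF that]] by simp
    fix m assume m: "m \<in> U' \<inter> UNIV"
    show "smult \<beta> s m = (\<Sum>i<length es. (if m \<in> U then \<beta> m * c i m else 0) *\<^sub>R (es ! i) m)"
    proof (cases "m \<in> U")
      case True
      then show ?thesis using m by (simp add: c(2) smult_def scaleR_sum_right)
    next
      case False
      then have "\<beta> m = 0" using \<beta> by blast
      then show ?thesis using False by (simp add: smult_def)
    qed
  qed
qed

lemma frame_expand:
  assumes "vector_bundle M B" "(U, es) \<in> frames B" "m \<in> U" "v \<in> fiber B m"
  obtains c where "v = (\<Sum>i<length es. c i *\<^sub>R (es ! i) m)"
proof -
  have "v \<in> span (set (map (\<lambda>e. e m) es))" using vb_frame(6)[OF assms(1-3)] assms(4) by simp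
  then show ?thesis using span_list[of v "map (\<lambda>e. e m) es"] that by auto
qed

lemma Sec_through:
  assumes "vector_bundle M B" "v \<in> fiber B m"
  obtains s where "s \<in> Sec M B" "s m = v"
proof -
  obtain U es where fr: "(U, es) \<in> frames B" "m \<in> U" using vb_frame_ex[OF assms(1)] .
  obtain c where c: "v = (\<Sum>i<length es. c i *\<^sub>R (es ! i) m)"
    using frame_expand[OF assms(1) fr assms(2)] .
  note U = vb_frame(1)[OF assms(1) fr(1)]
  obtain \<beta> V where \<beta>: "\<beta> \<in> Cinf M" "open V" "V \<union> U = UNIV" "\<And>x. x \<in> V \<Longrightarrow> \<beta> x = 0" "\<beta> m = 1"
    using bump[OF U fr(2)] by metis
  have "smooth_section_on M B U (\<lambda>m. \<Sum>i<length es. c i *\<^sub>R (es ! i) m)"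
    by (intro smooth_section_on_sum smooth_section_on_scaleR vb_subspace[OF assms(1)] vb_frame(3)[OF assms(1) fr(1)])
       simp
  from bump_smult_Sec[OF assms(1) this U \<beta>(1-4)]
  have "smult \<beta> (\<lambda>m. \<Sum>i<length es. c i *\<^sub>R (es ! i) m) \<in> Sec M B" .
  moreover have "smult \<beta> (\<lambda>m. \<Sum>i<length es. c i *\<^sub>R (es ! i) m) m = v"
    by (simp add: smult_def \<beta>(5) flip: c)
  ultimately show ?thesis by (rule that)
qed

lemma Sec_add: "vector_bundle M B \<Longrightarrow> s \<in> Sec M B \<Longrightarrow> t \<in> Sec M B \<Longrightarrow> (\<lambda>m. s m + t m) \<in> Sec M B"
  by (rule SecI, rule smooth_section_on_add[OF vb_subspace]) (assumption | erule SecD)+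

lemma Sec_smult: "vector_bundle M B \<Longrightarrow> s \<in> Sec M B \<Longrightarrow> f \<in> Cinf M \<Longrightarrow> smult f s \<in> Sec M B"
  by (rule SecI, rule smooth_section_on_smult[OF vb_subspace]) (assumption | erule SecD | erule CinfD)+

lemma Sec_scaleR: "vector_bundle M B \<Longrightarrow> s \<in> Sec M B \<Longrightarrow> (\<lambda>m. c *\<^sub>R s m) \<in> Sec M B"
  by (rule SecI, rule smooth_section_on_scaleR[OF vb_subspace]) (assumption | erule SecD)+

lemma Sec_zero: "vector_bundle M B \<Longrightarrow> (\<lambda>_. 0) \<in> Sec M B"
  by (rule SecI, rule smooth_section_on_zero[OF vb_subspace])

lemma Sec_sum:
  "vector_bundle M B \<Longrightarrow> (\<And>i. i \<in> I \<Longrightarrow> s i \<in> Sec M B) \<Longrightarrow> (\<lambda>m. \<Sum>i\<in>I. s i m) \<in> Sec M B"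
  by (rule SecI, rule smooth_section_on_sum[OF vb_subspace]) (assumption | rule SecD)+

end

section \<open>Bundles in duality\<close>

text \<open>
  The bundle \<open>C\<close> plays the role of the dual of \<open>B\<close>. The pairing is abstract so that the results apply
  both to a bundle and its dual and, in the opposite direction, to the dual and the bundle itself.
\<close>

locale dual_pair = smooth_mfd M
  for M :: "('m::{t2_space, second_countable_topology}, 'a::euclidean_space) manifold" +
  fixes B :: "('m, 'v::real_vector) vbundle" and C :: "('m, 'w::real_vector) vbundle"
    and p :: "'m \<Rightarrow> 'w \<Rightarrow> 'v \<Rightarrow> real"
  assumes vb: "vector_bundle M B"
    and subC: "subspace (fiber C m)"
    and coverC: "\<exists>U cs. (U, cs) \<in> frames C \<and> m \<in> U"
    and p_add_right: "w \<in> fiber C m \<Longrightarrow> v \<in> fiber B m \<Longrightarrow> v' \<in> fiber B m \<Longrightarrow> p m w (v + v') = p m w v + p m w v'"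
    and p_scale_right: "w \<in> fiber C m \<Longrightarrow> v \<in> fiber B m \<Longrightarrow> p m w (c *\<^sub>R v) = c * p m w v"
    and p_add_left: "w \<in> fiber C m \<Longrightarrow> w' \<in> fiber C m \<Longrightarrow> v \<in> fiber B m \<Longrightarrow> p m (w + w') v = p m w v + p m w' v"
    and p_scale_left: "w \<in> fiber C m \<Longrightarrow> v \<in> fiber B m \<Longrightarrow> p m (c *\<^sub>R w) v = c * p m w v"
    and frame_dual: "(U, cs) \<in> frames C \<Longrightarrow> \<exists>bs. (U, bs) \<in> frames B \<and> length bs = length cs \<and>
      (\<forall>m\<in>U. (\<forall>i<length cs. (cs ! i) m \<in> fiber C m \<and>
            (\<forall>j<length cs. p m ((cs ! i) m) ((bs ! j) m) = (if i = j then 1 else 0))) \<and>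
         (\<forall>w\<in>fiber C m. w = (\<Sum>i<length cs. p m w ((bs ! i) m) *\<^sub>R (cs ! i) m)))"
begin

lemma frame_dualE:
  assumes "(U, cs) \<in> frames C"
  obtains bs where "(U, bs) \<in> frames B" "length bs = length cs"
    "\<And>m i. m \<in> U \<Longrightarrow> i < length cs \<Longrightarrow> (cs ! i) m \<in> fiber C m"
    "\<And>m i j. m \<in> U \<Longrightarrow> i < length cs \<Longrightarrow> j < length cs \<Longrightarrow> p m ((cs ! i) m) ((bs ! j) m) = (if i = j then 1 else 0)"
    "\<And>m w. m \<in> U \<Longrightarrow> w \<in> fiber C m \<Longrightarrow> w = (\<Sum>i<length cs. p m w ((bs ! i) m) *\<^sub>R (cs ! i) m)"
proof -
  from frame_dual[OF assms] obtain bs where *: "(U, bs) \<in> frames B \<and> length bs = length cs \<and>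
      (\<forall>m\<in>U. (\<forall>i<length cs. (cs ! i) m \<in> fiber C m \<and>
            (\<forall>j<length cs. p m ((cs ! i) m) ((bs ! j) m) = (if i = j then 1 else 0))) \<and>
         (\<forall>w\<in>fiber C m. w = (\<Sum>i<length cs. p m w ((bs ! i) m) *\<^sub>R (cs ! i) m)))" by (elim exE)
  show ?thesis by (rule that[of bs]) (use * in blast)+
qed

lemma p_sum_right:
  assumes "w \<in> fiber C m" "\<And>i. i \<in> I \<Longrightarrow> v i \<in> fiber B m"
  shows "p m w (\<Sum>i\<in>I. a i *\<^sub>R v i) = (\<Sum>i\<in>I. a i * p m w (v i))"
proof -
  note sub = vb_subspace[OF vb, of m]
  have "p m w 0 = 0" using p_scale_right[of w m 0 0] subspace_0[OF sub] assms(1) by simp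
  then show ?thesis
    using assms(2)
    by (induction I rule: infinite_finite_induct)
       (simp_all add: p_add_right[OF assms(1)] p_scale_right[OF assms(1)] subspace_scale[OF sub] subspace_sum[OF sub])
qed

lemma p_sum_left:
  assumes "v \<in> fiber B m" "\<And>i. i \<in> I \<Longrightarrow> w i \<in> fiber C m"
  shows "p m (\<Sum>i\<in>I. a i *\<^sub>R w i) v = (\<Sum>i\<in>I. a i * p m (w i) v)"
proof -
  note sub = subC[of m]
  have "p m 0 v = 0" using p_scale_left[of 0 m v 0] subspace_0[OF sub] assms(1) by simp
  then show ?thesis
    using assms(2)
    by (induction I rule: infinite_finite_induct)
       (simp_all add: p_add_left[OF _ _ assms(1)] p_scale_left[OF _ assms(1)] subspace_scale[OF sub] subspace_sum[OF sub])
qed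

lemma p_nondegenerate:
  assumes "w \<in> fiber C m" "w' \<in> fiber C m" "\<And>v. v \<in> fiber B m \<Longrightarrow> p m w v = p m w' v"
  shows "w = w'"
proof -
  obtain U cs where fr: "(U, cs) \<in> frames C" "m \<in> U" using coverC by metis
  obtain bs where bs: "(U, bs) \<in> frames B" "length bs = length cs"
     "\<And>m w. m \<in> U \<Longrightarrow> w \<in> fiber C m \<Longrightarrow> w = (\<Sum>i<length cs. p m w ((bs ! i) m) *\<^sub>R (cs ! i) m)"
    by (rule frame_dualE[OF fr(1)], rule that; assumption)
  have "(bs ! i) m \<in> fiber B m" if "i < length cs" for i
    using that bs(2) smooth_section_on_fiber[OF vb_frame(3)[OF vb bs(1)] fr(2)] by simp
  then have "(\<Sum>i<length cs. p m w ((bs ! i) m) *\<^sub>R (cs ! i) m) = (\<Sum>i<length cs. p m w' ((bs ! i) m) *\<^sub>R (cs ! i) m)"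
    by (simp add: assms(3))
  then show ?thesis using bs(3)[OF fr(2) assms(1)] bs(3)[OF fr(2) assms(2)] by simp
qed

lemma section_eqI:
  assumes "s \<in> Sec M C" "s' \<in> Sec M C"
    "\<And>Y. Y \<in> Sec M B \<Longrightarrow> (\<lambda>m. p m (s m) (Y m)) = (\<lambda>m. p m (s' m) (Y m))"
  shows "s = s'"
proof
  fix m
  show "s m = s' m"
  proof (rule p_nondegenerate)
    fix v assume "v \<in> fiber B m"
    then obtain Y where "Y \<in> Sec M B" "Y m = v" using Sec_through[OF vb] by metis
    then show "p m (s m) v = p m (s' m) v" using fun_cong[OF assms(3), of Y m] by simp
  qed (use assms Sec_fiber in auto)
qed

text \<open>
  If \<open>\<beta>\<close> is a bump function at \<open>m\<close> and \<open>Y = \<Sum> y\<^sub>i b\<^sub>i\<close> in a frame, then \<open>\<beta>\<^sup>2 Y = \<Sum> (\<beta> y\<^sub>i) (\<beta> b\<^sub>i)\<close> is an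
  identity between global sections with smooth coefficients. Applying \<open>F\<close> and evaluating at \<open>m\<close>,
  where \<open>\<beta>\<close> is \<open>1\<close>, shows that \<open>F Y\<close> at \<open>m\<close> depends only on the value \<open>Y m\<close>.
\<close>

lemma functional_at:
  assumes F: "\<And>Y. Y \<in> Sec M B \<Longrightarrow> F Y \<in> Cinf M"
    and F_add: "\<And>Y Z. Y \<in> Sec M B \<Longrightarrow> Z \<in> Sec M B \<Longrightarrow> F (\<lambda>m. Y m + Z m) = (\<lambda>m. F Y m + F Z m)"
    and F_smult: "\<And>f Y. f \<in> Cinf M \<Longrightarrow> Y \<in> Sec M B \<Longrightarrow> F (smult f Y) = (\<lambda>m. f m * F Y m)"
  shows "\<exists>w\<in>fiber C m. \<forall>Y\<in>Sec M B. p m w (Y m) = F Y m"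
proof -
  obtain U cs where fr: "(U, cs) \<in> frames C" "m \<in> U" using coverC by metis
  obtain bs where bs: "(U, bs) \<in> frames B" "length bs = length cs"
     and dual': "\<And>m i. m \<in> U \<Longrightarrow> i < length cs \<Longrightarrow> (cs ! i) m \<in> fiber C m"
       "\<And>m i j. m \<in> U \<Longrightarrow> i < length cs \<Longrightarrow> j < length cs \<Longrightarrow> p m ((cs ! i) m) ((bs ! j) m) = (if i = j then 1 else 0)"
    by (rule frame_dualE[OF fr(1)], rule that; assumption)
  note dual = dual'[OF fr(2)]
  note U = vb_frame(1)[OF vb bs(1)]
  obtain \<beta> V where \<beta>: "\<beta> \<in> Cinf M" "open V" "V \<union> U = UNIV" "\<And>x. x \<in> V \<Longrightarrow> \<beta> x = 0" "\<beta> m = 1"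
    using bump[OF U fr(2)] by metis
  have b_sec: "smooth_section_on M B U (bs ! i)" if "i < length cs" for i
    using that bs(2) by (intro vb_frame(3)[OF vb bs(1)]) simp
  have b_fib: "(bs ! i) m \<in> fiber B m" if "i < length cs" for i
    by (rule smooth_section_on_fiber[OF b_sec[OF that] fr(2)])
  define b where "b = (\<lambda>i. smult \<beta> (bs ! i))"
  have b: "b i \<in> Sec M B" if "i < length cs" for i
    unfolding b_def by (rule bump_smult_Sec[OF vb b_sec[OF that] U \<beta>(1-4)])
  define w where "w = (\<Sum>i<length cs. F (b i) m *\<^sub>R (cs ! i) m)"
  have wfib: "w \<in> fiber C m"
    unfolding w_def by (intro subspace_sum subspace_scale subC dual) simp
  have w_b: "p m w ((bs ! j) m) = F (b j) m" if "j < length cs" for j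
  proof -
    have "p m w ((bs ! j) m) = (\<Sum>i<length cs. F (b i) m * p m ((cs ! i) m) ((bs ! j) m))"
      unfolding w_def by (intro p_sum_left b_fib that dual) simp
    also have "\<dots> = (\<Sum>i<length cs. if i = j then F (b i) m else 0)"
      by (intro sum.cong) (simp_all add: dual that)
    finally show ?thesis using that by simp
  qed
  have F_sum: "F (\<lambda>x. \<Sum>i<k. smult (y i) (b i) x) = (\<lambda>x. \<Sum>i<k. y i x * F (b i) x)"
    if "k \<le> length cs" "\<And>i. i < k \<Longrightarrow> y i \<in> Cinf M" for k y
    using that
  proof (induction k)
    case 0
    have "F (smult (\<lambda>_. 0) (\<lambda>_. 0)) = (\<lambda>m. 0 * F (\<lambda>_. 0) m)"
      by (rule F_smult[OF Cinf_const Sec_zero[OF vb]])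
    then show ?case by (simp add: smult_def)
  next
    case (Suc k)
    have "F (\<lambda>x. (\<Sum>i<k. smult (y i) (b i) x) + smult (y k) (b k) x) =
        (\<lambda>x. F (\<lambda>x. \<Sum>i<k. smult (y i) (b i) x) x + F (smult (y k) (b k)) x)"
      using Suc.prems by (intro F_add Sec_sum[OF vb] Sec_smult[OF vb] b) auto
    also have "\<dots> = (\<lambda>x. (\<Sum>i<k. y i x * F (b i) x) + y k x * F (b k) x)"
      using Suc by (simp add: F_smult b)
    finally show ?case by simp
  qed
  have "p m w (Y m) = F Y m" if Y: "Y \<in> Sec M B" for Y
  proof -
    obtain y where y: "\<And>i. i < length bs \<Longrightarrow> smooth_fun_on M (U \<inter> UNIV) (y i)"
      "\<And>m. m \<in> U \<Longrightarrow> m \<in> UNIV \<Longrightarrow> Y m = (\<Sum>i<length bs. y i m *\<^sub>R (bs ! i) m)"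
      using smooth_section_onE[OF SecD[OF Y] bs(1)] by metis
    define y' where "y' = (\<lambda>i m. if m \<in> U then \<beta> m * y i m else 0)"
    have y': "y' i \<in> Cinf M" if "i < length cs" for i
      using bump_smult_fun[OF \<beta>(1-4) U open_UNIV, of "y i"] y(1)[of i] bs(2) that
      by (simp add: y'_def Cinf_def)
    have "smult (\<lambda>x. \<beta> x * \<beta> x) Y x = (\<Sum>i<length cs. smult (y' i) (b i) x)" for x
    proof (cases "x \<in> U")
      case True
      then show ?thesis
        by (simp add: smult_def y(2) bs(2) y'_def b_def scaleR_sum_right mult_ac)
    next
      case False
      then have "\<beta> x = 0" using \<beta>(3,4) by blast
      then show ?thesis using False by (simp add: smult_def y'_def)
    qed
    then have "F (smult (\<lambda>x. \<beta> x * \<beta> x) Y) = F (\<lambda>x. \<Sum>i<length cs. smult (y' i) (b i) x)"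
      by presburger
    also have "\<dots> = (\<lambda>x. \<Sum>i<length cs. y' i x * F (b i) x)"
      by (intro F_sum y') auto
    finally have "(\<lambda>x. (\<beta> x * \<beta> x) * F Y x) = (\<lambda>x. \<Sum>i<length cs. y' i x * F (b i) x)"
      using F_smult[OF Cinf_mult[OF \<beta>(1) \<beta>(1)] Y] by simp
    from fun_cong[OF this, of m] have "F Y m = (\<Sum>i<length cs. y i m * F (b i) m)"
      using fr(2) by (simp add: \<beta>(5) y'_def)
    also have "\<dots> = (\<Sum>i<length cs. y i m * p m w ((bs ! i) m))"
      by (simp add: w_b)
    also have "\<dots> = p m w (Y m)"
      using fr(2) p_sum_right[OF wfib, of "{..<length cs}" "\<lambda>i. (bs ! i) m" "\<lambda>i. y i m"] b_fib
      by (simp add: y(2) bs(2))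
    finally show ?thesis by simp
  qed
  then show ?thesis using wfib by blast
qed

text \<open>
  Choosing values pointwise leaves smoothness to be shown: near \<open>m\<close> the coefficients of the section in
  a frame are \<open>F (\<beta> b\<^sub>i) / \<beta>\<close>, for a bump function \<open>\<beta>\<close> at \<open>m\<close>.
\<close>

lemma functional_section:
  assumes F: "\<And>Y. Y \<in> Sec M B \<Longrightarrow> F Y \<in> Cinf M"
    and F_add: "\<And>Y Z. Y \<in> Sec M B \<Longrightarrow> Z \<in> Sec M B \<Longrightarrow> F (\<lambda>m. Y m + Z m) = (\<lambda>m. F Y m + F Z m)"
    and F_smult: "\<And>f Y. f \<in> Cinf M \<Longrightarrow> Y \<in> Sec M B \<Longrightarrow> F (smult f Y) = (\<lambda>m. f m * F Y m)"
  shows "\<exists>!s. s \<in> Sec M C \<and> (\<forall>Y\<in>Sec M B. (\<lambda>m. p m (s m) (Y m)) = F Y)"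
proof -
  have "\<exists>s. \<forall>m. s m \<in> fiber C m \<and> (\<forall>Y\<in>Sec M B. p m (s m) (Y m) = F Y m)"
  proof (rule choice, rule allI)
    fix m
    show "\<exists>w. w \<in> fiber C m \<and> (\<forall>Y\<in>Sec M B. p m w (Y m) = F Y m)"
      using functional_at[of F m] F F_add F_smult by blast
  qed
  then obtain s where s: "\<And>m. s m \<in> fiber C m" "\<And>Y m. Y \<in> Sec M B \<Longrightarrow> p m (s m) (Y m) = F Y m"
    by blast
  have "s \<in> Sec M C"
  proof (rule SecI, rule smooth_section_onI)
    fix U cs assume fr: "(U, cs) \<in> frames C"
    obtain bs where bs: "(U, bs) \<in> frames B" "length bs = length cs"
      "\<And>m w. m \<in> U \<Longrightarrow> w \<in> fiber C m \<Longrightarrow> w = (\<Sum>i<length cs. p m w ((bs ! i) m) *\<^sub>R (cs ! i) m)"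
      by (rule frame_dualE[OF fr(1)], rule that; assumption)
    note U = vb_frame(1)[OF vb bs(1)]
    show "\<exists>c. smooth_coords U UNIV cs s c"
    proof (intro exI[of _ "\<lambda>i m. p m (s m) ((bs ! i) m)"] conjI allI impI ballI)
      fix i assume i: "i < length cs"
      have b_sec: "smooth_section_on M B U (bs ! i)"
        using i bs(2) by (intro vb_frame(3)[OF vb bs(1)]) simp
      show "smooth_fun_on M (U \<inter> UNIV) (\<lambda>m. p m (s m) ((bs ! i) m))"
      proof (rule smooth_fun_on_glue)
        fix m assume "m \<in> U \<inter> UNIV"
        then have "m \<in> U" by simp
        obtain \<beta> V where \<beta>: "\<beta> \<in> Cinf M" "open V" "V \<union> U = UNIV" "\<And>x. x \<in> V \<Longrightarrow> \<beta> x = 0" "\<beta> m = 1"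
          using bump[OF U \<open>m \<in> U\<close>] by metis
        let ?W = "{x \<in> U. \<beta> x \<noteq> 0}"
        have b: "smult \<beta> (bs ! i) \<in> Sec M B"
          by (rule bump_smult_Sec[OF vb b_sec U \<beta>(1-4)])
        have "smooth_fun_on M ?W (\<lambda>x. F (smult \<beta> (bs ! i)) x * inverse (\<beta> x))"
          using CinfD[OF F[OF b]] CinfD[OF \<beta>(1)]
          by (intro smooth_fun_on_mult smooth_fun_on_inverse) auto
        then have "smooth_fun_on M ?W (\<lambda>m. p m (s m) ((bs ! i) m))"
        proof (rule smooth_fun_on_cong)
          fix x assume x: "x \<in> ?W"
          have "F (smult \<beta> (bs ! i)) x = \<beta> x * p x (s x) ((bs ! i) x)"
            using s(2)[OF b, of x] p_scale_right[OF s(1) smooth_section_on_fiber[OF b_sec], of x] x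
            by (simp add: smult_def)
          then show "F (smult \<beta> (bs ! i)) x * inverse (\<beta> x) = p x (s x) ((bs ! i) x)"
            using x by simp
        qed
        moreover have "open ?W" by (rule open_nonzero[OF U CinfD[OF \<beta>(1)]])
        ultimately show "\<exists>V. open V \<and> m \<in> V \<and> smooth_fun_on M V (\<lambda>m. p m (s m) ((bs ! i) m))"
          using \<open>m \<in> U\<close> \<beta>(5) by (intro exI[of _ ?W]) auto
      qed
    qed (use bs(3) s(1) in auto)
  qed (rule s(1))
  then show ?thesis
    using s(2) by (intro ex1I[of _ s]) (auto intro!: section_eqI)
qed

end

section \<open>Dual spaces and dual frames\<close>

lemma dual_spaceD:
  assumes "\<phi> \<in> dual_space V"
  shows "x \<in> V \<Longrightarrow> y \<in> V \<Longrightarrow> \<phi> (x + y) = \<phi> x + \<phi> y" "x \<in> V \<Longrightarrow> \<phi> (c *\<^sub>R x) = c * \<phi> x"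
    "x \<notin> V \<Longrightarrow> \<phi> x = 0"
  using assms unfolding dual_space_def by blast+

lemma subspace_dual_space: "subspace (dual_space V)"
  unfolding subspace_def dual_space_def by (auto simp: algebra_simps)

lemma dual_space_sum:
  assumes "\<phi> \<in> dual_space V" "subspace V" "\<And>i. i \<in> I \<Longrightarrow> v i \<in> V"
  shows "\<phi> (\<Sum>i\<in>I. a i *\<^sub>R v i) = (\<Sum>i\<in>I. a i * \<phi> (v i))"
proof -
  have "\<phi> 0 = 0" using dual_spaceD(2)[OF assms(1), of 0 0] subspace_0[OF assms(2)] by simp
  then show ?thesis
    using assms(3)
    by (induction I rule: infinite_finite_induct)
       (simp_all add: dual_spaceD[OF assms(1)] subspace_scale[OF assms(2)] subspace_sum[OF assms(2)])
qed

lemma dual_space_eqI: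
  assumes "\<phi> \<in> dual_space V" "\<psi> \<in> dual_space V" "subspace V" "span (set vs) = V"
    "\<And>i. i < length vs \<Longrightarrow> \<phi> (vs ! i) = \<psi> (vs ! i)"
  shows "\<phi> = \<psi>"
proof
  fix x
  show "\<phi> x = \<psi> x"
  proof (cases "x \<in> V")
    case True
    then obtain c where x: "x = (\<Sum>i<length vs. c i *\<^sub>R vs ! i)"
      using span_list assms(4) by metis
    have "vs ! i \<in> V" if "i < length vs" for i
      using that assms(4) span_base[of "vs ! i" "set vs"] by simp
    then show ?thesis
      unfolding x using dual_space_sum[OF assms(1,3), of "{..<length vs}" "\<lambda>i. vs ! i" c]
        dual_space_sum[OF assms(2,3), of "{..<length vs}" "\<lambda>i. vs ! i" c] by (simp add: assms(5))
  qed (simp add: dual_spaceD(3)[OF assms(1)] dual_spaceD(3)[OF assms(2)])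
qed

lemma dual_vector_ex:
  assumes "distinct vs" "independent (set vs)" "span (set vs) = V" "i < length vs"
  shows "\<exists>!\<phi>. \<phi> \<in> dual_space V \<and> (\<forall>j<length vs. \<phi> (vs ! j) = (if i = j then 1 else 0))"
proof -
  obtain g :: "'a \<Rightarrow> real" where g: "linear g" "\<forall>x\<in>set vs. g x = (if x = vs ! i then 1 else 0)"
    using linear_independent_extend[OF assms(2), of "\<lambda>x. if x = vs ! i then 1 else 0"] by blast
  have V: "subspace V" using assms(3) by auto
  have in_V: "vs ! j \<in> V" if "j < length vs" for j
    using that assms(3) span_base[of "vs ! j" "set vs"] by simp
  let ?\<phi> = "\<lambda>x. if x \<in> V then g x else 0"
  have \<phi>: "?\<phi> \<in> dual_space V"
    unfolding dual_space_def using V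
    by (auto simp: linear_add[OF g(1)] linear_scale[OF g(1)] subspace_add subspace_scale)
  have val: "?\<phi> (vs ! j) = (if i = j then 1 else 0)" if "j < length vs" for j
    using that in_V[OF that] g(2) assms(1,4) by (auto simp: nth_eq_iff_index_eq)
  show ?thesis
  proof (rule ex1I[of _ ?\<phi>])
    fix \<psi> assume "\<psi> \<in> dual_space V \<and> (\<forall>j<length vs. \<psi> (vs ! j) = (if i = j then 1 else 0))"
    then show "\<psi> = ?\<phi>" using val by (intro dual_space_eqI[OF _ \<phi> V assms(3)]) simp_all
  qed (use \<phi> val in blast)
qed

context smooth_mfd
begin

lemma frame_fiber:
  assumes "vector_bundle M B" "(U, es) \<in> frames B" "m \<in> U" "i < length es"
  shows "(es ! i) m \<in> fiber B m"
  by (rule smooth_section_on_fiber[OF vb_frame(3)[OF assms(1,2)] assms(3)]) (use assms(4) in simp)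

lemma dual_frame:
  assumes "vector_bundle M B" "(U, es) \<in> frames B" "m \<in> U"
  shows "length (dual_frame B es) = length es"
    and "i < length es \<Longrightarrow> (dual_frame B es ! i) m \<in> dual_space (fiber B m)"
    and "i < length es \<Longrightarrow> j < length es \<Longrightarrow> (dual_frame B es ! i) m ((es ! j) m) = (if i = j then 1 else 0)"
proof -
  show "length (dual_frame B es) = length es" by (simp add: dual_frame_def)
  let ?P = "\<lambda>i \<phi>. \<phi> \<in> dual_space (fiber B m) \<and> (\<forall>j<length es. \<phi> ((es ! j) m) = (if i = j then 1 else 0))"
  have "?P i ((dual_frame B es ! i) m)" if "i < length es" for i
  proof -
    have "\<exists>!\<phi>. ?P i \<phi>"
      using dual_vector_ex[OF vb_frame(4)[OF assms] vb_frame(5)[OF assms] vb_frame(6)[OF assms], of i] that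
      by simp
    from theI'[OF this] show ?thesis using that by (simp add: dual_frame_def)
  qed
  then show "i < length es \<Longrightarrow> (dual_frame B es ! i) m \<in> dual_space (fiber B m)"
    "i < length es \<Longrightarrow> j < length es \<Longrightarrow> (dual_frame B es ! i) m ((es ! j) m) = (if i = j then 1 else 0)"
    by blast+
qed

lemma frame_expand_dual:
  assumes "vector_bundle M B" "(U, es) \<in> frames B" "m \<in> U" "v \<in> fiber B m"
  shows "v = (\<Sum>i<length es. (dual_frame B es ! i) m v *\<^sub>R (es ! i) m)"
proof -
  obtain c where c: "v = (\<Sum>i<length es. c i *\<^sub>R (es ! i) m)"
    using frame_expand[OF assms] .
  have "(dual_frame B es ! i) m v = c i" if "i < length es" for i
  proof -
    have "(dual_frame B es ! i) m v = (\<Sum>j<length es. c j * (dual_frame B es ! i) m ((es ! j) m))"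
      unfolding c using frame_fiber[OF assms(1-3)]
      by (intro dual_space_sum[OF dual_frame(2)[OF assms(1-3) that] vb_subspace[OF assms(1)]]) simp
    also have "\<dots> = (\<Sum>j<length es. if i = j then c j else 0)"
      using that by (intro sum.cong) (simp_all add: dual_frame(3)[OF assms(1-3)])
    finally show ?thesis using that by simp
  qed
  then show ?thesis using c by simp
qed

lemma dual_frame_expand:
  assumes "vector_bundle M B" "(U, es) \<in> frames B" "m \<in> U" "\<phi> \<in> dual_space (fiber B m)"
  shows "\<phi> = (\<Sum>i<length es. \<phi> ((es ! i) m) *\<^sub>R (dual_frame B es ! i) m)"
proof -
  have *: "(dual_frame B es ! i) m \<in> dual_space (fiber B m)" if "i \<in> {..<length es}" for i
    using dual_frame(2)[OF assms(1-3)] that by simp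
  show ?thesis
  proof (rule dual_space_eqI[OF assms(4) _ vb_subspace[OF assms(1)] vb_frame(6)[OF assms(1-3)]])
    show "(\<Sum>i<length es. \<phi> ((es ! i) m) *\<^sub>R (dual_frame B es ! i) m) \<in> dual_space (fiber B m)"
      by (intro subspace_sum subspace_scale subspace_dual_space *)
    have sum_apply: "(\<Sum>i\<in>I. f i) x = (\<Sum>i\<in>I. f i x)" for I and f :: "nat \<Rightarrow> 'b \<Rightarrow> real" and x
      by (induction I rule: infinite_finite_induct) auto
    fix j assume "j < length (map (\<lambda>e. e m) es)"
    then have j: "j < length es" by simp
    have "(\<Sum>i<length es. \<phi> ((es ! i) m) *\<^sub>R (dual_frame B es ! i) m) ((es ! j) m)
        = (\<Sum>i<length es. if i = j then \<phi> ((es ! i) m) else 0)"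
      unfolding sum_apply using j by (intro sum.cong) (simp_all add: dual_frame(3)[OF assms(1-3)])
    then show "\<phi> (map (\<lambda>e. e m) es ! j) =
        (\<Sum>i<length es. \<phi> ((es ! i) m) *\<^sub>R (dual_frame B es ! i) m) (map (\<lambda>e. e m) es ! j)"
      using j by simp
  qed
qed

lemma frames_dual_bundle:
  "(U, fs) \<in> frames (dual_bundle B) \<longleftrightarrow> (\<exists>es. (U, es) \<in> frames B \<and> fs = dual_frame B es)"
  by (auto simp: dual_bundle_def)

lemma fiber_dual_bundle [simp]: "fiber (dual_bundle B) m = dual_space (fiber B m)"
  by (simp add: dual_bundle_def)

lemma dual_pair_dual:
  assumes "vector_bundle M B"
  shows "dual_pair M B (dual_bundle B) (\<lambda>m w v. w v)"
proof (unfold_locales, goal_cases)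
  case (3 m)
  then show ?case using vb_frame_ex[OF assms, of m] frames_dual_bundle by metis
next
  case (8 U cs)
  then obtain es where es: "(U, es) \<in> frames B" "cs = dual_frame B es"
    using frames_dual_bundle by blast
  have len: "length cs = length es" using es(2) by (simp add: dual_frame_def)
  show ?case
  proof (intro exI[of _ es] conjI ballI allI impI)
    fix m w assume "m \<in> U" "w \<in> fiber (dual_bundle B) m"
    then show "w = (\<Sum>i<length cs. w ((es ! i) m) *\<^sub>R (cs ! i) m)"
      unfolding len unfolding es(2) using dual_frame_expand[OF assms es(1)] by simp
  qed (use es len dual_frame[OF assms es(1)] in simp_all)
qed (use assms subspace_dual_space in \<open>auto dest: dual_spaceD\<close>)

lemma dual_pair_predual:
  assumes "vector_bundle M B" "vector_bundle M (dual_bundle B)"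
  shows "dual_pair M (dual_bundle B) B (\<lambda>m v w. w v)"
proof (unfold_locales, goal_cases)
  case (3 m)
  then show ?case using vb_frame_ex[OF assms(1), of m] by metis
next
  case (8 U cs)
  show ?case
  proof (intro exI[of _ "dual_frame B cs"] conjI ballI allI impI)
    fix m w assume "m \<in> U" "w \<in> fiber B m"
    then show "w = (\<Sum>i<length cs. (dual_frame B cs ! i) m w *\<^sub>R (cs ! i) m)"
      by (rule frame_expand_dual[OF assms(1) 8])
  next
    show "(U, dual_frame B cs) \<in> frames (dual_bundle B)" using 8 frames_dual_bundle by blast
    show "length (dual_frame B cs) = length cs" by (simp add: dual_frame_def)
    show "(cs ! i) m \<in> fiber B m" if "m \<in> U" "i < length cs" for m i
      by (rule frame_fiber[OF assms(1) 8 that])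
    show "(dual_frame B cs ! j) m ((cs ! i) m) = (if i = j then 1 else 0)"
      if "m \<in> U" "i < length cs" "j < length cs" for m i j
      using dual_frame(3)[OF assms(1) 8 that(1,3,2)] by auto
  qed
qed (use assms vb_subspace[OF assms(1)] in \<open>auto dest: dual_spaceD\<close>)

end

section \<open>Determinants and wedge products\<close>

lemma det_mat_eq_sum:
  "Determinant.det (Matrix.mat n n (\<lambda>(i, j). H i j)) = (\<Sum>p | p permutes {..<n}. of_int (sign p) * (\<Prod>i<n. H i (p i)))"
proof -
  have "Determinant.det (Matrix.mat n n (\<lambda>(i, j). H i j)) =
      (\<Sum>p | p permutes {0..<n}. of_int (sign p) * (\<Prod>i = 0..<n. Matrix.mat n n (\<lambda>(i, j). H i j) $$ (i, p i)))"
    by (rule det_def') simp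
  also have "\<dots> = (\<Sum>p | p permutes {..<n}. of_int (sign p) * (\<Prod>i<n. H i (p i)))"
    by (auto simp: atLeast0LessThan permutes_in_image intro!: sum.cong prod.cong)
  finally show ?thesis .
qed

lemma wedge_eq_det:
  assumes "length \<phi>s = length xs" "set \<phi>s \<subseteq> dual_space V"
  shows "wedge V xs \<phi>s = Determinant.det (Matrix.mat (length xs) (length xs) (\<lambda>(i, j). (\<phi>s ! i) (xs ! j)))"
  unfolding det_mat_eq_sum using assms by (simp add: wedge_def)

lemma wedge_outside: "\<not> (length \<phi>s = length xs \<and> set \<phi>s \<subseteq> dual_space V) \<Longrightarrow> wedge V xs \<phi>s = 0"
  by (simp only: wedge_def if_False)

text \<open>
  The matrix \<open>\<phi>\<^sub>i(y\<^sub>j)\<close> is the product of \<open>\<phi>\<^sub>i(x\<^sub>k)\<close> with the transpose of \<open>a\<close>.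
\<close>

lemma wedge_change:
  assumes "subspace V" "set xs \<subseteq> V" "length xs = n" "length ys = n"
    "\<And>j. j < n \<Longrightarrow> ys ! j = (\<Sum>k<n. a j k *\<^sub>R xs ! k)"
  shows "wedge V ys = Determinant.det (Matrix.mat n n (\<lambda>(j, k). a j k)) *\<^sub>R wedge V xs"
proof
  fix \<phi>s
  show "wedge V ys \<phi>s = (Determinant.det (Matrix.mat n n (\<lambda>(j, k). a j k)) *\<^sub>R wedge V xs) \<phi>s"
  proof (cases "length \<phi>s = n \<and> set \<phi>s \<subseteq> dual_space V")
    case True
    let ?X = "Matrix.mat n n (\<lambda>(i, j). (\<phi>s ! i) (xs ! j))" and ?Y = "Matrix.mat n n (\<lambda>(i, j). (\<phi>s ! i) (ys ! j))"
      and ?A = "Matrix.mat n n (\<lambda>(j, k). a j k)"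
    have "?Y = ?X * transpose_mat ?A"
    proof (rule eq_matI)
      fix i j assume ij: "i < dim_row (?X * transpose_mat ?A)" "j < dim_col (?X * transpose_mat ?A)"
      have "(\<phi>s ! i) (ys ! j) = (\<Sum>k<n. a j k * (\<phi>s ! i) (xs ! k))"
        using ij True assms(2,3) unfolding assms(5)[of j]
        by (subst assms(5)) (auto intro!: dual_space_sum[OF _ assms(1)] simp: subset_iff)
      then show "?Y $$ (i, j) = (?X * transpose_mat ?A) $$ (i, j)"
        using ij by (simp add: scalar_prod_def atLeast0LessThan mult.commute)
    qed auto
    then have "Determinant.det ?Y = Determinant.det ?A * Determinant.det ?X"
      using Determinant.det_mult[of ?X n "transpose_mat ?A"] Determinant.det_transpose[of ?A n] by simp
    then show ?thesis
      using True assms(3,4) by (simp add: wedge_eq_det)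
  qed (use assms(3,4) in \<open>auto simp: wedge_outside\<close>)
qed

lemma sum_lessThan_add: "(\<Sum>i<m + n. f i) = (\<Sum>i<m. f i) + (\<Sum>i<n. f (m + i :: nat))"
  for f :: "nat \<Rightarrow> 'b::comm_monoid_add"
  by (induction n) (simp_all add: add.assoc)

section \<open>The canonical volume of the double of a vector bundle\<close>

lemma frames_direct_sum:
  "(W, bs) \<in> frames (direct_sum A B) \<longleftrightarrow> (\<exists>U es V fs. W = U \<inter> V \<and>
     bs = map (\<lambda>e m. (e m, 0)) es @ map (\<lambda>e m. (0, e m)) fs \<and> (U, es) \<in> frames A \<and> (V, fs) \<in> frames B)"
  by (auto simp: direct_sum_def)

lemma fiber_direct_sum [simp]: "fiber (direct_sum A B) m = fiber A m \<times> fiber B m"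
  by (simp add: direct_sum_def)

lemma rank_direct_sum: "vbundle.rank (direct_sum A B) = vbundle.rank A + vbundle.rank B"
  by (simp add: direct_sum_def)

definition sum_frame :: "('m \<Rightarrow> 'v::real_vector) list \<Rightarrow> ('m \<Rightarrow> 'w::real_vector) list \<Rightarrow> ('m \<Rightarrow> 'v \<times> 'w) list" where
  "sum_frame es fs = map (\<lambda>e m. (e m, 0)) es @ map (\<lambda>e m. (0, e m)) fs"

lemma sum_frame_nth:
  "length (sum_frame es fs) = length es + length fs"
  "i < length es \<Longrightarrow> (sum_frame es fs ! i) m = ((es ! i) m, 0)"
  "j < length fs \<Longrightarrow> (sum_frame es fs ! (length es + j)) m = (0, (fs ! j) m)"
  by (simp_all add: sum_frame_def nth_append)

lemma sum_frame_expand: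
  "(\<Sum>i<length es + length fs. a i *\<^sub>R (sum_frame es fs ! i) m) =
   (\<Sum>i<length es. a i *\<^sub>R (es ! i) m, \<Sum>j<length fs. a (length es + j) *\<^sub>R (fs ! j) m)"
  by (rule prod_eqI) (simp_all add: sum_lessThan_add fst_sum snd_sum sum_frame_nth)

context smooth_mfd
begin

lemma direct_sum_section_onI:
  assumes "smooth_section_on M A W s" "smooth_section_on M B W t"
  shows "smooth_section_on M (direct_sum A B) W (\<lambda>m. (s m, t m))"
proof (rule smooth_section_onI)
  show "(s m, t m) \<in> fiber (direct_sum A B) m" if "m \<in> W" for m
    using smooth_section_on_fiber[OF assms(1) that] smooth_section_on_fiber[OF assms(2) that] by simp
  fix U' bs assume "(U', bs) \<in> frames (direct_sum A B)"
  then obtain U es V fs where fr: "U' = U \<inter> V" "bs = sum_frame es fs" "(U, es) \<in> frames A" "(V, fs) \<in> frames B"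
    unfolding frames_direct_sum sum_frame_def by blast
  obtain c where c: "\<And>i. i < length es \<Longrightarrow> smooth_fun_on M (U \<inter> W) (c i)"
    "\<And>m. m \<in> U \<Longrightarrow> m \<in> W \<Longrightarrow> s m = (\<Sum>i<length es. c i m *\<^sub>R (es ! i) m)"
    by (rule smooth_section_onE[OF assms(1) fr(3)], rule that; assumption)
  obtain d where d: "\<And>i. i < length fs \<Longrightarrow> smooth_fun_on M (V \<inter> W) (d i)"
    "\<And>m. m \<in> V \<Longrightarrow> m \<in> W \<Longrightarrow> t m = (\<Sum>i<length fs. d i m *\<^sub>R (fs ! i) m)"
    by (rule smooth_section_onE[OF assms(2) fr(4)], rule that; assumption)
  define a where "a = (\<lambda>i. if i < length es then c i else d (i - length es))"
  show "\<exists>c. smooth_coords U' W bs (\<lambda>m. (s m, t m)) c"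
  proof (intro exI[of _ a] conjI allI impI ballI)
    fix i assume "i < length bs"
    then show "smooth_fun_on M (U' \<inter> W) (a i)"
      unfolding a_def fr(1,2) sum_frame_nth
      by (auto intro: smooth_fun_on_subset[OF c(1)] smooth_fun_on_subset[OF d(1)])
  next
    fix m assume "m \<in> U' \<inter> W"
    then show "(s m, t m) = (\<Sum>i<length bs. a i m *\<^sub>R (bs ! i) m)"
      unfolding fr(1,2) sum_frame_nth sum_frame_expand by (simp add: a_def c(2) d(2))
  qed
qed

end

text \<open>
  The vector bundle underlying the double. That the dual of \<open>A\<close> is a vector bundle is part of the
  hypothesis that it carries a Lie algebroid structure.
\<close>

locale dual_bundles = smooth_mfd M
  for M :: "('m::{t2_space, second_countable_topology}, 'a::euclidean_space) manifold" +
  fixes A :: "('m, 'v::real_vector) vbundle"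
  assumes vbA: "vector_bundle M A" and vbD: "vector_bundle M (dual_bundle A)"
begin

sublocale right: dual_pair M A "dual_bundle A" "\<lambda>m w v. w v"
  by (rule dual_pair_dual[OF vbA])

sublocale left: dual_pair M "dual_bundle A" A "\<lambda>m v w. w v"
  by (rule dual_pair_predual[OF vbA vbD])

abbreviation E :: "('m, 'v \<times> ('v \<Rightarrow> real)) vbundle" where
  "E \<equiv> direct_sum A (dual_bundle A)"

abbreviation n :: nat where
  "n \<equiv> vbundle.rank E"

lemma rank_E: "n = vbundle.rank A + vbundle.rank A"
  by (simp add: rank_direct_sum dual_bundle_def)

lemma subspace_E: "subspace (fiber E m)"
  using vb_subspace[OF vbA] vb_subspace[OF vbD] by (simp add: subspace_Times)

lemma frames_E:
  assumes "(W, bs) \<in> frames E"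
  obtains U es V gs where "W = U \<inter> V" "bs = sum_frame es (dual_frame A gs)" "(U, es) \<in> frames A" "(V, gs) \<in> frames A"
  using assms unfolding frames_direct_sum sum_frame_def frames_dual_bundle by blast

text \<open>
  A frame together with its dual frame is a hyperbolic frame of \<open>A \<oplus> A\<^sup>*\<close>. The frames of the direct
  sum combine a frame of \<open>A\<close> with the dual of a possibly different frame.
\<close>

abbreviation hyp :: "('m \<Rightarrow> 'v) list \<Rightarrow> ('m \<Rightarrow> 'v \<times> ('v \<Rightarrow> real)) list" where
  "hyp es \<equiv> sum_frame es (dual_frame A es)"

lemma frames_E_hyperbolic:
  assumes "(U, es) \<in> frames A"
  shows "(U, hyp es) \<in> frames E"
  using assms unfolding frames_direct_sum sum_frame_def frames_dual_bundle by (metis Int_absorb)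

lemma length_frame_A: "(U, es) \<in> frames A \<Longrightarrow> length es = vbundle.rank A"
  by (rule vb_frame(2)[OF vbA])

lemma length_dual_frame [simp]: "length (dual_frame A es) = length es"
  by (simp add: dual_frame_def)

lemma length_frame_E: "(W, bs) \<in> frames E \<Longrightarrow> length bs = n"
  by (elim frames_E) (simp add: sum_frame_nth rank_E length_frame_A)

lemma frame_E_smooth:
  assumes "(W, bs) \<in> frames E" "b \<in> set bs"
  shows "smooth_section_on M E W b"
proof -
  obtain U es V gs where fr: "W = U \<inter> V" "bs = sum_frame es (dual_frame A gs)" "(U, es) \<in> frames A" "(V, gs) \<in> frames A"
    using frames_E[OF assms(1)] .
  have frV: "(V, dual_frame A gs) \<in> frames (dual_bundle A)" using fr(4) frames_dual_bundle by blast
  consider e where "e \<in> set es" "b = (\<lambda>m. (e m, 0))" | f where "f \<in> set (dual_frame A gs)" "b = (\<lambda>m. (0, f m))"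
    using assms(2) unfolding fr(2) sum_frame_def by auto
  then show ?thesis
  proof cases
    case 1
    have "smooth_section_on M A W e"
      by (rule smooth_section_on_subset[OF vb_frame(3)[OF vbA fr(3) 1(1)]]) (simp add: fr(1))
    then show ?thesis unfolding 1(2)
      by (rule direct_sum_section_onI) (rule smooth_section_on_zero[OF vb_subspace[OF vbD]])
  next
    case 2
    have "smooth_section_on M (dual_bundle A) W f"
      by (rule smooth_section_on_subset[OF vb_frame(3)[OF vbD frV 2(1)]]) (simp add: fr(1))
    then show ?thesis unfolding 2(2)
      by (rule direct_sum_section_onI[rotated]) (rule smooth_section_on_zero[OF vb_subspace[OF vbA]])
  qed
qed

lemma frame_E_fiber: "(W, bs) \<in> frames E \<Longrightarrow> m \<in> W \<Longrightarrow> i < length bs \<Longrightarrow> (bs ! i) m \<in> fiber E m"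
  by (rule smooth_section_on_fiber[OF frame_E_smooth]) auto

lemma frame_E_fibers:
  assumes "(W, bs) \<in> frames E" "m \<in> W"
  shows "set (map (\<lambda>b. b m) bs) \<subseteq> fiber E m"
  using smooth_section_on_fiber[OF frame_E_smooth[OF assms(1)] assms(2)] by (auto simp del: fiber_direct_sum)

text \<open>
  The factor is the determinant of the coefficients of the sections in the frame, a polynomial in
  smooth functions.
\<close>

lemma wedge_sec_smooth:
  assumes fr: "(U, bs) \<in> frames E" and xs: "\<And>x. x \<in> set xs \<Longrightarrow> smooth_section_on M E W x" "length xs = n"
  obtains c where "smooth_fun_on M (U \<inter> W) c" "\<And>m. m \<in> U \<Longrightarrow> m \<in> W \<Longrightarrow> wedge_sec E xs m = c m *\<^sub>R wedge_sec E bs m"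
proof -
  note len = length_frame_E[OF fr]
  let ?Q = "\<lambda>j a. (\<forall>i<n. smooth_fun_on M (U \<inter> W) (a i)) \<and>
      (\<forall>m\<in>U \<inter> W. (xs ! j) m = (\<Sum>i<n. a i m *\<^sub>R (bs ! i) m))"
  have ex: "\<exists>a. ?Q j a" if "j < n" for j
  proof -
    have "xs ! j \<in> set xs" using that xs(2) by simp
    note sm = xs(1)[OF this]
    obtain a where "\<And>i. i < length bs \<Longrightarrow> smooth_fun_on M (U \<inter> W) (a i)"
      "\<And>m. m \<in> U \<Longrightarrow> m \<in> W \<Longrightarrow> (xs ! j) m = (\<Sum>i<length bs. a i m *\<^sub>R (bs ! i) m)"
      by (rule smooth_section_onE[OF sm fr], rule that; assumption)
    then show ?thesis unfolding len by (intro exI[of _ a]) blast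
  qed
  define a where "a = (\<lambda>j. SOME a. ?Q j a)"
  have Q: "?Q j (a j)" if "j < n" for j
    unfolding a_def by (rule someI_ex[OF ex[OF that]])
  have a: "\<And>j i. j < n \<Longrightarrow> i < n \<Longrightarrow> smooth_fun_on M (U \<inter> W) (a j i)"
      "\<And>j m. j < n \<Longrightarrow> m \<in> U \<inter> W \<Longrightarrow> (xs ! j) m = (\<Sum>i<n. a j i m *\<^sub>R (bs ! i) m)"
    using Q by blast+
  let ?c = "\<lambda>m. Determinant.det (Matrix.mat n n (\<lambda>(j, k). a j k m))"
  have "smooth_fun_on M (U \<inter> W) ?c"
    unfolding det_mat_eq_sum
  proof (rule smooth_fun_on_sum, rule smooth_fun_on_mult[OF smooth_fun_on_const], rule smooth_fun_on_prod)
    fix p i assume "p \<in> {p. p permutes {..<n}}" "i \<in> {..<n}"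
    then show "smooth_fun_on M (U \<inter> W) (a i (p i))"
      using a(1) permutes_in_image[of p "{..<n}" i] by auto
  qed
  moreover have "wedge_sec E xs m = ?c m *\<^sub>R wedge_sec E bs m" if "m \<in> U" "m \<in> W" for m
    unfolding wedge_sec_def
  proof (rule wedge_change[OF subspace_E])
    show "set (map (\<lambda>x. x m) bs) \<subseteq> fiber E m"
      by (rule frame_E_fibers[OF fr that(1)])
    show "map (\<lambda>x. x m) xs ! j = (\<Sum>k<n. a j k m *\<^sub>R map (\<lambda>x. x m) bs ! k)" if "j < n" for j
      using that a(2)[OF that, of m] \<open>m \<in> U\<close> \<open>m \<in> W\<close> len xs(2) by simp
  qed (use len xs(2) in auto)
  ultimately show ?thesis by (rule that)
qed

text \<open>
  The two frames of \<open>A\<close> differ by a matrix \<open>P\<close>, their dual frames by a matrix \<open>Q\<close> with \<open>P Q\<^sup>T = 1\<close>. So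
  the change of hyperbolic frame is block diagonal with determinant \<open>det P * det Q = 1\<close>.
\<close>

lemma wedge_hyperbolic_indep:
  assumes es: "(U, es) \<in> frames A" "m \<in> U" and gs: "(V, gs) \<in> frames A" "m \<in> V"
  shows "wedge_sec E (hyp gs) m = wedge_sec E (hyp es) m"
proof -
  define r where "r = vbundle.rank A"
  have len: "length es = r" "length gs = r" "n = r + r"
    using length_frame_A es gs rank_E unfolding r_def by auto
  define P where "P = (\<lambda>j k. (dual_frame A es ! k) m ((gs ! j) m))"
  define Q where "Q = (\<lambda>j k. (dual_frame A gs ! j) m ((es ! k) m))"
  define a where "a = (\<lambda>j k. if j < r then (if k < r then P j k else 0) else (if k < r then 0 else Q (j - r) (k - r)))"
  have gsE: "(gs ! j) m = (\<Sum>k<r. P j k *\<^sub>R (es ! k) m)" if "j < r" for j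
    using frame_expand_dual[OF vbA es frame_fiber[OF vbA gs], of j] that len by (simp add: P_def)
  have dgsE: "(dual_frame A gs ! j) m = (\<Sum>k<r. Q j k *\<^sub>R (dual_frame A es ! k) m)" if "j < r" for j
    using dual_frame_expand[OF vbA es dual_frame(2)[OF vbA gs], of j] that len by (simp add: Q_def)
  have PQ: "(\<Sum>k<r. P i k * Q j k) = (if i = j then 1 else 0)" if "i < r" "j < r" for i j
  proof -
    have "(dual_frame A gs ! j) m ((gs ! i) m) = (\<Sum>k<r. P i k * (dual_frame A gs ! j) m ((es ! k) m))"
      unfolding gsE[OF that(1)] using that len frame_fiber[OF vbA es]
      by (intro dual_space_sum[OF dual_frame(2)[OF vbA gs] vb_subspace[OF vbA]]) auto
    then show ?thesis using dual_frame(3)[OF vbA gs, of j i] that len by (auto simp: Q_def)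
  qed
  let ?P = "Matrix.mat r r (\<lambda>(j, k). P j k)" and ?Q = "Matrix.mat r r (\<lambda>(j, k). Q j k)"
  have "wedge_sec E (hyp gs) m =
      Determinant.det (Matrix.mat n n (\<lambda>(j, k). a j k)) *\<^sub>R wedge_sec E (hyp es) m"
    unfolding wedge_sec_def
  proof (rule wedge_change[OF subspace_E])
    show "set (map (\<lambda>x. x m) (hyp es)) \<subseteq> fiber E m"
      by (rule frame_E_fibers[OF frames_E_hyperbolic[OF es(1)] es(2)])
    fix j assume j: "j < n"
    have "(hyp gs ! j) m = (\<Sum>k<length es + length (dual_frame A es). a j k *\<^sub>R (hyp es ! k) m)"
      unfolding sum_frame_expand
    proof (cases "j < r")
      case True
      then show "(hyp gs ! j) m =
        (\<Sum>i<length es. a j i *\<^sub>R (es ! i) m, \<Sum>i<length (dual_frame A es). a j (length es + i) *\<^sub>R (dual_frame A es ! i) m)"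
        using gsE[OF True] len by (simp add: sum_frame_nth a_def)
    next
      case False
      then obtain i where i: "j = r + i" "i < r" using j len by (metis add_less_cancel_left le_Suc_ex not_less)
      then show "(hyp gs ! j) m =
        (\<Sum>i<length es. a j i *\<^sub>R (es ! i) m, \<Sum>i<length (dual_frame A es). a j (length es + i) *\<^sub>R (dual_frame A es ! i) m)"
        using dgsE[OF i(2)] len sum_frame_nth(3)[of i "dual_frame A gs" gs m] by (simp add: a_def)
    qed
    then show "map (\<lambda>x. x m) (hyp gs) ! j =
        (\<Sum>k<n. a j k *\<^sub>R map (\<lambda>x. x m) (hyp es) ! k)"
      using j len by (simp add: sum_frame_nth)
  qed (use len in \<open>auto simp: sum_frame_nth\<close>)
  also have "Matrix.mat n n (\<lambda>(j, k). a j k) = four_block_mat ?P (0\<^sub>m r r) (0\<^sub>m r r) ?Q"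
    by (rule eq_matI) (auto simp: len a_def)
  also have "Determinant.det \<dots> = Determinant.det ?P * Determinant.det ?Q"
    by (rule det_four_block_mat_lower_left_zero) auto
  also have "\<dots> = Determinant.det (?P * transpose_mat ?Q)"
    using Determinant.det_mult[of ?P r "transpose_mat ?Q"] Determinant.det_transpose[of ?Q r] by simp
  also have "?P * transpose_mat ?Q = 1\<^sub>m r"
    by (rule eq_matI) (auto simp: scalar_prod_def atLeast0LessThan PQ)
  finally show ?thesis by simp
qed

text \<open>
  Any frame around the point may be chosen, by \<open>wedge_hyperbolic_indep\<close>.
\<close>

definition vol :: "'m \<Rightarrow> ('v \<times> ('v \<Rightarrow> real) \<Rightarrow> real) list \<Rightarrow> real" where
  "vol m = (let es = snd (SOME fr. fr \<in> frames A \<and> m \<in> fst fr) in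
     wedge_sec E (hyp es) m)"

lemma vol_eq:
  assumes "(U, es) \<in> frames A" "m \<in> U"
  shows "vol m = wedge_sec E (hyp es) m"
proof -
  let ?fr = "SOME fr. fr \<in> frames A \<and> m \<in> fst fr"
  have "?fr \<in> frames A \<and> m \<in> fst ?fr"
    by (rule someI[of "\<lambda>fr. fr \<in> frames A \<and> m \<in> fst fr" "(U, es)"]) (use assms in simp)
  then have "(fst ?fr, snd ?fr) \<in> frames A" "m \<in> fst ?fr" by auto
  from wedge_hyperbolic_indep[OF assms this] show ?thesis by (simp add: vol_def)
qed

end

lemma sum_fun_apply: "(\<Sum>i\<in>I. f i) x = (\<Sum>i\<in>I. f i x)" for f :: "'i \<Rightarrow> 'a \<Rightarrow> 'b::comm_monoid_add"
  by (induction I rule: infinite_finite_induct) auto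

lemma (in dual_pair) p_Cinf:
  assumes "s \<in> Sec M C" "Y \<in> Sec M B"
  shows "(\<lambda>m. p m (s m) (Y m)) \<in> Cinf M"
proof (rule CinfI, rule smooth_fun_on_glue)
  fix m :: 'm
  obtain U cs where fr: "(U, cs) \<in> frames C" "m \<in> U" using coverC by metis
  obtain bs where bs: "(U, bs) \<in> frames B" "length bs = length cs"
    and cfib: "\<And>m i. m \<in> U \<Longrightarrow> i < length cs \<Longrightarrow> (cs ! i) m \<in> fiber C m"
    and dual: "\<And>m i j. m \<in> U \<Longrightarrow> i < length cs \<Longrightarrow> j < length cs \<Longrightarrow> p m ((cs ! i) m) ((bs ! j) m) = (if i = j then 1 else 0)"
    by (rule frame_dualE[OF fr(1)], rule that; assumption)
  obtain c where c: "\<And>i. i < length cs \<Longrightarrow> smooth_fun_on M (U \<inter> UNIV) (c i)"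
    "\<And>m. m \<in> U \<Longrightarrow> m \<in> UNIV \<Longrightarrow> s m = (\<Sum>i<length cs. c i m *\<^sub>R (cs ! i) m)"
    by (rule smooth_section_onE[OF SecD[OF assms(1), of UNIV] fr(1)], rule that; assumption)
  obtain y where y: "\<And>i. i < length bs \<Longrightarrow> smooth_fun_on M (U \<inter> UNIV) (y i)"
    "\<And>m. m \<in> U \<Longrightarrow> m \<in> UNIV \<Longrightarrow> Y m = (\<Sum>i<length bs. y i m *\<^sub>R (bs ! i) m)"
    by (rule smooth_section_onE[OF SecD[OF assms(2), of UNIV] bs(1)], rule that; assumption)
  have "smooth_fun_on M U (\<lambda>m. \<Sum>i<length cs. c i m * y i m)"
    using c(1) y(1) bs(2) by (intro smooth_fun_on_sum smooth_fun_on_mult) auto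
  then have "smooth_fun_on M U (\<lambda>m. p m (s m) (Y m))"
  proof (rule smooth_fun_on_cong)
    fix x assume x: "x \<in> U"
    have bfib: "(bs ! j) x \<in> fiber B x" if "j < length cs" for j
      using that bs(2) smooth_section_on_fiber[OF vb_frame(3)[OF vb bs(1)] x] by simp
    have sfib: "s x \<in> fiber C x" by (rule Sec_fiber[OF assms(1)])
    have "p x (s x) ((bs ! j) x) = c j x" if "j < length cs" for j
    proof -
      have "p x (s x) ((bs ! j) x) = (\<Sum>i<length cs. c i x * p x ((cs ! i) x) ((bs ! j) x))"
        using p_sum_left[OF bfib[OF that], of "{..<length cs}" "\<lambda>i. (cs ! i) x" "\<lambda>i. c i x"] cfib[OF x] c(2)[OF x]
        by simp
      also have "\<dots> = (\<Sum>i<length cs. if i = j then c i x else 0)"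
        by (intro sum.cong) (simp_all add: dual[OF x] that)
      finally show ?thesis using that by simp
    qed
    moreover have "p x (s x) (Y x) = (\<Sum>i<length cs. y i x * p x (s x) ((bs ! i) x))"
      using p_sum_right[OF sfib, of "{..<length cs}" "\<lambda>i. (bs ! i) x" "\<lambda>i. y i x"] bfib y(2)[OF x] bs(2)
      by simp
    ultimately show "(\<Sum>i<length cs. c i x * y i x) = p x (s x) (Y x)"
      by (simp add: mult.commute)
  qed
  then show "\<exists>V. open V \<and> m \<in> V \<and> smooth_fun_on M V (\<lambda>m. p m (s m) (Y m))"
    using fr(2) vb_frame(1)[OF vb bs(1)] by blast
qed

lemma subspace_ext_power: "subspace (ext_power V U k)"
  unfolding ext_power_def by (rule subspace_span)

lemma fiber_ext_bundle: "fiber (ext_bundle B k) m = ext_power (fiber B m) (fiber B m) k"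
  by (simp add: ext_bundle_def)

lemma wedge_in_ext_power: "set xs \<subseteq> U \<Longrightarrow> length xs = k \<Longrightarrow> wedge V xs \<in> ext_power V U k"
  unfolding ext_power_def by (rule span_base) blast

text \<open>
  The frames of an exterior power are indexed by the subsequences of a frame of given length. These
  are the degrees that occur below: functions, sections, and top degree.
\<close>

lemma filter_subseqs_length:
  "filter (\<lambda>xs. length xs = 0) (subseqs es) = [[]]"
  "filter (\<lambda>xs. length xs = Suc 0) (subseqs es) = map (\<lambda>e. [e]) es"
  "filter (\<lambda>xs. length xs = length es) (subseqs es) = [es]"
proof -
  show 0: "filter (\<lambda>xs. length xs = 0) (subseqs es) = [[]]" for es :: "'a list"
    by (induction es) (auto simp: Let_def filter_map o_def)
  show "filter (\<lambda>xs. length xs = Suc 0) (subseqs es) = map (\<lambda>e. [e]) es"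
  proof (induction es)
    case (Cons e es)
    then show ?case using 0[of es] by (simp add: Let_def filter_map o_def)
  qed simp
  have le: "length xs \<le> length es" if "xs \<in> set (subseqs es)" for xs es :: "'a list"
    using that by (induction es arbitrary: xs) (auto simp: Let_def le_SucI)
  show "filter (\<lambda>xs. length xs = length es) (subseqs es) = [es]"
  proof (induction es)
    case (Cons e es)
    have "filter (\<lambda>xs. length xs = Suc (length es)) (subseqs es) = []"
      using le[of _ es] by (fastforce simp: filter_empty_conv)
    then show ?case using Cons by (simp add: Let_def filter_map o_def)
  qed simp
qed

context dual_bundles
begin

lemma E_SecI: "s \<in> Sec M A \<Longrightarrow> t \<in> Sec M (dual_bundle A) \<Longrightarrow> (\<lambda>m. (s m, t m)) \<in> Sec M E"
  by (rule SecI, rule direct_sum_section_onI) (erule SecD)+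

lemma E_SecD:
  assumes "z \<in> Sec M E"
  shows "fst \<circ> z \<in> Sec M A" "snd \<circ> z \<in> Sec M (dual_bundle A)"
proof -
  have zfib: "fst (z m) \<in> fiber A m" "snd (z m) \<in> dual_space (fiber A m)" for m
    using Sec_fiber[OF assms, of m] by (auto simp: mem_Times_iff)
  have *: "\<exists>c. (\<forall>i<n. smooth_fun_on M (U \<inter> UNIV) (c i)) \<and>
      (\<forall>m\<in>U. fst (z m) = (\<Sum>i<length es. c i m *\<^sub>R (es ! i) m) \<and>
         snd (z m) = (\<Sum>i<length es. c (length es + i) m *\<^sub>R (dual_frame A es ! i) m))"
    if fr: "(U, es) \<in> frames A" for U es
  proof -
    obtain c where c: "\<And>i. i < length (hyp es) \<Longrightarrow> smooth_fun_on M (U \<inter> UNIV) (c i)"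
      "\<And>m. m \<in> U \<Longrightarrow> m \<in> UNIV \<Longrightarrow> z m = (\<Sum>i<length (hyp es). c i m *\<^sub>R (hyp es ! i) m)"
      by (rule smooth_section_onE[OF SecD[OF assms, of UNIV] frames_E_hyperbolic[OF fr]], rule that; assumption)
    show ?thesis
      using c unfolding length_frame_E[OF frames_E_hyperbolic[OF fr]] sum_frame_nth sum_frame_expand
      by (intro exI[of _ c]) (simp add: rank_E length_frame_A[OF fr] sum_frame_expand[of _ es "dual_frame A es", unfolded length_dual_frame length_frame_A[OF fr]])
  qed
  show "fst \<circ> z \<in> Sec M A"
  proof (rule SecI, rule smooth_section_onI)
    fix U es assume fr: "(U, es) \<in> frames A"
    from *[OF fr] show "\<exists>c. smooth_coords U UNIV es (fst \<circ> z) c"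
      by (elim exE) (rule exI, auto simp: rank_E length_frame_A[OF fr])
  qed (simp add: zfib)
  show "snd \<circ> z \<in> Sec M (dual_bundle A)"
  proof (rule SecI, rule smooth_section_onI)
    fix U fs assume "(U, fs) \<in> frames (dual_bundle A)"
    then obtain es where fr: "(U, es) \<in> frames A" "fs = dual_frame A es" using frames_dual_bundle by blast
    from *[OF fr(1)] obtain c where c: "\<forall>i<n. smooth_fun_on M (U \<inter> UNIV) (c i)"
      "\<forall>m\<in>U. snd (z m) = (\<Sum>i<length es. c (length es + i) m *\<^sub>R (dual_frame A es ! i) m)" by blast
    show "\<exists>c. smooth_coords U UNIV fs (snd \<circ> z) c"
      using c unfolding fr(2)
      by (intro exI[of _ "\<lambda>i. c (length es + i)"]) (auto simp: rank_E length_frame_A[OF fr(1)])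
  qed (simp add: zfib)
qed

lemma E_Sec_through:
  assumes "v \<in> fiber E m"
  obtains s where "s \<in> Sec M E" "s m = v"
proof -
  have v: "fst v \<in> fiber A m" "snd v \<in> fiber (dual_bundle A) m" using assms by auto
  obtain s where s: "s \<in> Sec M A" "s m = fst v" by (rule Sec_through[OF vbA v(1)])
  obtain t where t: "t \<in> Sec M (dual_bundle A)" "t m = snd v" by (rule Sec_through[OF vbD v(2)])
  from E_SecI[OF s(1) t(1)] show ?thesis by (rule that) (simp add: s t)
qed

section \<open>The metric\<close>

lemma double_metric_sym: "double_metric m u w = double_metric m w u"
  by (simp add: double_metric_def split_beta)

lemma double_metric_add:
  assumes "u \<in> fiber E m" "w \<in> fiber E m" "w' \<in> fiber E m"
  shows "double_metric m u (w + w') = double_metric m u w + double_metric m u w'"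
  using assms by (auto simp: double_metric_def split_beta dual_spaceD(1)[of _ "fiber A m"])

lemma double_metric_scale:
  assumes "u \<in> fiber E m" "w \<in> fiber E m"
  shows "double_metric m u (c *\<^sub>R w) = c * double_metric m u w"
  using assms by (auto simp: double_metric_def split_beta dual_spaceD(2)[of _ "fiber A m"] algebra_simps)

lemma double_metric_Cinf:
  assumes "x \<in> Sec M E" "y \<in> Sec M E"
  shows "(\<lambda>m. double_metric m (x m) (y m)) \<in> Cinf M"
  using Cinf_add[OF right.p_Cinf[OF E_SecD(2)[OF assms(1)] E_SecD(1)[OF assms(2)]]
      right.p_Cinf[OF E_SecD(2)[OF assms(2)] E_SecD(1)[OF assms(1)]]]
  by (simp add: double_metric_def split_beta)

definition flatE :: "'m \<Rightarrow> 'v \<times> ('v \<Rightarrow> real) \<Rightarrow> 'v \<times> ('v \<Rightarrow> real) \<Rightarrow> real" where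
  "flatE m y = (\<lambda>w. if w \<in> fiber E m then double_metric m y w else 0)"

lemma flatE_dual: "y \<in> fiber E m \<Longrightarrow> flatE m y \<in> dual_space (fiber E m)"
  unfolding flatE_def dual_space_def
  using double_metric_add[of y m] double_metric_scale[of y m] subspace_add[OF subspace_E[of m]] subspace_scale[OF subspace_E[of m]]
  by (auto simp del: fiber_direct_sum)

text \<open>
  Non-degeneracy: a covector on \<open>V \<oplus> V\<^sup>*\<close> restricts to a covector on \<open>V\<close> and to one on \<open>V\<^sup>*\<close>, and the
  latter is evaluation at a vector of \<open>V\<close>, found by means of a basis.
\<close>

lemma flatE_surj:
  assumes "\<phi> \<in> dual_space (fiber E m)"
  obtains y where "y \<in> fiber E m" "\<phi> = flatE m y"
proof -
  let ?V = "fiber A m"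
  obtain U es where fr: "(U, es) \<in> frames A" "m \<in> U" using vb_frame_ex[OF vbA] .
  note sub = vb_subspace[OF vbA, of m] subspace_dual_space[of ?V]
  define \<xi> where "\<xi> = (\<lambda>v. \<phi> (v, 0))"
  define x where "x = (\<Sum>i<length es. \<phi> (0, (dual_frame A es ! i) m) *\<^sub>R (es ! i) m)"
  have \<xi>: "\<xi> \<in> dual_space ?V"
    unfolding \<xi>_def dual_space_def
  proof (safe)
    fix u v assume "u \<in> ?V" "v \<in> ?V"
    then show "\<phi> (u + v, 0) = \<phi> (u, 0) + \<phi> (v, 0)"
      using dual_spaceD(1)[OF assms, of "(u, 0)" "(v, 0)"] subspace_0[OF sub(2)] by simp
  next
    fix c v assume "v \<in> ?V"
    then show "\<phi> (c *\<^sub>R v, 0) = c * \<phi> (v, 0)"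
      using dual_spaceD(2)[OF assms, of "(v, 0)" c] subspace_0[OF sub(2)] by simp
  next
    fix v assume "v \<notin> ?V"
    then show "\<phi> (v, 0) = 0" using dual_spaceD(3)[OF assms, of "(v, 0)"] by simp
  qed
  have x: "x \<in> ?V"
    unfolding x_def using frame_fiber[OF vbA fr] by (intro subspace_sum subspace_scale sub) simp
  have \<psi>: "\<phi> (0, \<psi>) = \<psi> x" if "\<psi> \<in> dual_space ?V" for \<psi>
  proof -
    have "\<phi> (0, \<psi>) = \<phi> (\<Sum>i<length es. \<psi> ((es ! i) m) *\<^sub>R (0, (dual_frame A es ! i) m))"
    proof (rule arg_cong[where f = \<phi>], rule prod_eqI)
      show "snd (0, \<psi>) = snd (\<Sum>i<length es. \<psi> ((es ! i) m) *\<^sub>R (0, (dual_frame A es ! i) m))"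
        using dual_frame_expand[OF vbA fr that] by (simp add: snd_sum)
    qed (simp add: fst_sum)
    also have "\<dots> = (\<Sum>i<length es. \<psi> ((es ! i) m) * \<phi> (0, (dual_frame A es ! i) m))"
      using dual_frame(2)[OF vbA fr] subspace_0[OF sub(1)]
      by (intro dual_space_sum[OF assms subspace_E]) simp
    also have "\<dots> = \<psi> x"
      unfolding x_def using dual_space_sum[OF that sub(1), of "{..<length es}" "\<lambda>i. (es ! i) m"] frame_fiber[OF vbA fr]
      by (simp add: mult.commute)
    finally show ?thesis .
  qed
  have "\<phi> = flatE m (x, \<xi>)"
  proof
    fix w
    show "\<phi> w = flatE m (x, \<xi>) w"
    proof (cases "w \<in> fiber E m")
      case True
      then obtain v \<psi> where w: "w = (v, \<psi>)" "v \<in> ?V" "\<psi> \<in> dual_space ?V" by auto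
      have "\<phi> ((v, 0) + (0, \<psi>)) = \<phi> (v, 0) + \<phi> (0, \<psi>)"
        using w subspace_0[OF sub(1)] subspace_0[OF sub(2)] by (intro dual_spaceD(1)[OF assms]) auto
      then show ?thesis using True w by (simp add: flatE_def double_metric_def \<xi>_def \<psi>)
    qed (simp add: flatE_def dual_spaceD(3)[OF assms] del: fiber_direct_sum)
  qed
  then show ?thesis using that[of "(x, \<xi>)"] x \<xi> by simp
qed

section \<open>Gram determinants\<close>

lemma wedge_flatE:
  assumes "set xs \<subseteq> fiber E m" "set ys \<subseteq> fiber E m" "length xs = k" "length ys = k"
  shows "wedge (fiber E m) xs (map (flatE m) ys) =
    Determinant.det (Matrix.mat k k (\<lambda>(i, j). double_metric m (ys ! i) (xs ! j)))"
proof -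
  have "wedge (fiber E m) xs (map (flatE m) ys) =
      Determinant.det (Matrix.mat (length xs) (length xs) (\<lambda>(i, j). (map (flatE m) ys ! i) (xs ! j)))"
    using assms flatE_dual by (intro wedge_eq_det) (auto simp del: fiber_direct_sum)
  also have "Matrix.mat (length xs) (length xs) (\<lambda>(i, j). (map (flatE m) ys ! i) (xs ! j)) =
      Matrix.mat k k (\<lambda>(i, j). double_metric m (ys ! i) (xs ! j))"
  proof (rule eq_matI)
    fix i j assume "i < dim_row (Matrix.mat k k (\<lambda>(i, j). double_metric m (ys ! i) (xs ! j)))"
      "j < dim_col (Matrix.mat k k (\<lambda>(i, j). double_metric m (ys ! i) (xs ! j)))"
    then have ij: "i < k" "j < k" by auto
    then have "xs ! j \<in> fiber E m" using assms(1,3) nth_mem by blast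
    then show "Matrix.mat (length xs) (length xs) (\<lambda>(i, j). (map (flatE m) ys ! i) (xs ! j)) $$ (i, j) =
      Matrix.mat k k (\<lambda>(i, j). double_metric m (ys ! i) (xs ! j)) $$ (i, j)"
      using ij assms(3,4) by (simp add: flatE_def del: fiber_direct_sum)
  qed (use assms in auto)
  finally show ?thesis .
qed

text \<open>
  The Gram matrix of two lists is transposed when the lists are exchanged.
\<close>

lemma wedge_flatE_sym:
  assumes "set xs \<subseteq> fiber E m" "set ys \<subseteq> fiber E m" "length xs = k" "length ys = k"
  shows "wedge (fiber E m) xs (map (flatE m) ys) = wedge (fiber E m) ys (map (flatE m) xs)"
proof -
  have "Matrix.mat k k (\<lambda>(i, j). double_metric m (ys ! i) (xs ! j)) =
      transpose_mat (Matrix.mat k k (\<lambda>(i, j). double_metric m (xs ! i) (ys ! j)))"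
    by (rule eq_matI) (auto simp: double_metric_sym)
  then show ?thesis
    using Determinant.det_transpose[of "Matrix.mat k k (\<lambda>(i, j). double_metric m (xs ! i) (ys ! j))" k]
    by (simp add: wedge_flatE[OF assms] wedge_flatE[OF assms(2,1,4,3)] del: fiber_direct_sum)
qed

text \<open>
  The Gram matrix of every hyperbolic frame. It is its own inverse and does not depend on the point.
\<close>

definition J :: "real mat" where
  "J = four_block_mat (0\<^sub>m (vbundle.rank A) (vbundle.rank A)) (1\<^sub>m (vbundle.rank A))
     (1\<^sub>m (vbundle.rank A)) (0\<^sub>m (vbundle.rank A) (vbundle.rank A))"

lemma J_carrier: "J \<in> carrier_mat n n"
  unfolding J_def rank_E by (rule four_block_carrier_mat) auto

lemma det_J_nonzero: "Determinant.det J \<noteq> 0"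
proof -
  let ?r = "vbundle.rank A"
  have "J * J = four_block_mat (1\<^sub>m ?r) (0\<^sub>m ?r ?r) (0\<^sub>m ?r ?r) (1\<^sub>m ?r)"
    unfolding J_def by (subst mult_four_block_mat[of _ ?r ?r _ ?r _ ?r]) auto
  also have "\<dots> = 1\<^sub>m n" unfolding rank_E by (rule four_block_one_mat)
  finally have "Determinant.det J * Determinant.det J = 1"
    using Determinant.det_mult[OF J_carrier J_carrier] by simp
  then show ?thesis by auto
qed

lemma gram_hyperbolic:
  assumes fr: "(U, es) \<in> frames A" "m \<in> U"
  shows "vol m (map (\<lambda>b. flatE m (b m)) (hyp es)) = Determinant.det J"
proof -
  let ?b = "hyp es" and ?r = "vbundle.rank A"
  have len: "length es = ?r" "length ?b = n"
    using length_frame_A[OF fr(1)] rank_E by (auto simp: sum_frame_nth)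
  note fib = frame_E_fibers[OF frames_E_hyperbolic[OF fr(1)] fr(2)]
  have zero: "0 \<in> dual_space (fiber A m)" by (rule subspace_0[OF subspace_dual_space])
  have "wedge (fiber E m) (map (\<lambda>b. b m) ?b) (map (flatE m) (map (\<lambda>b. b m) ?b)) =
      Determinant.det (Matrix.mat n n (\<lambda>(i, j). double_metric m (map (\<lambda>b. b m) ?b ! i) (map (\<lambda>b. b m) ?b ! j)))"
    using len by (intro wedge_flatE fib) auto
  also have "Matrix.mat n n (\<lambda>(i, j). double_metric m (map (\<lambda>b. b m) ?b ! i) (map (\<lambda>b. b m) ?b ! j)) = J"
  proof (rule eq_matI)
    fix i j assume "i < dim_row J" "j < dim_col J"
    then have ij: "i < n" "j < n" using J_carrier by auto
    have bi: "(?b ! i) m = (if i < ?r then ((es ! i) m, 0) else (0, (dual_frame A es ! (i - ?r)) m))" if "i < n" for i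
      using that sum_frame_nth(2)[of i es "dual_frame A es" m] sum_frame_nth(3)[of "i - ?r" "dual_frame A es" es m]
      by (auto simp: len rank_E)
    have d0: "(dual_frame A es ! i) m 0 = 0" if "i < ?r" for i
      using dual_spaceD(2)[OF dual_frame(2)[OF vbA fr], of i 0 0] subspace_0[OF vb_subspace[OF vbA]] that len by simp
    have "double_metric m ((?b ! i) m) ((?b ! j) m) = J $$ (i, j)"
      using ij dual_frame(3)[OF vbA fr] len d0
      by (auto simp: bi J_def double_metric_def rank_E)
    then show "Matrix.mat n n (\<lambda>(i, j). double_metric m (map (\<lambda>b. b m) ?b ! i) (map (\<lambda>b. b m) ?b ! j)) $$ (i, j) = J $$ (i, j)"
      using ij len by simp
  qed (use J_carrier in auto)
  finally show ?thesis
    unfolding vol_eq[OF fr] wedge_sec_def by (simp add: o_def)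
qed

lemma vol_nonzero: "vol m \<noteq> 0"
proof -
  obtain U es where fr: "(U, es) \<in> frames A" "m \<in> U" using vb_frame_ex[OF vbA] .
  show ?thesis using gram_hyperbolic[OF fr] det_J_nonzero by auto
qed

text \<open>
  Exchange the two lists in a Gram determinant between \<open>ys\<close> and a hyperbolic frame.
\<close>

lemma vol_flatE:
  assumes "set ys \<subseteq> fiber E m" "length ys = n" "wedge (fiber E m) ys = c *\<^sub>R vol m"
  shows "vol m (map (flatE m) ys) = Determinant.det J * c"
proof -
  obtain U es where fr: "(U, es) \<in> frames A" "m \<in> U" using vb_frame_ex[OF vbA] .
  let ?b = "hyp es"
  note frE = frames_E_hyperbolic[OF fr(1)]
  note fib = frame_E_fibers[OF frE fr(2)]
  have "wedge (fiber E m) (map (\<lambda>x. x m) ?b) (map (flatE m) ys) = wedge (fiber E m) ys (map (flatE m) (map (\<lambda>x. x m) ?b))"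
    using length_frame_E[OF frE] assms by (intro wedge_flatE_sym[OF fib, where k = n]) auto
  then show ?thesis
    using gram_hyperbolic[OF fr] vol_eq[OF fr] by (simp add: wedge_sec_def assms(3) o_def del: fiber_direct_sum)
qed

end

section \<open>Derivations of functions and determinants\<close>

context smooth_mfd
begin

text \<open>
  Derivations of the algebra of smooth functions. The clause on constants stands in for homogeneity,
  which then follows from the Leibniz rule.
\<close>

definition fun_derivation :: "(('m \<Rightarrow> real) \<Rightarrow> 'm \<Rightarrow> real) \<Rightarrow> bool" where
  "fun_derivation X \<longleftrightarrow>
     (\<forall>f\<in>Cinf M. X f \<in> Cinf M) \<and>
     (\<forall>f\<in>Cinf M. \<forall>g\<in>Cinf M. X (\<lambda>x. f x + g x) = (\<lambda>x. X f x + X g x)) \<and>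
     (\<forall>f\<in>Cinf M. \<forall>g\<in>Cinf M. X (\<lambda>x. f x * g x) = (\<lambda>x. f x * X g x + g x * X f x)) \<and>
     (\<forall>c. X (\<lambda>_. c) = (\<lambda>_. 0))"

lemma fun_derivationD:
  assumes "fun_derivation X"
  shows "f \<in> Cinf M \<Longrightarrow> X f \<in> Cinf M"
    "f \<in> Cinf M \<Longrightarrow> g \<in> Cinf M \<Longrightarrow> X (\<lambda>x. f x + g x) = (\<lambda>x. X f x + X g x)"
    "f \<in> Cinf M \<Longrightarrow> g \<in> Cinf M \<Longrightarrow> X (\<lambda>x. f x * g x) = (\<lambda>x. f x * X g x + g x * X f x)"
    "X (\<lambda>_. c) = (\<lambda>_. 0)"
  using assms unfolding fun_derivation_def by blast+

lemma fun_derivation_cmult: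
  "fun_derivation X \<Longrightarrow> f \<in> Cinf M \<Longrightarrow> X (\<lambda>x. c * f x) = (\<lambda>x. c * X f x)"
  using fun_derivationD(3)[of X "\<lambda>_. c" f] fun_derivationD(4)[of X c] Cinf_const by simp

lemma fun_derivation_sum:
  assumes "fun_derivation X" "\<And>i. i \<in> I \<Longrightarrow> f i \<in> Cinf M"
  shows "X (\<lambda>x. \<Sum>i\<in>I. f i x) = (\<lambda>x. \<Sum>i\<in>I. X (f i) x)"
  using assms(2)
proof (induction I rule: infinite_finite_induct)
  case (insert i I)
  have "X (\<lambda>x. f i x + (\<Sum>i\<in>I. f i x)) = (\<lambda>x. X (f i) x + X (\<lambda>x. \<Sum>i\<in>I. f i x) x)"
    using insert.prems by (intro fun_derivationD(2)[OF assms(1)] Cinf_sum) auto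
  then show ?case using insert by simp
qed (simp_all add: fun_derivationD(4)[OF assms(1)])

lemma fun_derivation_prod:
  assumes "fun_derivation X" "finite I" "\<And>i. i \<in> I \<Longrightarrow> f i \<in> Cinf M"
  shows "X (\<lambda>x. \<Prod>i\<in>I. f i x) = (\<lambda>x. \<Sum>i\<in>I. X (f i) x * (\<Prod>j\<in>I - {i}. f j x))"
  using assms(2,3)
proof (induction I)
  case empty
  then show ?case by (simp add: fun_derivationD(4)[OF assms(1)])
next
  case (insert k I)
  have "X (\<lambda>x. f k x * (\<Prod>i\<in>I. f i x)) = (\<lambda>x. f k x * X (\<lambda>x. \<Prod>i\<in>I. f i x) x + (\<Prod>i\<in>I. f i x) * X (f k) x)"
    using insert.prems by (intro fun_derivationD(3)[OF assms(1)] Cinf_prod) auto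
  also have "\<dots> = (\<lambda>x. f k x * (\<Sum>i\<in>I. X (f i) x * (\<Prod>j\<in>I - {i}. f j x)) + (\<Prod>i\<in>I. f i x) * X (f k) x)"
    using insert by simp
  also have "\<dots> = (\<lambda>x. \<Sum>i\<in>insert k I. X (f i) x * (\<Prod>j\<in>insert k I - {i}. f j x))"
  proof
    fix x
    have "f k x * (\<Prod>j\<in>I - {i}. f j x) = (\<Prod>j\<in>insert k I - {i}. f j x)" if "i \<in> I" for i
    proof -
      have "insert k I - {i} = insert k (I - {i})" using that insert.hyps by auto
      then show ?thesis using insert.hyps by simp
    qed
    note eq = this
    have "f k x * (\<Sum>i\<in>I. X (f i) x * (\<Prod>j\<in>I - {i}. f j x)) = (\<Sum>i\<in>I. X (f i) x * (f k x * (\<Prod>j\<in>I - {i}. f j x)))"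
      by (simp add: sum_distrib_left mult.left_commute)
    also have "\<dots> = (\<Sum>i\<in>I. X (f i) x * (\<Prod>j\<in>insert k I - {i}. f j x))"
      by (intro sum.cong) (simp_all add: eq)
    finally have "f k x * (\<Sum>i\<in>I. X (f i) x * (\<Prod>j\<in>I - {i}. f j x)) = (\<Sum>i\<in>I. X (f i) x * (\<Prod>j\<in>insert k I - {i}. f j x))" .
    moreover have "insert k I - {k} = I" using insert.hyps by auto
    ultimately show "f k x * (\<Sum>i\<in>I. X (f i) x * (\<Prod>j\<in>I - {i}. f j x)) + (\<Prod>i\<in>I. f i x) * X (f k) x
        = (\<Sum>i\<in>insert k I. X (f i) x * (\<Prod>j\<in>insert k I - {i}. f j x))"
      using insert.hyps by simp
  qed
  finally show ?case using insert.hyps by simp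
qed

lemma prod_replace_one:
  fixes f :: "nat \<Rightarrow> real"
  assumes "k < n"
  shows "(\<Prod>i<n. if i = k then c else f i) = c * (\<Prod>i\<in>{..<n} - {k}. f i)"
proof -
  have "(\<Prod>i<n. if i = k then c else f i) = c * (\<Prod>i\<in>{..<n} - {k}. if i = k then c else f i)"
    using assms by (subst prod.remove[of _ k]) auto
  also have "(\<Prod>i\<in>{..<n} - {k}. if i = k then c else f i) = (\<Prod>i\<in>{..<n} - {k}. f i)"
    by (intro prod.cong) auto
  finally show ?thesis .
qed

text \<open>
  For a Gram matrix \<open>G i j = \<langle>y\<^sub>i, x\<^sub>j\<rangle>\<close> the derivative of an entry has a part \<open>G1\<close>, which varies \<open>y\<^sub>i\<close>, and
  a part \<open>G2\<close>, which varies \<open>x\<^sub>j\<close>. In the derivative of the determinant the first parts are collected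
  by rows and the second parts by columns, so that every summand is a Gram determinant again.
\<close>

lemma fun_derivation_det:
  assumes X: "fun_derivation X"
    and G: "\<And>i j. i < n \<Longrightarrow> j < n \<Longrightarrow> G i j \<in> Cinf M"
    and XG: "\<And>i j x. i < n \<Longrightarrow> j < n \<Longrightarrow> X (G i j) x = G1 i j x + G2 i j x"
  shows "X (\<lambda>x. Determinant.det (Matrix.mat n n (\<lambda>(i, j). G i j x))) =
    (\<lambda>x. (\<Sum>k<n. Determinant.det (Matrix.mat n n (\<lambda>(i, j). if i = k then G1 i j x else G i j x))) +
         (\<Sum>k<n. Determinant.det (Matrix.mat n n (\<lambda>(i, j). if j = k then G2 i j x else G i j x))))"
proof -
  let ?P = "{p. p permutes {..<n}}"
  define \<epsilon> where "\<epsilon> p = (of_int (sign p) :: real)" for p :: "nat \<Rightarrow> nat"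
  define R where "R p k x = (\<Prod>j\<in>{..<n} - {k}. G j (p j) x)" for p k x
  define G1' where "G1' p k x = (\<Prod>i<n. if i = k then G1 i (p i) x else G i (p i) x)" for p k x
  define G2' where "G2' p k x = (\<Prod>i<n. if p i = k then G2 i (p i) x else G i (p i) x)" for p k x
  have perm: "p i < n" if "p permutes {..<n}" "i < n" for p i
    using that permutes_in_image[of p "{..<n}" i] by auto
  have "X (\<lambda>x. \<Sum>p\<in>?P. \<epsilon> p * (\<Prod>i<n. G i (p i) x)) =
      (\<lambda>x. \<Sum>p\<in>?P. X (\<lambda>x. \<epsilon> p * (\<Prod>i<n. G i (p i) x)) x)"
    by (intro fun_derivation_sum[OF X] Cinf_mult[OF Cinf_const] Cinf_prod G) (auto intro: perm)
  also have "\<dots> = (\<lambda>x. \<Sum>p\<in>?P. \<epsilon> p * (\<Sum>k<n. X (G k (p k)) x * R p k x))"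
  proof
    fix x
    have "X (\<lambda>x. \<epsilon> p * (\<Prod>i<n. G i (p i) x)) =
        (\<lambda>x. \<epsilon> p * (\<Sum>k<n. X (G k (p k)) x * R p k x))" if "p permutes {..<n}" for p
    proof -
      have "X (\<lambda>x. \<epsilon> p * (\<Prod>i<n. G i (p i) x)) = (\<lambda>x. \<epsilon> p * X (\<lambda>x. \<Prod>i<n. G i (p i) x) x)"
        using perm[OF that] by (intro fun_derivation_cmult[OF X] Cinf_prod G) auto
      also have "X (\<lambda>x. \<Prod>i<n. G i (p i) x) = (\<lambda>x. \<Sum>k<n. X (G k (p k)) x * R p k x)"
        unfolding R_def using perm[OF that] by (intro fun_derivation_prod[OF X] G) auto
      finally show ?thesis .
    qed
    then show "(\<Sum>p\<in>?P. X (\<lambda>x. \<epsilon> p * (\<Prod>i<n. G i (p i) x)) x) =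
      (\<Sum>p\<in>?P. \<epsilon> p * (\<Sum>k<n. X (G k (p k)) x * R p k x))"
      by (intro sum.cong) simp_all
  qed
  also have "\<dots> = (\<lambda>x. (\<Sum>k<n. \<Sum>p\<in>?P. \<epsilon> p * G1' p k x) +
      (\<Sum>k<n. \<Sum>p\<in>?P. \<epsilon> p * G2' p k x))"
  proof
    fix x
    have 1: "(\<Sum>k<n. X (G k (p k)) x * R p k x) = (\<Sum>k<n. G1' p k x) + (\<Sum>k<n. G2' p k x)"
      if p: "p permutes {..<n}" for p
    proof -
      have "(\<Sum>k<n. X (G k (p k)) x * R p k x) =
        (\<Sum>k<n. G1 k (p k) x * R p k x) + (\<Sum>k<n. G2 k (p k) x * R p k x)"
        unfolding sum.distrib[symmetric] using perm[OF p] by (intro sum.cong) (simp_all add: XG distrib_right)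
      also have "(\<Sum>k<n. G1 k (p k) x * R p k x) = (\<Sum>k<n. G1' p k x)"
      proof (rule sum.cong)
        fix k assume k: "k \<in> {..<n}"
        have "G1' p k x = (\<Prod>i<n. if i = k then G1 k (p k) x else G i (p i) x)"
          unfolding G1'_def by (intro prod.cong) auto
        then show "G1 k (p k) x * R p k x = G1' p k x"
          using k by (simp add: prod_replace_one R_def)
      qed simp
      also have "(\<Sum>k<n. G2 k (p k) x * R p k x) = (\<Sum>k<n. G2' p (p k) x)"
      proof (rule sum.cong)
        fix k assume k: "k \<in> {..<n}"
        have "G2' p (p k) x = (\<Prod>i<n. if i = k then G2 k (p k) x else G i (p i) x)"
          unfolding G2'_def using permutes_inj[OF p] by (intro prod.cong) (auto simp: inj_eq)
        then show "G2 k (p k) x * R p k x = G2' p (p k) x"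
          using k by (simp add: prod_replace_one R_def)
      qed simp
      also have "\<dots> = (\<Sum>k<n. G2' p k x)"
        using sum.permute[OF p, of "\<lambda>k. G2' p k x"] by (simp add: o_def)
      finally show ?thesis .
    qed
    have "(\<Sum>p\<in>?P. \<epsilon> p * (\<Sum>k<n. X (G k (p k)) x * R p k x)) =
      (\<Sum>p\<in>?P. (\<Sum>k<n. \<epsilon> p * G1' p k x) + (\<Sum>k<n. \<epsilon> p * G2' p k x))"
      by (intro sum.cong) (simp_all add: 1 distrib_left sum_distrib_left)
    also have "\<dots> = (\<Sum>k<n. \<Sum>p\<in>?P. \<epsilon> p * G1' p k x) +
      (\<Sum>k<n. \<Sum>p\<in>?P. \<epsilon> p * G2' p k x)"
      unfolding sum.distrib by (intro arg_cong2[where f = "(+)"] sum.swap)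
    finally show "(\<Sum>p\<in>?P. \<epsilon> p * (\<Sum>k<n. X (G k (p k)) x * R p k x)) =
      (\<Sum>k<n. \<Sum>p\<in>?P. \<epsilon> p * G1' p k x) +
      (\<Sum>k<n. \<Sum>p\<in>?P. \<epsilon> p * G2' p k x)" .
  qed
  finally show ?thesis unfolding det_mat_eq_sum \<epsilon>_def G1'_def G2'_def .
qed

end

section \<open>The top exterior power of the double\<close>

context dual_bundles
begin

abbreviation S where "S \<equiv> ext_bundle E n"

lemma frames_S: "(U, ss) \<in> frames S \<longleftrightarrow> (\<exists>bs. (U, bs) \<in> frames E \<and> ss = [wedge_sec E bs])"
proof -
  have "map (wedge_sec E) (filter (\<lambda>xs. length xs = n) (subseqs bs)) = [wedge_sec E bs]" if "(U, bs) \<in> frames E" for U bs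
    using filter_subseqs_length(3)[of bs] length_frame_E[OF that] by simp
  then show ?thesis unfolding ext_bundle_def by force
qed

lemma vol_fiber: "vol m \<in> fiber S m"
proof -
  obtain U es where fr: "(U, es) \<in> frames A" "m \<in> U" using vb_frame_ex[OF vbA] .
  note frE = frames_E_hyperbolic[OF fr(1)]
  show ?thesis
    unfolding vol_eq[OF fr] fiber_ext_bundle wedge_sec_def
    using frame_E_fibers[OF frE fr(2)] length_frame_E[OF frE]
    by (intro wedge_in_ext_power) simp_all
qed

lemma subspace_S: "subspace (fiber S m)"
  unfolding fiber_ext_bundle by (rule subspace_ext_power)

lemma vol_Sec: "vol \<in> Sec M S"
proof (rule SecI, rule smooth_section_onI)
  fix W ss assume "(W, ss) \<in> frames S"
  then obtain bs where bs: "(W, bs) \<in> frames E" "ss = [wedge_sec E bs]" using frames_S by blast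
  obtain U es V gs where fr: "W = U \<inter> V" "bs = sum_frame es (dual_frame A gs)" "(U, es) \<in> frames A" "(V, gs) \<in> frames A"
    using frames_E[OF bs(1)] .
  note frE = frames_E_hyperbolic[OF fr(4)]
  obtain c where c: "smooth_fun_on M (W \<inter> V) c"
    "\<And>m. m \<in> W \<Longrightarrow> m \<in> V \<Longrightarrow> wedge_sec E (hyp gs) m = c m *\<^sub>R wedge_sec E bs m"
    using wedge_sec_smooth[OF bs(1) frame_E_smooth[OF frE] length_frame_E[OF frE]] by blast
  show "\<exists>c. smooth_coords W UNIV ss vol c"
  proof (intro exI[of _ "\<lambda>_. c"] conjI allI impI ballI)
    show "smooth_fun_on M (W \<inter> UNIV) c" using c(1) by (rule smooth_fun_on_subset) (simp add: fr(1))
    fix m assume "m \<in> W \<inter> UNIV"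
    then show "vol m = (\<Sum>i<length ss. c m *\<^sub>R (ss ! i) m)"
      using c(2)[of m] vol_eq[OF fr(4), of m] by (simp add: bs(2) fr(1))
  qed
qed (rule vol_fiber)

lemma smult_vol_Sec: "f \<in> Cinf M \<Longrightarrow> smult f vol \<in> Sec M S"
  by (rule SecI, rule smooth_section_on_smult[OF subspace_S]) (rule SecD[OF vol_Sec], erule CinfD)

lemma smult_vol_inj: "smult f vol = smult g vol \<Longrightarrow> f = g"
  by (rule ext) (metis scaleR_cancel_right smult_def vol_nonzero)

lemma Sec_S_coef:
  assumes "\<sigma> \<in> Sec M S"
  obtains f where "f \<in> Cinf M" "\<sigma> = smult f vol"
proof (rule line_section_coefficient[OF assms vol_nonzero])
  fix m
  obtain U es where fr: "(U, es) \<in> frames A" "m \<in> U" using vb_frame_ex[OF vbA] .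
  show "\<exists>U t. (U, [t]) \<in> frames S \<and> open U \<and> m \<in> U \<and> (\<forall>x\<in>U. t x = vol x)"
    using frames_S frames_E_hyperbolic[OF fr(1)] vb_frame(1)[OF vbA fr(1)] fr(2) vol_eq[OF fr(1)]
    by (intro exI[of _ U] exI[of _ "wedge_sec E (hyp es)"]) auto
qed (rule that)

definition coef :: "('m \<Rightarrow> ('v \<times> ('v \<Rightarrow> real) \<Rightarrow> real) list \<Rightarrow> real) \<Rightarrow> 'm \<Rightarrow> real" where
  "coef \<sigma> = (THE f. \<sigma> = smult f vol)"

lemma coef_smult [simp]: "coef (smult f vol) = f"
  unfolding coef_def by (rule the_equality) (auto dest: smult_vol_inj)

lemma coef:
  assumes "\<sigma> \<in> Sec M S"
  shows "coef \<sigma> \<in> Cinf M" "smult (coef \<sigma>) vol = \<sigma>"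
  using Sec_S_coef[OF assms] by (metis coef_smult)+

lemma Sec_list_fiber:
  assumes "set xs \<subseteq> Sec M E"
  shows "set (map (\<lambda>x. x m) xs) \<subseteq> fiber E m"
proof
  fix v assume "v \<in> set (map (\<lambda>x. x m) xs)"
  then obtain x where "x \<in> set xs" "v = x m" by auto
  then show "v \<in> fiber E m" using assms Sec_fiber[of x E m] by blast
qed

lemma Sec_list_update:
  assumes "\<And>x. x \<in> Sec M E \<Longrightarrow> \<delta> x \<in> Sec M E" "set zs \<subseteq> Sec M E" "length zs = n" "k < n"
  shows "set (zs[k := \<delta> (zs ! k)]) \<subseteq> Sec M E" "length (zs[k := \<delta> (zs ! k)]) = n"
proof -
  have "zs ! k \<in> Sec M E" using assms nth_mem[of k zs] by (simp add: subset_iff)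
  then show "set (zs[k := \<delta> (zs ! k)]) \<subseteq> Sec M E"
    using assms(1,2) set_update_subset_insert[of zs k "\<delta> (zs ! k)"] by blast
qed (use assms in simp)

lemma wedge_Sec:
  assumes "set xs \<subseteq> Sec M E" "length xs = n"
  shows "wedge_sec E xs \<in> Sec M S"
proof (rule SecI, rule smooth_section_onI)
  fix m
  note Sec_list_fiber[OF assms(1), of m]
  then show "wedge_sec E xs m \<in> fiber S m"
    unfolding fiber_ext_bundle wedge_sec_def using assms(2) by (intro wedge_in_ext_power) auto
next
  fix W ss assume "(W, ss) \<in> frames S"
  then obtain bs where bs: "(W, bs) \<in> frames E" "ss = [wedge_sec E bs]" using frames_S by blast
  have "smooth_section_on M E UNIV x" if "x \<in> set xs" for x using that assms(1) SecD by blast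
  from wedge_sec_smooth[OF bs(1) this assms(2)]
  obtain c where c: "smooth_fun_on M (W \<inter> UNIV) c"
    "\<And>m. m \<in> W \<Longrightarrow> m \<in> UNIV \<Longrightarrow> wedge_sec E xs m = c m *\<^sub>R wedge_sec E bs m" by blast
  then show "\<exists>c. smooth_coords W UNIV ss (wedge_sec E xs) c"
    by (intro exI[of _ "\<lambda>_. c"]) (simp add: bs(2))
qed

text \<open>
  The Gram determinant is \<open>x\<^sub>1 \<and> \<dots> \<and> x\<^sub>n\<close> evaluated on the covectors of the \<open>y\<^sub>i\<close>.
\<close>

lemma gram_coef:
  assumes "set xs \<subseteq> Sec M E" "length xs = n" "set ys \<subseteq> Sec M E" "length ys = n"
  shows "Determinant.det (Matrix.mat n n (\<lambda>(i, j). double_metric m ((ys ! i) m) ((xs ! j) m))) =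
    coef (wedge_sec E xs) m * (Determinant.det J * coef (wedge_sec E ys) m)"
proof -
  note fib = Sec_list_fiber[of _ m]
  have c: "wedge (fiber E m) (map (\<lambda>x. x m) zs) = coef (wedge_sec E zs) m *\<^sub>R vol m"
    if "set zs \<subseteq> Sec M E" "length zs = n" for zs
    using fun_cong[OF coef(2)[OF wedge_Sec[OF that]], of m] by (simp add: smult_def wedge_sec_def del: fiber_direct_sum)
  have "vol m (map (flatE m) (map (\<lambda>x. x m) ys)) = Determinant.det J * coef (wedge_sec E ys) m"
    using assms by (intro vol_flatE fib c) auto
  then have "wedge (fiber E m) (map (\<lambda>x. x m) xs) (map (flatE m) (map (\<lambda>x. x m) ys)) =
      coef (wedge_sec E xs) m * (Determinant.det J * coef (wedge_sec E ys) m)"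
    by (simp add: c[OF assms(1,2)] del: fiber_direct_sum)
  moreover have "wedge (fiber E m) (map (\<lambda>x. x m) xs) (map (flatE m) (map (\<lambda>x. x m) ys)) =
      Determinant.det (Matrix.mat n n (\<lambda>(i, j). double_metric m (map (\<lambda>x. x m) ys ! i) (map (\<lambda>x. x m) xs ! j)))"
    using assms by (intro wedge_flatE fib) auto
  moreover have "Matrix.mat n n (\<lambda>(i, j). double_metric m (map (\<lambda>x. x m) ys ! i) (map (\<lambda>x. x m) xs ! j)) =
      Matrix.mat n n (\<lambda>(i, j). double_metric m ((ys ! i) m) ((xs ! j) m))"
    using assms by (intro eq_matI) auto
  ultimately show ?thesis by simp
qed

lemma wedge_Sec_at:
  obtains ys where "set ys \<subseteq> Sec M E" "length ys = n" "coef (wedge_sec E ys) m = 1"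
proof -
  obtain U es where fr: "(U, es) \<in> frames A" "m \<in> U" using vb_frame_ex[OF vbA] .
  let ?b = "hyp es"
  note frE = frames_E_hyperbolic[OF fr(1)]
  define y where "y = (\<lambda>i. SOME s. s \<in> Sec M E \<and> s m = (?b ! i) m)"
  have y: "y i \<in> Sec M E \<and> y i m = (?b ! i) m" if "i < n" for i
  proof -
    have "(?b ! i) m \<in> fiber E m" using frame_E_fiber[OF frE fr(2)] that length_frame_E[OF frE] by simp
    then obtain s where "s \<in> Sec M E" "s m = (?b ! i) m" by (rule E_Sec_through)
    then show ?thesis unfolding y_def by (intro someI[of "\<lambda>s. s \<in> Sec M E \<and> s m = (?b ! i) m" s]) simp
  qed
  let ?ys = "map y [0..<n]"
  have ys: "set ?ys \<subseteq> Sec M E" "length ?ys = n" using y by auto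
  have "map (\<lambda>x. x m) ?ys = map (\<lambda>x. x m) ?b"
    using y length_frame_E[OF frE] by (intro nth_equalityI) auto
  then have "wedge_sec E ?ys m = vol m" unfolding vol_eq[OF fr] wedge_sec_def by metis
  then have "coef (wedge_sec E ?ys) m *\<^sub>R vol m = 1 *\<^sub>R vol m"
    using fun_cong[OF coef(2)[OF wedge_Sec[OF ys]], of m] by (simp add: smult_def)
  then have "coef (wedge_sec E ?ys) m = 1" unfolding scaleR_cancel_right using vol_nonzero by blast
  with ys show ?thesis by (rule that)
qed

text \<open>
  Let \<open>D\<close> denote the coefficient with respect to \<open>vol\<close>, and \<open>err\<close> the failure of the claim. Applying
  \<open>X\<close> to \<open>det \<langle>y\<^sub>i, x\<^sub>j\<rangle> = \<kappa> (D x) (D y)\<close> and using the invariance of the metric on the left gives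
  \<open>err x * D y + D x * err y = 0\<close>. Take \<open>y\<close> with \<open>D y = 1\<close> at the point: the case \<open>x = y\<close> gives \<open>err y = 0\<close>,
  and then the general case gives \<open>err x = 0\<close>.
\<close>

lemma derivation_coef:
  assumes X: "fun_derivation X" and \<delta>: "\<And>x. x \<in> Sec M E \<Longrightarrow> \<delta> x \<in> Sec M E"
    and metric: "\<And>x y m. x \<in> Sec M E \<Longrightarrow> y \<in> Sec M E \<Longrightarrow> X (\<lambda>m. double_metric m (x m) (y m)) m =
      double_metric m (\<delta> x m) (y m) + double_metric m (x m) (\<delta> y m)"
    and xs: "set xs \<subseteq> Sec M E" "length xs = n"
  shows "X (coef (wedge_sec E xs)) m = (\<Sum>k<n. coef (wedge_sec E (xs[k := \<delta> (xs ! k)])) m)"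
proof -
  define D where "D = (\<lambda>xs. coef (wedge_sec E xs))"
  define err where "err = (\<lambda>xs. X (D xs) m - (\<Sum>k<n. D (xs[k := \<delta> (xs ! k)]) m))"
  have upd: "set (zs[k := \<delta> (zs ! k)]) \<subseteq> Sec M E" "length (zs[k := \<delta> (zs ! k)]) = n"
    if "set zs \<subseteq> Sec M E" "length zs = n" "k < n" for zs k
    using Sec_list_update[of \<delta> zs k] \<delta> that by blast+
  have key: "err xs * D ys m + D xs m * err ys = 0"
    if xs: "set xs \<subseteq> Sec M E" "length xs = n" and ys: "set ys \<subseteq> Sec M E" "length ys = n" for xs ys
  proof -
    let ?\<kappa> = "Determinant.det J"
    have C: "D xs \<in> Cinf M" "D ys \<in> Cinf M"
      unfolding D_def using coef(1)[OF wedge_Sec] xs ys by auto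
    have x: "xs ! i \<in> Sec M E" and y: "ys ! i \<in> Sec M E" if "i < n" for i
      using that xs ys nth_mem[of i xs] nth_mem[of i ys] by (simp_all add: subset_iff)
    define G where "G = (\<lambda>i j m. double_metric m ((ys ! i) m) ((xs ! j) m))"
    define G1 where "G1 = (\<lambda>i j m. double_metric m (\<delta> (ys ! i) m) ((xs ! j) m))"
    define G2 where "G2 = (\<lambda>i j m. double_metric m ((ys ! i) m) (\<delta> (xs ! j) m))"
    have "X (\<lambda>m. Determinant.det (Matrix.mat n n (\<lambda>(i, j). G i j m))) =
    (\<lambda>x. (\<Sum>k<n. Determinant.det (Matrix.mat n n (\<lambda>(i, j). if i = k then G1 i j x else G i j x))) +
         (\<Sum>k<n. Determinant.det (Matrix.mat n n (\<lambda>(i, j). if j = k then G2 i j x else G i j x))))"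
      by (intro fun_derivation_det[OF X])
         (simp_all add: G_def G1_def G2_def metric x y double_metric_Cinf)
    moreover have "Determinant.det (Matrix.mat n n (\<lambda>(i, j). G i j m)) = D xs m * (?\<kappa> * D ys m)" for m
      unfolding G_def D_def using xs ys by (rule gram_coef)
    moreover have "Determinant.det (Matrix.mat n n (\<lambda>(i, j). if i = k then G1 i j m else G i j m)) =
        D xs m * (?\<kappa> * D (ys[k := \<delta> (ys ! k)]) m)" if k: "k < n" for k
      unfolding D_def gram_coef[OF xs upd[OF ys k], symmetric]
      by (rule arg_cong[where f = Determinant.det], rule eq_matI)
         (use ys xs in \<open>auto simp: G_def G1_def nth_list_update\<close>)
    moreover have "Determinant.det (Matrix.mat n n (\<lambda>(i, j). if j = k then G2 i j m else G i j m)) =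
        D (xs[k := \<delta> (xs ! k)]) m * (?\<kappa> * D ys m)" if k: "k < n" for k
      unfolding D_def gram_coef[OF upd[OF xs k] ys, symmetric]
      by (rule arg_cong[where f = Determinant.det], rule eq_matI)
         (use ys xs in \<open>auto simp: G_def G2_def nth_list_update\<close>)
    ultimately have "X (\<lambda>m. D xs m * (?\<kappa> * D ys m)) m = (\<Sum>k<n. D xs m * (?\<kappa> * D (ys[k := \<delta> (ys ! k)]) m)) +
        (\<Sum>k<n. D (xs[k := \<delta> (xs ! k)]) m * (?\<kappa> * D ys m))" by simp
    moreover have "X (\<lambda>m. D xs m * (?\<kappa> * D ys m)) m = D xs m * (?\<kappa> * X (D ys) m) + ?\<kappa> * D ys m * X (D xs) m"
      using fun_derivationD(3)[OF X C(1) Cinf_mult[OF Cinf_const C(2)]] fun_derivation_cmult[OF X C(2)] by simp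
    ultimately have "?\<kappa> * (err xs * D ys m + D xs m * err ys) = 0"
      by (simp add: err_def algebra_simps sum_distrib_left sum_distrib_right)
    then show ?thesis using det_J_nonzero by simp
  qed
  obtain ys where ys: "set ys \<subseteq> Sec M E" "length ys = n" "D ys m = 1"
    using wedge_Sec_at[of m] unfolding D_def by metis
  have "err ys = 0" using key[OF ys(1,2) ys(1,2)] ys(3) by simp
  then have "err xs = 0" using key[OF xs ys(1,2)] ys(3) by simp
  then show ?thesis by (simp add: err_def D_def)
qed

text \<open>
  Existence: the operator \<open>f vol \<mapsto> X(f) vol\<close> satisfies the Leibniz rule on wedge products by
  \<open>derivation_coef\<close>. Uniqueness: an extension \<open>T\<close> satisfies \<open>T (f vol) = X(f) vol + f T(vol)\<close>, and
  comparing its two values on a wedge product that does not vanish at a point gives \<open>T(vol) = 0\<close> there.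
\<close>

lemma leibniz_ext_top:
  assumes X: "fun_derivation X" and \<delta>: "\<And>x. x \<in> Sec M E \<Longrightarrow> \<delta> x \<in> Sec M E"
    and metric: "\<And>x y m. x \<in> Sec M E \<Longrightarrow> y \<in> Sec M E \<Longrightarrow> X (\<lambda>m. double_metric m (x m) (y m)) m =
      double_metric m (\<delta> x m) (y m) + double_metric m (x m) (\<delta> y m)"
    and f: "f \<in> Cinf M"
  shows "leibniz_ext M E n X \<delta> (smult f vol) = smult (X f) vol"
proof -
  define T0 where "T0 = restrict (\<lambda>\<sigma>. smult (X (coef \<sigma>)) vol) (Sec M S)"
  let ?P = "\<lambda>T. T \<in> extensional (Sec M S) \<and> derivation_over M S X T \<and>
     (\<forall>xs. length xs = n \<and> set xs \<subseteq> Sec M E \<longrightarrow>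
        T (wedge_sec E xs) = (\<Sum>i<n. wedge_sec E (xs[i := \<delta> (xs ! i)])))"
  have T0: "T0 (smult g vol) = smult (X g) vol" if "g \<in> Cinf M" for g
    using smult_vol_Sec[OF that] by (simp add: T0_def)
  have upd: "set (zs[k := \<delta> (zs ! k)]) \<subseteq> Sec M E" "length (zs[k := \<delta> (zs ! k)]) = n"
    if "set zs \<subseteq> Sec M E" "length zs = n" "k < n" for zs k
    using Sec_list_update[of \<delta> zs k] \<delta> that by blast+
  have W: "T0 (wedge_sec E xs) = (\<Sum>i<n. wedge_sec E (xs[i := \<delta> (xs ! i)]))"
    if xs: "length xs = n" "set xs \<subseteq> Sec M E" for xs
  proof
    fix m
    have w: "wedge_sec E (xs[i := \<delta> (xs ! i)]) m = coef (wedge_sec E (xs[i := \<delta> (xs ! i)])) m *\<^sub>R vol m" if "i < n" for i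
      using fun_cong[OF coef(2)[OF wedge_Sec[OF upd[OF xs(2,1) that]]], of m] by (simp add: smult_def)
    have "(\<Sum>i<n. wedge_sec E (xs[i := \<delta> (xs ! i)])) m = (\<Sum>i<n. coef (wedge_sec E (xs[i := \<delta> (xs ! i)])) m) *\<^sub>R vol m"
      unfolding scaleR_sum_left by (subst sum_fun_apply, rule sum.cong[OF refl], rule w, simp)
    also have "(\<Sum>i<n. coef (wedge_sec E (xs[i := \<delta> (xs ! i)])) m) = X (coef (wedge_sec E xs)) m"
      by (rule derivation_coef[OF X \<delta> metric xs(2,1), symmetric])
    finally have R: "(\<Sum>i<n. wedge_sec E (xs[i := \<delta> (xs ! i)])) m = X (coef (wedge_sec E xs)) m *\<^sub>R vol m" .
    have "T0 (wedge_sec E xs) m = X (coef (wedge_sec E xs)) m *\<^sub>R vol m"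
      using wedge_Sec[OF xs(2,1)] by (simp add: T0_def smult_def)
    then show "T0 (wedge_sec E xs) m = (\<Sum>i<n. wedge_sec E (xs[i := \<delta> (xs ! i)])) m"
      unfolding R .
  qed
  have "derivation_over M S X T0"
    unfolding derivation_over_def
  proof (intro conjI ballI)
    show "T0 \<in> Sec M S \<rightarrow> Sec M S"
      using coef fun_derivationD(1)[OF X] smult_vol_Sec by (auto simp: T0_def)
  next
    fix s t assume "s \<in> Sec M S" "t \<in> Sec M S"
    then obtain g h where gh: "g \<in> Cinf M" "h \<in> Cinf M" "s = smult g vol" "t = smult h vol"
      by (metis Sec_S_coef)
    have "s + t = smult (\<lambda>x. g x + h x) vol" by (auto simp: gh smult_def scaleR_left_distrib)
    then have "T0 (s + t) = smult (\<lambda>x. X g x + X h x) vol"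
      using T0[OF Cinf_add[OF gh(1,2)]] fun_derivationD(2)[OF X gh(1,2)] by metis
    also have "\<dots> = T0 s + T0 t"
      unfolding gh(3,4) T0[OF gh(1)] T0[OF gh(2)] by (auto simp: smult_def scaleR_left_distrib)
    finally show "T0 (s + t) = T0 s + T0 t" .
  next
    fix g s assume g: "g \<in> Cinf M" and "s \<in> Sec M S"
    then obtain h where h: "h \<in> Cinf M" "s = smult h vol" by (metis Sec_S_coef)
    have "smult g s = smult (\<lambda>x. g x * h x) vol" by (auto simp: h smult_def)
    then have "T0 (smult g s) = smult (\<lambda>x. g x * X h x + h x * X g x) vol"
      using T0[OF Cinf_mult[OF g h(1)]] fun_derivationD(3)[OF X g h(1)] by metis
    also have "\<dots> = smult (X g) s + smult g (T0 s)"
      unfolding h(2) T0[OF h(1)] by (auto simp: smult_def scaleR_left_distrib mult.commute)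
    finally show "T0 (smult g s) = smult (X g) s + smult g (T0 s)" .
  qed
  then have P: "?P T0" using W by (auto simp: T0_def)
  have uniq: "T = T0" if T: "?P T" for T
  proof -
    have D: "T (smult g s) = smult (X g) s + smult g (T s)" if "g \<in> Cinf M" "s \<in> Sec M S" for g s
      using T that unfolding derivation_over_def by blast
    have Tvol: "T vol m = 0" for m
    proof -
      obtain ys where ys: "set ys \<subseteq> Sec M E" "length ys = n" "coef (wedge_sec E ys) m = 1"
        by (rule wedge_Sec_at)
      let ?d = "coef (wedge_sec E ys)"
      have d: "?d \<in> Cinf M" "smult ?d vol = wedge_sec E ys" using coef[OF wedge_Sec[OF ys(1,2)]] by auto
      have "T (wedge_sec E ys) = T0 (wedge_sec E ys)" using T W ys by simp
      then have "smult (X ?d) vol + smult ?d (T vol) = smult (X ?d) vol"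
        using D[OF d(1) vol_Sec] T0[OF d(1)] d(2) by simp
      from fun_cong[OF this, of m] show ?thesis using ys(3) by (simp add: smult_def)
    qed
    show "T = T0"
    proof (rule extensionalityI[of _ "Sec M S"])
      fix \<sigma> assume "\<sigma> \<in> Sec M S"
      then obtain g where g: "g \<in> Cinf M" "\<sigma> = smult g vol" by (metis Sec_S_coef)
      show "T \<sigma> = T0 \<sigma>"
        unfolding g(2) D[OF g(1) vol_Sec] T0[OF g(1)] by (auto simp: smult_def Tvol)
    qed (use T P in blast)+
  qed
  have "leibniz_ext M E n X \<delta> = T0"
    unfolding leibniz_ext_def by (rule the_equality) (use P uniq in blast)+
  then show ?thesis using T0[OF f] by simp
qed

end

section \<open>Anchors, differentials and Lie derivatives\<close>

context smooth_mfd
begin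

lemma Cinf_diff: "f \<in> Cinf M \<Longrightarrow> g \<in> Cinf M \<Longrightarrow> (\<lambda>x. f x - g x) \<in> Cinf M"
  using Cinf_add[of f "\<lambda>x. (-1) * g x"] Cinf_mult[OF Cinf_const[of "-1"], of g] by simp

lemma Sec_diff:
  assumes "vector_bundle M B" "s \<in> Sec M B" "t \<in> Sec M B"
  shows "(\<lambda>m. s m - t m) \<in> Sec M B"
  using Sec_add[OF assms(1,2) Sec_scaleR[OF assms(1,3), of "-1"]] by simp

lemma tangent_space_derivation:
  assumes "\<And>m. D m \<in> tangent_space M m" "\<And>f. f \<in> Cinf M \<Longrightarrow> (\<lambda>m. D m f) \<in> Cinf M"
  shows "fun_derivation (\<lambda>f m. D m f)"
proof -
  have D: "D m (f + g) = D m f + D m g" "D m (c *\<^sub>R f) = c * D m f" "D m (f * g) = f m * D m g + g m * D m f"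
    if "f \<in> Cinf M" "g \<in> Cinf M" for f g m c
    using assms(1)[of m] that unfolding tangent_space_def by blast+
  have one: "(\<lambda>_. 1) \<in> Cinf M" by (rule Cinf_const)
  have "D m (\<lambda>_. 1) = 0" for m
    using D(3)[OF one one, of m] by (simp add: times_fun_def)
  then have "D m (\<lambda>_. c) = 0" for m c
    using D(2)[OF one one, of m c] by (simp add: scaleR_fun_def)
  moreover have "(\<lambda>x. f x + g x) = f + g" "(\<lambda>x. f x * g x) = f * g" for f g :: "'m \<Rightarrow> real"
    by auto
  ultimately show ?thesis
    unfolding fun_derivation_def using assms(2) D by simp
qed

lemma anchor_derivation:
  assumes "anchor_map M B a" "e \<in> Sec M B"
  shows "fun_derivation (act a e)"
proof -
  have "fun_derivation (\<lambda>f m. a m (e m) f)"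
    using assms Sec_fiber[OF assms(2)] unfolding anchor_map_def act_def
    by (intro tangent_space_derivation) blast+
  then show ?thesis by (simp add: act_def[abs_def])
qed

lemma act_add:
  assumes "anchor_map M B a" "Y \<in> Sec M B" "Z \<in> Sec M B"
  shows "act a (\<lambda>m. Y m + Z m) f = (\<lambda>m. act a Y f m + act a Z f m)"
  using assms Sec_fiber[OF assms(2)] Sec_fiber[OF assms(3)] unfolding anchor_map_def act_def
  by (intro ext) (simp add: plus_fun_def)

lemma act_smult:
  assumes "anchor_map M B a" "Y \<in> Sec M B"
  shows "act a (smult h Y) f = (\<lambda>m. h m * act a Y f m)"
  using assms Sec_fiber[OF assms(2)] unfolding anchor_map_def act_def smult_def
  by (intro ext) simp

lemma fun_derivation_plus:
  assumes "fun_derivation X" "fun_derivation Y"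
  shows "fun_derivation (\<lambda>f m. X f m + Y f m)"
  unfolding fun_derivation_def
  using fun_derivationD[OF assms(1)] fun_derivationD[OF assms(2)] Cinf_add
  by (simp add: algebra_simps)

end

lemma lie_algebroidD:
  assumes "lie_algebroid M A L"
  shows "vector_bundle M A" "anchor_map M A (lanchor L)"
    "X \<in> Sec M A \<Longrightarrow> Y \<in> Sec M A \<Longrightarrow> lbracket L X Y \<in> Sec M A"
    "X \<in> Sec M A \<Longrightarrow> Y \<in> Sec M A \<Longrightarrow> Z \<in> Sec M A \<Longrightarrow> lbracket L Z (X + Y) = lbracket L Z X + lbracket L Z Y"
    "X \<in> Sec M A \<Longrightarrow> Y \<in> Sec M A \<Longrightarrow> lbracket L X Y = - lbracket L Y X"
    "X \<in> Sec M A \<Longrightarrow> Y \<in> Sec M A \<Longrightarrow> f \<in> Cinf M \<Longrightarrow>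
        lbracket L X (smult f Y) = smult (act (lanchor L) X f) Y + smult f (lbracket L X Y)"
  using assms unfolding lie_algebroid_def by blast+

context dual_pair
begin

lemma differential_ex:
  assumes "anchor_map M B a" "f \<in> Cinf M"
  shows "\<exists>!s. s \<in> Sec M C \<and> (\<forall>Y\<in>Sec M B. (\<lambda>m. p m (s m) (Y m)) = act a Y f)"
  by (rule functional_section)
     (use fun_derivationD(1)[OF anchor_derivation[OF assms(1)] assms(2)] act_add[OF assms(1)] act_smult[OF assms(1)]
      in auto)

text \<open>
  The terms \<open>X(f) \<langle>\<xi>, Y\<rangle>\<close> from the derivative and from the bracket cancel, so the right-hand side is
  linear in \<open>Y\<close> over the smooth functions.
\<close>

lemma lie_derivative_ex:
  assumes L: "lie_algebroid M B L" and X: "X \<in> Sec M B" and \<xi>: "\<xi> \<in> Sec M C"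
  shows "\<exists>!s. s \<in> Sec M C \<and> (\<forall>Y\<in>Sec M B. (\<lambda>m. p m (s m) (Y m)) =
    (\<lambda>m. act (lanchor L) X (\<lambda>m. p m (\<xi> m) (Y m)) m - p m (\<xi> m) (lbracket L X Y m)))"
proof (rule functional_section)
  let ?X = "act (lanchor L) X"
  note D = fun_derivationD[OF anchor_derivation[OF lie_algebroidD(2)[OF L] X]]
  note br = lie_algebroidD(3)[OF L X]
  have \<xi>f: "\<xi> m \<in> fiber C m" for m by (rule Sec_fiber[OF \<xi>])
  fix Y assume Y: "Y \<in> Sec M B"
  show "(\<lambda>m. ?X (\<lambda>m. p m (\<xi> m) (Y m)) m - p m (\<xi> m) (lbracket L X Y m)) \<in> Cinf M"
    by (intro Cinf_diff D(1) p_Cinf \<xi> Y br)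
  {
    fix Z assume Z: "Z \<in> Sec M B"
    have "(\<lambda>m. Y m + Z m) = Y + Z" by auto
    then have "lbracket L X (\<lambda>m. Y m + Z m) = lbracket L X Y + lbracket L X Z"
      using lie_algebroidD(4)[OF L Y Z X] by simp
    moreover have "(\<lambda>m. p m (\<xi> m) (Y m + Z m)) = (\<lambda>m. p m (\<xi> m) (Y m) + p m (\<xi> m) (Z m))"
      using p_add_right[OF \<xi>f Sec_fiber[OF Y] Sec_fiber[OF Z]] by auto
    ultimately show "(\<lambda>m. ?X (\<lambda>m. p m (\<xi> m) (Y m + Z m)) m - p m (\<xi> m) (lbracket L X (\<lambda>m. Y m + Z m) m)) =
      (\<lambda>m. (?X (\<lambda>m. p m (\<xi> m) (Y m)) m - p m (\<xi> m) (lbracket L X Y m)) +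
        (?X (\<lambda>m. p m (\<xi> m) (Z m)) m - p m (\<xi> m) (lbracket L X Z m)))"
      using p_add_right[OF \<xi>f Sec_fiber[OF br[OF Y]] Sec_fiber[OF br[OF Z]]]
      by (auto simp: D(2) p_Cinf \<xi> Y Z)
  }
  {
    fix f assume f: "f \<in> Cinf M"
    have Yf: "Y m \<in> fiber B m" and bf: "lbracket L X Y m \<in> fiber B m" for m
      by (rule Sec_fiber, fact Y, rule Sec_fiber, rule br, fact Y)
    have "(\<lambda>m. p m (\<xi> m) (smult f Y m)) = (\<lambda>m. f m * p m (\<xi> m) (Y m))"
      using p_scale_right[OF \<xi>f Yf] by (auto simp: smult_def)
    moreover have "p m (\<xi> m) (lbracket L X (smult f Y) m) = ?X f m * p m (\<xi> m) (Y m) + f m * p m (\<xi> m) (lbracket L X Y m)" for m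
      unfolding lie_algebroidD(6)[OF L X Y f]
      using subspace_scale[OF vb_subspace[OF vb] Yf] subspace_scale[OF vb_subspace[OF vb] bf]
      by (simp add: smult_def p_add_right[OF \<xi>f] p_scale_right[OF \<xi>f] Yf bf)
    ultimately show "(\<lambda>m. ?X (\<lambda>m. p m (\<xi> m) (smult f Y m)) m - p m (\<xi> m) (lbracket L X (smult f Y) m)) =
      (\<lambda>m. f m * (?X (\<lambda>m. p m (\<xi> m) (Y m)) m - p m (\<xi> m) (lbracket L X Y m)))"
      by (auto simp: D(3) f p_Cinf \<xi> Y algebra_simps)
  }
qed

end

section \<open>The Dorfman operation of the double\<close>

locale dual_algebroids = smooth_mfd M
  for M :: "('m::{t2_space, second_countable_topology}, 'a::euclidean_space) manifold" +
  fixes A :: "('m, 'v::real_vector) vbundle" and L :: "('m, 'v) lie_structure"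
    and L' :: "('m, 'v \<Rightarrow> real) lie_structure"
  assumes LA: "lie_algebroid M A L" and LD: "lie_algebroid M (dual_bundle A) L'"
begin

sublocale dual_bundles M A
  by unfold_locales (rule lie_algebroidD(1)[OF LA], rule lie_algebroidD(1)[OF LD])

abbreviation \<rho> where "\<rho> \<equiv> double_anchor L L'"

lemma diff_fun:
  assumes "f \<in> Cinf M"
  shows "diff_fun M A L f \<in> Sec M (dual_bundle A)"
    "Y \<in> Sec M A \<Longrightarrow> diff_fun M A L f m (Y m) = act (lanchor L) Y f m"
proof -
  have *: "diff_fun M A L f \<in> Sec M (dual_bundle A) \<and>
     (\<forall>Y\<in>Sec M A. pairing (diff_fun M A L f) Y = act (lanchor L) Y f)"
    using theI'[OF right.differential_ex[OF lie_algebroidD(2)[OF LA] assms]] unfolding diff_fun_def pairing_def fun_diff_def .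
  then show "diff_fun M A L f \<in> Sec M (dual_bundle A)" by blast
  show "diff_fun M A L f m (Y m) = act (lanchor L) Y f m" if "Y \<in> Sec M A"
    using * that unfolding pairing_def by (metis (full_types))
qed

lemma diff_fun_star:
  assumes "f \<in> Cinf M"
  shows "diff_fun_star M A L' f \<in> Sec M A"
    "\<eta> \<in> Sec M (dual_bundle A) \<Longrightarrow> \<eta> m (diff_fun_star M A L' f m) = act (lanchor L') \<eta> f m"
proof -
  have *: "diff_fun_star M A L' f \<in> Sec M A \<and>
     (\<forall>\<eta>\<in>Sec M (dual_bundle A). pairing \<eta> (diff_fun_star M A L' f) = act (lanchor L') \<eta> f)"
    using theI'[OF left.differential_ex[OF lie_algebroidD(2)[OF LD] assms]] unfolding diff_fun_star_def pairing_def fun_diff_def .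
  then show "diff_fun_star M A L' f \<in> Sec M A" by blast
  show "\<eta> m (diff_fun_star M A L' f m) = act (lanchor L') \<eta> f m" if "\<eta> \<in> Sec M (dual_bundle A)"
    using * that unfolding pairing_def by (metis (full_types))
qed

lemma lie_der:
  assumes "X \<in> Sec M A" "\<xi> \<in> Sec M (dual_bundle A)"
  shows "lie_der M A L X \<xi> \<in> Sec M (dual_bundle A)"
    "Y \<in> Sec M A \<Longrightarrow> lie_der M A L X \<xi> m (Y m) = act (lanchor L) X (pairing \<xi> Y) m - \<xi> m (lbracket L X Y m)"
proof -
  have *: "lie_der M A L X \<xi> \<in> Sec M (dual_bundle A) \<and>
     (\<forall>Y\<in>Sec M A. pairing (lie_der M A L X \<xi>) Y = act (lanchor L) X (pairing \<xi> Y) - pairing \<xi> (lbracket L X Y))"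
    using theI'[OF right.lie_derivative_ex[OF LA assms]] unfolding lie_der_def pairing_def fun_diff_def .
  then show "lie_der M A L X \<xi> \<in> Sec M (dual_bundle A)" by blast
  show "lie_der M A L X \<xi> m (Y m) = act (lanchor L) X (pairing \<xi> Y) m - \<xi> m (lbracket L X Y m)" if "Y \<in> Sec M A"
    using fun_cong[OF conjunct2[OF *, rule_format, OF that], of m] by (simp add: pairing_def)
qed

lemma lie_der_star:
  assumes "\<xi> \<in> Sec M (dual_bundle A)" "X \<in> Sec M A"
  shows "lie_der_star M A L' \<xi> X \<in> Sec M A"
    "\<eta> \<in> Sec M (dual_bundle A) \<Longrightarrow> \<eta> m (lie_der_star M A L' \<xi> X m) = act (lanchor L') \<xi> (pairing \<eta> X) m - lbracket L' \<xi> \<eta> m (X m)"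
proof -
  have *: "lie_der_star M A L' \<xi> X \<in> Sec M A \<and>
     (\<forall>\<eta>\<in>Sec M (dual_bundle A). pairing \<eta> (lie_der_star M A L' \<xi> X) = act (lanchor L') \<xi> (pairing \<eta> X) - pairing (lbracket L' \<xi> \<eta>) X)"
    using theI'[OF left.lie_derivative_ex[OF LD assms]] unfolding lie_der_star_def pairing_def fun_diff_def .
  then show "lie_der_star M A L' \<xi> X \<in> Sec M A" by blast
  show "\<eta> m (lie_der_star M A L' \<xi> X m) = act (lanchor L') \<xi> (pairing \<eta> X) m - lbracket L' \<xi> \<eta> m (X m)"
    if "\<eta> \<in> Sec M (dual_bundle A)"
    using fun_cong[OF conjunct2[OF *, rule_format, OF that], of m] by (simp add: pairing_def)
qed

lemma pairing_Cinf: "\<xi> \<in> Sec M (dual_bundle A) \<Longrightarrow> X \<in> Sec M A \<Longrightarrow> pairing \<xi> X \<in> Cinf M"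
  unfolding pairing_def by (rule right.p_Cinf)

lemma act_rho: "act \<rho> e f m = act (lanchor L) (fst \<circ> e) f m + act (lanchor L') (snd \<circ> e) f m"
  by (simp add: act_def double_anchor_def split_beta)

lemma rho_derivation:
  assumes "e \<in> Sec M E"
  shows "fun_derivation (act \<rho> e)"
proof -
  have "act \<rho> e = (\<lambda>f m. act (lanchor L) (fst \<circ> e) f m + act (lanchor L') (snd \<circ> e) f m)"
    by (intro ext) (rule act_rho)
  then show ?thesis
    using fun_derivation_plus[OF anchor_derivation[OF lie_algebroidD(2)[OF LA] E_SecD(1)[OF assms]]
        anchor_derivation[OF lie_algebroidD(2)[OF LD] E_SecD(2)[OF assms]]] by simp
qed

text \<open>
  Pairing with sections of each summand separately reduces this to the non-degeneracy of the duality
  pairing.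
\<close>

lemma E_section_eqI:
  assumes z: "z \<in> Sec M E" "z' \<in> Sec M E"
    and eq: "\<And>e m. e \<in> Sec M E \<Longrightarrow> double_metric m (z m) (e m) = double_metric m (z' m) (e m)"
  shows "z = z'"
proof -
  have f: "snd (z m) \<in> dual_space (fiber A m)" "snd (z' m) \<in> dual_space (fiber A m)" for m
    using Sec_fiber[OF z(1), of m] Sec_fiber[OF z(2), of m] by (auto simp: mem_Times_iff)
  have 0: "\<phi> 0 = 0" if "\<phi> \<in> dual_space (fiber A m)" for \<phi> m
    using dual_spaceD(2)[OF that, of 0 0] subspace_0[OF vb_subspace[OF vbA]] by simp
  have "fst \<circ> z = fst \<circ> z'"
  proof (rule left.section_eqI)
    fix \<eta> assume "\<eta> \<in> Sec M (dual_bundle A)"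
    then have "(\<lambda>m. (0, \<eta> m)) \<in> Sec M E" by (rule E_SecI[OF Sec_zero[OF vbA]])
    from eq[OF this] show "(\<lambda>m. \<eta> m ((fst \<circ> z) m)) = (\<lambda>m. \<eta> m ((fst \<circ> z') m))"
      by (simp add: double_metric_def split_beta 0[OF f(1)] 0[OF f(2)])
  qed (use z E_SecD in blast)+
  moreover have "snd \<circ> z = snd \<circ> z'"
  proof (rule right.section_eqI)
    fix Y assume "Y \<in> Sec M A"
    then have "(\<lambda>m. (Y m, 0)) \<in> Sec M E" by (rule E_SecI[OF _ Sec_zero[OF vbD]])
    from eq[OF this] show "(\<lambda>m. (snd \<circ> z) m (Y m)) = (\<lambda>m. (snd \<circ> z') m (Y m))"
      by (simp add: double_metric_def split_beta)
  qed (use z E_SecD in blast)+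
  ultimately show ?thesis by (auto simp: fun_eq_iff prod_eq_iff)
qed

text \<open>
  Twice the operator \<open>\<D>\<close>.
\<close>

definition grad :: "('m \<Rightarrow> real) \<Rightarrow> 'm \<Rightarrow> 'v \<times> ('v \<Rightarrow> real)" where
  "grad f = (\<lambda>m. (diff_fun_star M A L' f m, diff_fun M A L f m))"

lemma grad:
  assumes "f \<in> Cinf M"
  shows "grad f \<in> Sec M E" "e \<in> Sec M E \<Longrightarrow> double_metric m (grad f m) (e m) = act \<rho> e f m"
proof -
  show "grad f \<in> Sec M E"
    unfolding grad_def by (rule E_SecI[OF diff_fun_star(1)[OF assms] diff_fun(1)[OF assms]])
  show "double_metric m (grad f m) (e m) = act \<rho> e f m" if "e \<in> Sec M E"
    using diff_fun(2)[OF assms E_SecD(1)[OF that], of m] diff_fun_star(2)[OF assms E_SecD(2)[OF that], of m]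
    unfolding act_rho grad_def by (simp add: double_metric_def split_beta)
qed

lemma E_Sec_scaleR: "z \<in> Sec M E \<Longrightarrow> (\<lambda>m. c *\<^sub>R z m) \<in> Sec M E"
  by (rule SecI, rule smooth_section_on_scaleR[OF subspace_E]) (rule SecD)

lemma E_Sec_add: "z \<in> Sec M E \<Longrightarrow> w \<in> Sec M E \<Longrightarrow> (\<lambda>m. z m + w m) \<in> Sec M E"
  by (rule SecI, rule smooth_section_on_add[OF subspace_E]) (erule SecD)+

lemma courant_D_eq:
  assumes "f \<in> Cinf M"
  shows "courant_D M E double_metric \<rho> f = (\<lambda>m. (1/2) *\<^sub>R grad f m)"
  unfolding courant_D_def
proof (rule the_equality)
  have half: "(\<lambda>m. (1/2) *\<^sub>R grad f m) \<in> Sec M E" by (rule E_Sec_scaleR[OF grad(1)[OF assms]])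
  have m: "double_metric m ((1/2) *\<^sub>R grad f m) (e m) = (1/2) * act \<rho> e f m" if e: "e \<in> Sec M E" for e m
    using double_metric_scale[OF Sec_fiber[OF e] Sec_fiber[OF grad(1)[OF assms]], of m "1/2"] grad(2)[OF assms e, of m]
    by (simp add: double_metric_sym)
  then show "(\<lambda>m. (1/2) *\<^sub>R grad f m) \<in> Sec M E \<and>
    (\<forall>e\<in>Sec M E. (\<lambda>m. double_metric m ((1/2) *\<^sub>R grad f m) (e m)) = (1/2) *\<^sub>R act \<rho> e f)"
    using half by (auto simp: scaleR_fun_def)
  fix z assume z: "z \<in> Sec M E \<and> (\<forall>e\<in>Sec M E. (\<lambda>m. double_metric m (z m) (e m)) = (1/2) *\<^sub>R act \<rho> e f)"
  show "z = (\<lambda>m. (1/2) *\<^sub>R grad f m)"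
  proof (rule E_section_eqI)
    fix e m assume e: "e \<in> Sec M E"
    have "(\<lambda>m. double_metric m (z m) (e m)) = (1/2) *\<^sub>R act \<rho> e f" using z e by blast
    from fun_cong[OF this, of m] show "double_metric m (z m) (e m) = double_metric m ((1/2) *\<^sub>R grad f m) (e m)"
      unfolding m[OF e] by simp
  qed (use z half in blast)+
qed

lemma dorfman_eq:
  assumes "e1 \<in> Sec M E" "e2 \<in> Sec M E"
  defines "X \<equiv> fst \<circ> e1" and "\<xi> \<equiv> snd \<circ> e1" and "Y \<equiv> fst \<circ> e2" and "\<eta> \<equiv> snd \<circ> e2"
  defines "h \<equiv> \<lambda>m. pairing \<xi> Y m + pairing \<eta> X m"
  shows "dorfman (double M A L L') e1 e2 = (\<lambda>m.
    (lbracket L X Y m + (- lie_der_star M A L' \<eta> X m + (1/2) *\<^sub>R diff_fun_star M A L' (pairing \<eta> X) m)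
       - (- lie_der_star M A L' \<xi> Y m + (1/2) *\<^sub>R diff_fun_star M A L' (pairing \<xi> Y) m) + (1/2) *\<^sub>R diff_fun_star M A L' h m,
     lbracket L' \<xi> \<eta> m + (lie_der M A L X \<eta> m - (1/2) *\<^sub>R diff_fun M A L (pairing \<eta> X) m)
       - (lie_der M A L Y \<xi> m - (1/2) *\<^sub>R diff_fun M A L (pairing \<xi> Y) m) + (1/2) *\<^sub>R diff_fun M A L h m))"
proof -
  have h: "(\<lambda>m. double_metric m (e1 m) (e2 m)) = h"
    by (auto simp: h_def double_metric_def split_beta pairing_def X_def \<xi>_def Y_def \<eta>_def)
  have "h \<in> Cinf M" using double_metric_Cinf[OF assms(1,2)] unfolding h .
  then show ?thesis
    unfolding double_def Let_def
    by (intro ext) (simp add: h courant_D_eq grad_def double_bracket_def mixed_bracket_def Let_def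
      X_def[symmetric] \<xi>_def[symmetric] Y_def[symmetric] \<eta>_def[symmetric])
qed

lemma dorfman_Sec:
  assumes "e1 \<in> Sec M E" "e2 \<in> Sec M E"
  shows "dorfman (double M A L L') e1 e2 \<in> Sec M E"
proof -
  note s = E_SecD[OF assms(1)] E_SecD[OF assms(2)]
  have h: "(\<lambda>m. pairing (snd \<circ> e1) (fst \<circ> e2) m + pairing (snd \<circ> e2) (fst \<circ> e1) m) \<in> Cinf M"
    by (intro Cinf_add pairing_Cinf s)
  have neg: "(\<lambda>m. - t m) \<in> Sec M A" if "t \<in> Sec M A" for t
    using Sec_scaleR[OF vbA that, of "-1"] by simp
  show ?thesis
    unfolding dorfman_eq[OF assms]
    by (rule E_SecI)
       (intro Sec_add[OF vbA] Sec_diff[OF vbA] Sec_scaleR[OF vbA] neg Sec_add[OF vbD] Sec_diff[OF vbD] Sec_scaleR[OF vbD]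
         diff_fun_star(1) diff_fun(1) lie_der(1) lie_der_star(1) lie_algebroidD(3)[OF LA] lie_algebroidD(3)[OF LD]
         pairing_Cinf s h)+
qed

text \<open>
  All operators are eliminated in favour of anchors, brackets and pairings. The halves in the bracket
  and in \<open>\<D>\<close> combine so that of \<open>\<D> \<langle>\<xi>, Y\<rangle>\<close> and \<open>\<D> \<langle>\<eta>, X\<rangle>\<close> only one component each survives.
\<close>

lemma dorfman_metric:
  assumes "e1 \<in> Sec M E" "e2 \<in> Sec M E" "e3 \<in> Sec M E"
  defines "X \<equiv> fst \<circ> e1" and "\<xi> \<equiv> snd \<circ> e1" and "Y \<equiv> fst \<circ> e2" and "\<eta> \<equiv> snd \<circ> e2"
    and "Z \<equiv> fst \<circ> e3" and "\<zeta> \<equiv> snd \<circ> e3"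
  defines "a \<equiv> act (lanchor L)" and "a' \<equiv> act (lanchor L')"
  shows "double_metric m (dorfman (double M A L L') e1 e2 m) (e3 m) =
     \<zeta> m (lbracket L X Y m) - \<eta> m (lbracket L X Z m) + \<xi> m (lbracket L Y Z m)
     + lbracket L' \<eta> \<zeta> m (X m) - lbracket L' \<xi> \<zeta> m (Y m) + lbracket L' \<xi> \<eta> m (Z m)
     - a' \<eta> (pairing \<zeta> X) m + a' \<xi> (pairing \<zeta> Y) m + a' \<zeta> (pairing \<eta> X) m
     + a X (pairing \<eta> Z) m - a Y (pairing \<xi> Z) m + a Z (pairing \<xi> Y) m"
proof -
  have s: "X \<in> Sec M A" "Y \<in> Sec M A" "Z \<in> Sec M A"
    "\<xi> \<in> Sec M (dual_bundle A)" "\<eta> \<in> Sec M (dual_bundle A)" "\<zeta> \<in> Sec M (dual_bundle A)"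
    unfolding X_def Y_def Z_def \<xi>_def \<eta>_def \<zeta>_def by (auto intro!: E_SecD assms)
  define h where "h = (\<lambda>m. pairing \<xi> Y m + pairing \<eta> X m)"
  have pc: "pairing \<xi> Y \<in> Cinf M" "pairing \<eta> X \<in> Cinf M" by (intro pairing_Cinf s)+
  have hc: "h \<in> Cinf M" unfolding h_def by (rule Cinf_add[OF pc])
  have ah: "a Z h m = a Z (pairing \<xi> Y) m + a Z (pairing \<eta> X) m"
    unfolding a_def h_def
    using fun_derivationD(2)[OF anchor_derivation[OF lie_algebroidD(2)[OF LA] s(3)] pc] by simp
  have ah': "a' \<zeta> h m = a' \<zeta> (pairing \<xi> Y) m + a' \<zeta> (pairing \<eta> X) m"
    unfolding a'_def h_def
    using fun_derivationD(2)[OF anchor_derivation[OF lie_algebroidD(2)[OF LD] s(6)] pc] by simp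
  have \<zeta>: "\<zeta> m \<in> dual_space (fiber A m)" using Sec_fiber[OF s(6)] by simp
  note V = vb_subspace[OF vbA, of m]
  have add: "\<zeta> m (u + v) = \<zeta> m u + \<zeta> m v" if "u \<in> fiber A m" "v \<in> fiber A m" for u v
    using dual_spaceD(1)[OF \<zeta>] that by blast
  have scale: "\<zeta> m (c *\<^sub>R u) = c * \<zeta> m u" if "u \<in> fiber A m" for c u
    using dual_spaceD(2)[OF \<zeta>] that by blast
  have neg: "\<zeta> m (- u) = - \<zeta> m u" if "u \<in> fiber A m" for u
    using scale[OF that, of "-1"] by simp
  have diff: "\<zeta> m (u - v) = \<zeta> m u - \<zeta> m v" if "u \<in> fiber A m" "v \<in> fiber A m" for u v
    using add[OF that(1) subspace_neg[OF V that(2)]] neg[OF that(2)] by simp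
  note fib = Sec_fiber[OF lie_algebroidD(3)[OF LA s(1,2)]] Sec_fiber[OF lie_der_star(1)[OF s(5,1)]]
    Sec_fiber[OF lie_der_star(1)[OF s(4,2)]] Sec_fiber[OF diff_fun_star(1)[OF pc(1)]]
    Sec_fiber[OF diff_fun_star(1)[OF pc(2)]] Sec_fiber[OF diff_fun_star(1)[OF hc]]
  let ?v = "\<zeta> m (lbracket L X Y m) + (- \<zeta> m (lie_der_star M A L' \<eta> X m) + (1/2) * \<zeta> m (diff_fun_star M A L' (pairing \<eta> X) m))
       - (- \<zeta> m (lie_der_star M A L' \<xi> Y m) + (1/2) * \<zeta> m (diff_fun_star M A L' (pairing \<xi> Y) m)) + (1/2) * \<zeta> m (diff_fun_star M A L' h m)"
  have 1: "\<zeta> m (lbracket L X Y m + (- lie_der_star M A L' \<eta> X m + (1/2) *\<^sub>R diff_fun_star M A L' (pairing \<eta> X) m)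
       - (- lie_der_star M A L' \<xi> Y m + (1/2) *\<^sub>R diff_fun_star M A L' (pairing \<xi> Y) m) + (1/2) *\<^sub>R diff_fun_star M A L' h m)
     = ?v"
    using fib V by (simp add: add diff neg scale subspace_add subspace_diff subspace_neg subspace_scale)
  have "double_metric m (dorfman (double M A L L') e1 e2 m) (e3 m) =
     (lbracket L' \<xi> \<eta> m (Z m) + (lie_der M A L X \<eta> m (Z m) - (1/2) * diff_fun M A L (pairing \<eta> X) m (Z m))
       - (lie_der M A L Y \<xi> m (Z m) - (1/2) * diff_fun M A L (pairing \<xi> Y) m (Z m)) + (1/2) * diff_fun M A L h m (Z m))
     + ?v"
    unfolding 1[symmetric] dorfman_eq[OF assms(1,2)]
    by (simp add: double_metric_def split_beta X_def Y_def Z_def \<xi>_def \<eta>_def \<zeta>_def h_def)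
  then show ?thesis
    unfolding lie_der(2)[OF s(1,5,3)] lie_der(2)[OF s(2,4,3)] lie_der_star(2)[OF s(5,1,6)] lie_der_star(2)[OF s(4,2,6)]
      diff_fun(2)[OF pc(1) s(3)] diff_fun(2)[OF pc(2) s(3)] diff_fun(2)[OF hc s(3)]
      diff_fun_star(2)[OF pc(1) s(6)] diff_fun_star(2)[OF pc(2) s(6)] diff_fun_star(2)[OF hc s(6)]
    unfolding a_def[symmetric] a'_def[symmetric] ah ah' by (simp add: field_simps)
qed

text \<open>
  Under the exchange of \<open>e2\<close> and \<open>e3\<close> the terms of \<open>dorfman_metric\<close> cancel in pairs, by the skew-symmetry
  of the brackets, except for the derivatives along \<open>e1\<close> of the two summands of \<open>\<langle>e2, e3\<rangle>\<close>.
\<close>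

lemma dorfman_isometry:
  assumes e: "e1 \<in> Sec M E" "e2 \<in> Sec M E" "e3 \<in> Sec M E"
  shows "act \<rho> e1 (\<lambda>m. double_metric m (e2 m) (e3 m)) m =
    double_metric m (dorfman (double M A L L') e1 e2 m) (e3 m) + double_metric m (e2 m) (dorfman (double M A L L') e1 e3 m)"
proof -
  note s = E_SecD[OF e(1)] E_SecD[OF e(2)] E_SecD[OF e(3)]
  let ?f = "pairing (snd \<circ> e2) (fst \<circ> e3)" and ?g = "pairing (snd \<circ> e3) (fst \<circ> e2)"
  have C: "?f \<in> Cinf M" "?g \<in> Cinf M" by (intro pairing_Cinf s)+
  have "(\<lambda>m. double_metric m (e2 m) (e3 m)) = (\<lambda>m. ?f m + ?g m)"
    by (auto simp: double_metric_def split_beta pairing_def)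
  then have "act \<rho> e1 (\<lambda>m. double_metric m (e2 m) (e3 m)) m =
      act (lanchor L) (fst \<circ> e1) ?f m + act (lanchor L) (fst \<circ> e1) ?g m
    + (act (lanchor L') (snd \<circ> e1) ?f m + act (lanchor L') (snd \<circ> e1) ?g m)"
    unfolding act_rho
    using fun_derivationD(2)[OF anchor_derivation[OF lie_algebroidD(2)[OF LA] s(1)] C]
      fun_derivationD(2)[OF anchor_derivation[OF lie_algebroidD(2)[OF LD] s(2)] C] by simp
  moreover have "(snd \<circ> e1) m (lbracket L (fst \<circ> e3) (fst \<circ> e2) m) = - (snd \<circ> e1) m (lbracket L (fst \<circ> e2) (fst \<circ> e3) m)"
    using lie_algebroidD(5)[OF LA s(5,3)] dual_spaceD(2)[of "(snd \<circ> e1) m" "fiber A m" "lbracket L (fst \<circ> e2) (fst \<circ> e3) m" "-1"]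
      Sec_fiber[OF s(2), of m] Sec_fiber[OF lie_algebroidD(3)[OF LA s(3,5)], of m] by simp
  moreover have "lbracket L' (snd \<circ> e3) (snd \<circ> e2) m ((fst \<circ> e1) m) = - lbracket L' (snd \<circ> e2) (snd \<circ> e3) m ((fst \<circ> e1) m)"
    unfolding lie_algebroidD(5)[OF LD s(6,4)] by simp
  ultimately show ?thesis
    unfolding double_metric_sym[of m "e2 m"] dorfman_metric[OF e] dorfman_metric[OF e(1,3,2)] by linarith
qed

lemma lie_derivative_top:
  assumes "e \<in> Sec M E" "f \<in> Cinf M"
  shows "lie_derivative M (double M A L L') n e (smult f vol) = smult (act \<rho> e f) vol"
proof -
  have c: "cbundle (double M A L L') = E" "canchor (double M A L L') = \<rho>" by (simp_all add: double_def Let_def)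
  show ?thesis
    unfolding lie_derivative_def c
    by (rule leibniz_ext_top[where X = "act \<rho> e" and \<delta> = "dorfman (double M A L L') e",
        OF rho_derivation[OF assms(1)] dorfman_Sec[OF assms(1)] dorfman_isometry[OF assms(1)] assms(2)])
qed

end

section \<open>Naive cohomology in degree one\<close>

text \<open>
  With \<open>v = u - u m\<close> and \<open>k\<close> the entire function \<open>(exp t - 1) / t\<close>, the exponential is
  \<open>exp (u m) (1 + v k(v))\<close>. As \<open>v\<close> vanishes at \<open>m\<close> and \<open>k(0) = 1\<close>, the Leibniz rule leaves \<open>exp (u m) X(v)\<close>.
\<close>

lemma (in smooth_mfd) fun_derivation_exp:
  assumes X: "fun_derivation X" and u: "u \<in> Cinf M"
  shows "X (\<lambda>x. exp (u x)) m = exp (u m) * X u m"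
proof -
  define v where "v = (\<lambda>x. u x + - u m)"
  define k where "k = (\<lambda>x. exp_quotient_derivs 0 (v x))"
  have v: "v \<in> Cinf M" unfolding v_def by (rule Cinf_add[OF u Cinf_const])
  have k: "k \<in> Cinf M"
    unfolding k_def
    by (rule CinfI, rule smooth_fun_on_compose[where I = UNIV and h = exp_quotient_derivs])
       (use exp_quotient_derivs CinfD[OF v] in auto)
  have "exp (u x) = exp (u m) * (1 + v x * k x)" for x
  proof -
    have "exp (u x) = exp (u m) * exp (v x)" by (simp add: v_def flip: exp_add)
    then show ?thesis unfolding k_def exp_eq_quotient[of "v x", symmetric] .
  qed
  then have "(\<lambda>x. exp (u x)) = (\<lambda>x. exp (u m) * (1 + v x * k x))" by (rule ext)
  then have "X (\<lambda>x. exp (u x)) = X (\<lambda>x. exp (u m) * (1 + v x * k x))" by (rule arg_cong)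
  also have "\<dots> = (\<lambda>x. exp (u m) * X (\<lambda>x. 1 + v x * k x) x)"
    by (intro fun_derivation_cmult[OF X] Cinf_add Cinf_mult Cinf_const v k)
  also have "X (\<lambda>x. 1 + v x * k x) = (\<lambda>x. X (\<lambda>_. 1) x + X (\<lambda>x. v x * k x) x)"
    by (intro fun_derivationD(2)[OF X] Cinf_mult Cinf_const v k)
  also have "X (\<lambda>x. v x * k x) = (\<lambda>x. v x * X k x + k x * X v x)"
    by (rule fun_derivationD(3)[OF X v k])
  also have "X v = (\<lambda>x. X u x + X (\<lambda>_. - u m) x)"
    unfolding v_def by (rule fun_derivationD(2)[OF X u Cinf_const])
  finally show ?thesis
    by (simp add: fun_derivationD(4)[OF X] k_def v_def exp_quotient_derivs_0)
qed

text \<open>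
  The function \<open>g\<close> is \<open>ln \<bar>f\<bar>\<close>, written so that \<open>f\<close> may take both signs. Apply \<open>X\<close> to \<open>f\<^sup>2 = exp (2 g)\<close>.
\<close>

lemma (in smooth_mfd) fun_derivation_ln:
  assumes X: "fun_derivation X" and f: "f \<in> Cinf M" "\<And>x. f x \<noteq> 0"
  defines "g \<equiv> \<lambda>x. (1/2) * ln (f x * f x)"
  shows "g \<in> Cinf M" "X f m = f m * X g m"
proof -
  have pos: "f x * f x > 0" for x using f(2)[of x] by (simp add: zero_less_mult_iff linorder_neq_iff) linarith
  define h where "h = (\<lambda>x. ln (f x * f x))"
  have h: "h \<in> Cinf M"
    unfolding h_def by (rule CinfI, rule smooth_fun_on_ln[OF CinfD[OF Cinf_mult[OF f(1) f(1)]]]) (rule pos)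
  show "g \<in> Cinf M" unfolding g_def using Cinf_mult[OF Cinf_const h] unfolding h_def .
  have g: "X g m = (1/2) * X h m"
    unfolding g_def using fun_derivation_cmult[OF X h, of "1/2"] unfolding h_def by simp
  have "(\<lambda>x. exp (h x)) = (\<lambda>x. f x * f x)" using pos by (simp add: h_def)
  then have "f m * X f m + f m * X f m = (f m * f m) * X h m"
    using fun_derivation_exp[OF X h, of m] fun_derivationD(3)[OF X f(1) f(1)] by (metis (no_types, lifting))
  then have "f m * (2 * X f m) = f m * (f m * X h m)" by (simp add: algebra_simps)
  then have "2 * X f m = f m * X h m" using f(2)[of m] by simp
  then show "X f m = f m * X g m" unfolding g by simp
qed

lemma wedge_empty: "wedge V [] \<phi>s = (if \<phi>s = [] then 1 else 0)"
  by (simp add: wedge_def)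

lemma wedge_single: "wedge V [x] \<phi>s = (if length \<phi>s = 1 \<and> set \<phi>s \<subseteq> dual_space V then hd \<phi>s x else 0)"
proof -
  have "{p. p permutes {..<Suc 0}} = {id}" by (simp add: lessThan_Suc)
  then show ?thesis unfolding wedge_def by (cases \<phi>s) auto
qed

lemma wedge_single_sum:
  assumes "subspace V" "\<And>i. i < k \<Longrightarrow> v i \<in> V"
  shows "wedge V [\<Sum>i<k. c i *\<^sub>R v i] = (\<Sum>i<k. c i *\<^sub>R wedge V [v i])"
proof
  fix \<phi>s
  show "wedge V [\<Sum>i<k. c i *\<^sub>R v i] \<phi>s = (\<Sum>i<k. c i *\<^sub>R wedge V [v i]) \<phi>s"
  proof (cases "length \<phi>s = 1 \<and> set \<phi>s \<subseteq> dual_space V")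
    case True
    then have "hd \<phi>s \<in> dual_space V" by (cases \<phi>s) auto
    from dual_space_sum[OF this assms(1), of "{..<k}" v c] assms(2)
    show ?thesis using True by (simp add: wedge_single sum_fun_apply)
  next
    case False
    then show ?thesis by (simp only: wedge_single sum_fun_apply scaleR_fun_apply if_False) simp
  qed
qed

lemma frames_ext_bundle:
  "(U, ss) \<in> frames (ext_bundle B k) \<longleftrightarrow>
    (\<exists>es. (U, es) \<in> frames B \<and> ss = map (wedge_sec B) (filter (\<lambda>xs. length xs = k) (subseqs es)))"
  by (auto simp: ext_bundle_def)

lemma ext_power_outside:
  assumes "\<alpha> \<in> ext_power V U k" "\<not> (length \<phi>s = k \<and> set \<phi>s \<subseteq> dual_space V)"
  shows "\<alpha> \<phi>s = 0"
  using assms(1) unfolding ext_power_def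
proof (induction rule: span_induct)
  case base
  show ?case by (rule subspaceI) auto
next
  case (step \<beta>)
  then show ?case using assms(2) wedge_outside by blast
qed

context dual_algebroids
begin

abbreviation D where "D \<equiv> double M A L L'"

lemma double_simps: "cbundle D = E" "canchor D = \<rho>" "cmetric D = double_metric"
  by (simp_all add: double_def Let_def)

lemma form_eval_D: "form_eval D \<alpha> es m = \<alpha> m (map (\<lambda>e. flatE m (e m)) es)"
  unfolding form_eval_def multivector_eval_def flat_def flatE_def double_simps by (simp add: o_def)

text \<open>
  By non-degeneracy every covector at a point is the covector of the value of a global section.
\<close>

lemma form_eval_eqI:
  assumes "\<beta> \<in> Sec M (ext_bundle E k)" "\<gamma> \<in> Sec M (ext_bundle E k)"
    "\<And>es. length es = k \<Longrightarrow> set es \<subseteq> Sec M E \<Longrightarrow> form_eval D \<beta> es = form_eval D \<gamma> es"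
  shows "\<beta> = \<gamma>"
proof (intro ext)
  fix m \<phi>s
  have fib: "\<beta> m \<in> ext_power (fiber E m) (fiber E m) k" "\<gamma> m \<in> ext_power (fiber E m) (fiber E m) k"
    using Sec_fiber[OF assms(1), of m] Sec_fiber[OF assms(2), of m] unfolding fiber_ext_bundle by blast+
  show "\<beta> m \<phi>s = \<gamma> m \<phi>s"
  proof (cases "length \<phi>s = k \<and> set \<phi>s \<subseteq> dual_space (fiber E m)")
    case True
    have ex: "\<exists>e. e \<in> Sec M E \<and> flatE m (e m) = \<phi>" if "\<phi> \<in> set \<phi>s" for \<phi>
    proof -
      have "\<phi> \<in> dual_space (fiber E m)" using True that by blast
      then obtain y where y: "y \<in> fiber E m" "\<phi> = flatE m y" by (rule flatE_surj)
      obtain e where "e \<in> Sec M E" "e m = y" by (rule E_Sec_through[OF y(1)])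
      then show ?thesis using y(2) by blast
    qed
    define e where "e = (\<lambda>\<phi>. SOME e. e \<in> Sec M E \<and> flatE m (e m) = \<phi>)"
    have e: "e \<phi> \<in> Sec M E \<and> flatE m (e \<phi> m) = \<phi>" if "\<phi> \<in> set \<phi>s" for \<phi>
      unfolding e_def by (rule someI_ex[OF ex[OF that]])
    have "form_eval D \<beta> (map e \<phi>s) = form_eval D \<gamma> (map e \<phi>s)"
      using True e by (intro assms(3)) auto
    moreover have "map (\<lambda>\<phi>. flatE m (e \<phi> m)) \<phi>s = \<phi>s"
      using e by (simp add: map_idI)
    ultimately show ?thesis
      using form_eval_D[of \<beta> "map e \<phi>s" m] form_eval_D[of \<gamma> "map e \<phi>s" m] by (simp add: o_def)
  next
    case False
    then show ?thesis using ext_power_outside[OF fib(1)] ext_power_outside[OF fib(2)] by metis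
  qed
qed

lemma wedge_single_Sec:
  assumes "z \<in> Sec M E"
  shows "wedge_sec E [z] \<in> Sec M (ext_bundle E (Suc 0))"
proof (rule SecI, rule smooth_section_onI)
  show "wedge_sec E [z] m \<in> fiber (ext_bundle E (Suc 0)) m" for m
    unfolding fiber_ext_bundle wedge_sec_def using Sec_fiber[OF assms, of m]
    by (intro wedge_in_ext_power) (auto simp del: fiber_direct_sum)
  fix U ss assume "(U, ss) \<in> frames (ext_bundle E (Suc 0))"
  then obtain bs where bs: "(U, bs) \<in> frames E" "ss = map (wedge_sec E) (map (\<lambda>e. [e]) bs)"
    unfolding frames_ext_bundle filter_subseqs_length(2) by blast
  obtain c where c: "\<And>i. i < length bs \<Longrightarrow> smooth_fun_on M (U \<inter> UNIV) (c i)"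
    "\<And>m. m \<in> U \<Longrightarrow> m \<in> UNIV \<Longrightarrow> z m = (\<Sum>i<length bs. c i m *\<^sub>R (bs ! i) m)"
    by (rule smooth_section_onE[OF SecD[OF assms, of UNIV] bs(1)], rule that; assumption)
  show "\<exists>c. smooth_coords U UNIV ss (wedge_sec E [z]) c"
  proof (intro exI[of _ c] conjI allI impI ballI)
    fix m assume "m \<in> U \<inter> UNIV"
    then have m: "m \<in> U" by simp
    have "wedge (fiber E m) [\<Sum>i<length bs. c i m *\<^sub>R (bs ! i) m] = (\<Sum>i<length bs. c i m *\<^sub>R wedge (fiber E m) [(bs ! i) m])"
      by (rule wedge_single_sum[OF subspace_E]) (rule frame_E_fiber[OF bs(1) m])
    then show "wedge_sec E [z] m = (\<Sum>i<length ss. c i m *\<^sub>R (ss ! i) m)"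
      using c(2)[OF m] by (simp add: bs(2) wedge_sec_def del: fiber_direct_sum)
  qed (use c(1) bs(2) in simp)
qed

lemma form_eval_single:
  assumes "z \<in> Sec M E" "e \<in> Sec M E"
  shows "form_eval D (wedge_sec E [z]) [e] m = double_metric m (z m) (e m)"
proof -
  have "wedge (fiber E m) [z m] [flatE m (e m)] = flatE m (e m) (z m)"
    using flatE_dual[OF Sec_fiber[OF assms(2)]] by (simp add: wedge_single del: fiber_direct_sum)
  also have "\<dots> = double_metric m (z m) (e m)"
    using Sec_fiber[OF assms(1), of m] double_metric_sym by (simp add: flatE_def del: fiber_direct_sum)
  finally show ?thesis by (simp add: form_eval_D wedge_sec_def del: fiber_direct_sum)
qed

lemma naive_d_function:
  assumes "f \<in> Cinf M"
  shows "naive_d M D 0 (smult f (wedge_sec E [])) = wedge_sec E [grad f]"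
proof -
  have cartan: "cartan_formula \<rho> (courant_bracket D) (form_eval D (smult f (wedge_sec E []))) [e] = act \<rho> e f" for e
  proof -
    have "form_eval D (smult f (wedge_sec E [])) [] = f"
      by (auto simp: form_eval_D smult_def wedge_sec_def wedge_empty)
    then show ?thesis by (simp add: cartan_formula_def nths_singleton)
  qed
  have eval: "form_eval D (wedge_sec E [grad f]) [e] = act \<rho> e f" if "e \<in> Sec M E" for e
    using form_eval_single[OF grad(1)[OF assms] that] grad(2)[OF assms that] by auto
  have single: "\<exists>e. es = [e]" if "length es = Suc 0" for es :: "('m \<Rightarrow> 'v \<times> ('v \<Rightarrow> real)) list"
    using that by (auto simp: length_Suc_conv)
  let ?P = "\<lambda>\<beta>. \<beta> \<in> Sec M (ext_bundle E (Suc 0)) \<and> (\<forall>es. length es = Suc 0 \<and> set es \<subseteq> Sec M E \<longrightarrow>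
        form_eval D \<beta> es = cartan_formula \<rho> (courant_bracket D) (form_eval D (smult f (wedge_sec E []))) es)"
  have P: "?P (wedge_sec E [grad f])"
    using wedge_single_Sec[OF grad(1)[OF assms]] cartan eval by (auto dest!: single)
  have "\<beta> = wedge_sec E [grad f]" if "?P \<beta>" for \<beta>
    using that P by (intro form_eval_eqI[of _ "Suc 0"]) auto
  then show ?thesis
    unfolding naive_d_def double_simps using P by (intro the_equality) blast+
qed

lemma naive_cochains_0: "naive_cochains M D 0 = {smult f (wedge_sec E []) | f. f \<in> Cinf M}"
proof (intro equalityI subsetI)
  fix \<alpha> assume "\<alpha> \<in> naive_cochains M D 0"
  then have \<alpha>: "\<alpha> \<in> Sec M (ext_bundle E 0)" unfolding naive_cochains_def double_simps by blast
  have "\<exists>f. f \<in> Cinf M \<and> \<alpha> = smult f (wedge_sec E [])"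
  proof (rule line_section_coefficient[OF \<alpha>, of "wedge_sec E []"])
    show "wedge_sec E [] m \<noteq> 0" for m
      using wedge_empty[of "fiber E m" "[]"] by (auto simp: wedge_sec_def)
    fix m
    obtain U es where fr: "(U, es) \<in> frames A" "m \<in> U" using vb_frame_ex[OF vbA] .
    have "(U, [wedge_sec E []]) \<in> frames (ext_bundle E 0)"
      unfolding frames_ext_bundle filter_subseqs_length(1) using frames_E_hyperbolic[OF fr(1)] by auto
    then show "\<exists>U t. (U, [t]) \<in> frames (ext_bundle E 0) \<and> open U \<and> m \<in> U \<and> (\<forall>x\<in>U. t x = wedge_sec E [] x)"
      using fr(2) vb_frame(1)[OF vbA fr(1)] by blast
  qed blast
  then show "\<alpha> \<in> {smult f (wedge_sec E []) | f. f \<in> Cinf M}" by blast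
next
  fix \<alpha> assume "\<alpha> \<in> {smult f (wedge_sec E []) | f. f \<in> Cinf M}"
  then obtain f where f: "f \<in> Cinf M" "\<alpha> = smult f (wedge_sec E [])" by blast
  have in0: "\<alpha> m \<in> ext_power (fiber E m) U 0" for m U
    unfolding f(2) smult_def wedge_sec_def
    by (intro subspace_scale subspace_ext_power wedge_in_ext_power) auto
  have "\<alpha> \<in> Sec M (ext_bundle E 0)"
  proof (rule SecI, rule smooth_section_onI)
    show "\<alpha> m \<in> fiber (ext_bundle E 0) m" for m unfolding fiber_ext_bundle by (rule in0)
    fix U ss assume "(U, ss) \<in> frames (ext_bundle E 0)"
    then have ss: "ss = [wedge_sec E []]" unfolding frames_ext_bundle filter_subseqs_length(1) by auto
    show "\<exists>c. smooth_coords U UNIV ss \<alpha> c"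
      by (intro exI[of _ "\<lambda>_. f"]) (simp add: ss f(2) CinfD[OF f(1)] smult_def)
  qed
  then show "\<alpha> \<in> naive_cochains M D 0" unfolding naive_cochains_def double_simps using in0 by blast
qed

lemma naive_coboundaries_1: "naive_coboundaries M D 1 = {wedge_sec E [grad f] | f. f \<in> Cinf M}"
  unfolding One_nat_def naive_coboundaries.simps naive_cochains_0 setcompr_eq_image image_image
  by (rule image_cong[OF refl]) (simp add: naive_d_function)

lemma wedge_grad_add:
  assumes "f \<in> Cinf M" "g \<in> Cinf M"
  shows "wedge_sec E [grad f] + wedge_sec E [grad g] = wedge_sec E [grad (\<lambda>x. f x + g x)]"
proof -
  note fg = Cinf_add[OF assms]
  have "(\<lambda>m. grad f m + grad g m) = grad (\<lambda>x. f x + g x)"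
  proof (rule E_section_eqI[OF E_Sec_add[OF grad(1) grad(1)] grad(1)])
    fix e m assume e: "e \<in> Sec M E"
    show "double_metric m (grad f m + grad g m) (e m) = double_metric m (grad (\<lambda>x. f x + g x) m) (e m)"
      unfolding grad(2)[OF fg e] fun_derivationD(2)[OF rho_derivation[OF e] assms]
      unfolding grad(2)[OF assms(1) e, symmetric] grad(2)[OF assms(2) e, symmetric]
      using double_metric_add[OF Sec_fiber[OF e] Sec_fiber[OF grad(1)[OF assms(1)]] Sec_fiber[OF grad(1)[OF assms(2)]]]
      by (simp add: double_metric_sym)
  qed (use assms fg in auto)
  moreover have "wedge_sec E [grad f] + wedge_sec E [grad g] = wedge_sec E [\<lambda>m. grad f m + grad g m]"
  proof
    fix m
    \<comment> \<open>a sum of two terms, as an instance of \<open>wedge_single_sum\<close>\<close>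
    have "wedge (fiber E m) [\<Sum>i<2::nat. 1 *\<^sub>R (if i = 0 then grad f m else grad g m)] =
      (\<Sum>i<2::nat. 1 *\<^sub>R wedge (fiber E m) [if i = 0 then grad f m else grad g m])"
      using Sec_fiber[OF grad(1)[OF assms(1)], of m] Sec_fiber[OF grad(1)[OF assms(2)], of m]
      by (intro wedge_single_sum[OF subspace_E]) (simp del: fiber_direct_sum)
    then show "(wedge_sec E [grad f] + wedge_sec E [grad g]) m = wedge_sec E [\<lambda>m. grad f m + grad g m] m"
      by (simp add: wedge_sec_def eval_nat_numeral del: fiber_direct_sum)
  qed
  ultimately show ?thesis by simp
qed

text \<open>
  The coboundaries are a group, and \<open>wedge_sec E [grad g]\<close> is one of them.
\<close>

lemma naive_class_grad:
  assumes "g \<in> Cinf M"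
  shows "naive_class M D 1 (wedge_sec E [grad g]) = naive_coboundaries M D 1"
proof -
  have "wedge_sec E [grad f] = wedge_sec E [grad g] + wedge_sec E [grad (\<lambda>x. f x - g x)]" if "f \<in> Cinf M" for f
    using wedge_grad_add[OF assms Cinf_diff[OF that assms]] by simp
  then show ?thesis
    unfolding naive_class_def naive_coboundaries_1
    using wedge_grad_add[OF assms] Cinf_add[OF assms] Cinf_diff[OF _ assms] by blast
qed

lemma naive_class_0: "naive_class M D 1 0 = naive_coboundaries M D 1"
  unfolding naive_class_def by simp

lemma zero_naive_cocycle: "0 \<in> naive_cocycles M D 1"
proof -
  have sec0: "0 \<in> Sec M (ext_bundle E k)" for k
  proof -
    have "(\<lambda>_. 0) \<in> Sec M (ext_bundle E k)"
      by (rule SecI, rule smooth_section_on_zero) (unfold fiber_ext_bundle, rule subspace_ext_power)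
    moreover have "(\<lambda>_. 0) = (0 :: 'm \<Rightarrow> ('v \<times> ('v \<Rightarrow> real) \<Rightarrow> real) list \<Rightarrow> real)" by auto
    ultimately show ?thesis by metis
  qed
  have e0: "form_eval D 0 es = (\<lambda>_. 0)" for es
    by (auto simp: form_eval_D)
  have c0: "cartan_formula \<rho> (courant_bracket D) (form_eval D 0) es = (\<lambda>_. 0)" if "set es \<subseteq> Sec M E" for es
  proof -
    have "act \<rho> (es ! i) (\<lambda>_. 0) = (\<lambda>_. 0)" if "i < length es" for i
      using fun_derivationD(4)[OF rho_derivation, of "es ! i" 0] that nth_mem[OF that] \<open>set es \<subseteq> Sec M E\<close> by blast
    then show ?thesis by (simp add: cartan_formula_def e0)
  qed
  have "naive_d M D 1 0 = 0"
    unfolding naive_d_def double_simps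
  proof (rule the_equality)
    fix \<beta> assume \<beta>: "\<beta> \<in> Sec M (ext_bundle E (Suc 1)) \<and> (\<forall>es. length es = Suc 1 \<and> set es \<subseteq> Sec M E \<longrightarrow>
        form_eval D \<beta> es = cartan_formula \<rho> (courant_bracket D) (form_eval D 0) es)"
    show "\<beta> = 0"
      by (rule form_eval_eqI[of _ "Suc 1"]) (use \<beta> sec0 c0 e0 in auto)
  qed (use sec0 c0 e0 in auto)
  moreover have "0 \<in> naive_cochains M D 1"
    unfolding naive_cochains_def double_simps using sec0[of 1] by (simp add: subspace_0[OF subspace_ext_power])
  ultimately show ?thesis unfolding naive_cocycles_def by simp
qed

section \<open>The modular class of the double\<close>

lemma vol_nowhere_vanishing: "nowhere_vanishing M S vol"
  unfolding nowhere_vanishing_def using vol_Sec vol_nonzero by blast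

text \<open>
  For \<open>s = f vol\<close> the defining equation reads \<open>\<rho>(e) f = \<langle>\<theta>, e\<rangle> f\<close>, that is \<open>\<langle>\<theta>, e\<rangle> = \<rho>(e) (ln \<bar>f\<bar>)\<close>.
\<close>

lemma characteristic_section_grad:
  assumes s: "nowhere_vanishing M S s" and \<theta>: "characteristic_section M D (lie_derivative M D n) s \<theta>"
  obtains g where "g \<in> Cinf M" "\<theta> = grad g"
proof -
  have "s \<in> Sec M S" using s unfolding nowhere_vanishing_def by blast
  then obtain f where f: "f \<in> Cinf M" "s = smult f vol" by (rule Sec_S_coef)
  have f0: "f m \<noteq> 0" for m
  proof
    assume "f m = 0"
    then have "s m = 0" by (simp add: f(2) smult_def)
    then show False using s unfolding nowhere_vanishing_def by blast
  qed
  let ?g = "\<lambda>x. (1/2) * ln (f x * f x)"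
  have \<theta>S: "\<theta> \<in> Sec M E" using \<theta> unfolding characteristic_section_def double_simps by blast
  have "\<theta> = grad ?g" if g: "?g \<in> Cinf M"
  proof (rule E_section_eqI[OF \<theta>S grad(1)[OF g]])
    fix e m assume e: "e \<in> Sec M E"
    have "smult (act \<rho> e f) vol = smult (\<lambda>m. double_metric m (\<theta> m) (e m)) (smult f vol)"
      using \<theta> e lie_derivative_top[OF e f(1)] unfolding characteristic_section_def double_simps f(2) by simp
    from fun_cong[OF this, of m] have "act \<rho> e f m *\<^sub>R vol m = (double_metric m (\<theta> m) (e m) * f m) *\<^sub>R vol m"
      by (simp add: smult_def)
    then have "act \<rho> e f m = double_metric m (\<theta> m) (e m) * f m"
      unfolding scaleR_cancel_right using vol_nonzero by blast
    moreover have "act \<rho> e f m = f m * act \<rho> e ?g m" by (rule fun_derivation_ln(2)[OF rho_derivation[OF e] f(1) f0])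
    ultimately show "double_metric m (\<theta> m) (e m) = double_metric m (grad ?g m) (e m)"
      unfolding grad(2)[OF g e] using f0[of m] by simp
  qed
  moreover have "?g \<in> Cinf M"
    by (rule fun_derivation_ln(1)[OF rho_derivation[OF grad(1)[OF f(1)]] f(1) f0])
  ultimately show ?thesis using that by blast
qed

lemma characteristic_section_vol: "characteristic_section M D (lie_derivative M D n) vol (grad (\<lambda>_. 0))"
  unfolding characteristic_section_def double_simps
proof (intro conjI ballI)
  show "grad (\<lambda>_. 0) \<in> Sec M E" by (rule grad(1)[OF Cinf_const])
  fix e assume e: "e \<in> Sec M E"
  have vol1: "vol = smult (\<lambda>_. 1) vol" by (simp add: smult_def)
  have "lie_derivative M D n e (smult (\<lambda>_. 1) vol) = smult (act \<rho> e (\<lambda>_. 1)) vol"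
    by (rule lie_derivative_top[OF e Cinf_const])
  then show "lie_derivative M D n e vol = smult (\<lambda>m. double_metric m (grad (\<lambda>_. 0) m) (e m)) vol"
    unfolding vol1[symmetric] grad(2)[OF Cinf_const e] fun_derivationD(4)[OF rho_derivation[OF e]] .
qed

text \<open>
  As \<open>vol\<close> vanishes nowhere, the first branch of the definition applies. By
  \<open>characteristic_section_grad\<close> all admissible sections give the same coset, and \<open>vol\<close> is admissible.
\<close>

theorem modular_class_double: "modular_class M D = naive_class M D 1 0"
proof -
  let ?B = "naive_coboundaries M D 1"
  have "modular_class M D = (THE c. c \<in> naive_cohomology M D 1 \<and>
        (\<exists>s \<theta>. nowhere_vanishing M S s \<and> characteristic_section M D (lie_derivative M D n) s \<theta> \<and>
           c = naive_class M D 1 (wedge_sec E [\<theta>])))"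
    unfolding modular_class_def Let_def double_simps using vol_nowhere_vanishing by (subst if_P) blast+
  also have "\<dots> = ?B"
  proof (rule the_equality)
    show "?B \<in> naive_cohomology M D 1 \<and>
        (\<exists>s \<theta>. nowhere_vanishing M S s \<and> characteristic_section M D (lie_derivative M D n) s \<theta> \<and>
           ?B = naive_class M D 1 (wedge_sec E [\<theta>]))"
      using vol_nowhere_vanishing characteristic_section_vol naive_class_grad[OF Cinf_const, of 0]
        zero_naive_cocycle naive_class_0 unfolding naive_cohomology_def by blast
    fix c assume "c \<in> naive_cohomology M D 1 \<and>
        (\<exists>s \<theta>. nowhere_vanishing M S s \<and> characteristic_section M D (lie_derivative M D n) s \<theta> \<and>
           c = naive_class M D 1 (wedge_sec E [\<theta>]))"
    then obtain s \<theta> where "nowhere_vanishing M S s" "characteristic_section M D (lie_derivative M D n) s \<theta>"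
      "c = naive_class M D 1 (wedge_sec E [\<theta>])" by blast
    then show "c = ?B" using characteristic_section_grad naive_class_grad by metis
  qed
  finally show ?thesis unfolding naive_class_0 .
qed

end

theorem theorem5p1:
  fixes M :: "('m::{t2_space, second_countable_topology}, 'a::euclidean_space) manifold"
    and A :: "('m, 'v::real_vector) vbundle"
    and L :: "('m, 'v) lie_structure"
    and L' :: "('m, 'v \<Rightarrow> real) lie_structure"
  assumes "smooth_manifold M"
    and "lie_bialgebroid M A L L'"
  shows "modular_class M (double M A L L') = naive_class M (double M A L L') 1 0"
proof -
  interpret dual_algebroids M A L L'
    using assms unfolding lie_bialgebroid_def by unfold_locales auto
  show ?thesis by (rule modular_class_double)
qed

end
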